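(* Let $k$ be a field and let $g:\mathbb{Z}_{>0}\to k$ be a function. For $n\ge 1$ let $\mathcal{F}_n$ be the (finite) set of series-reduced planar forests on $n$ leaves, and define $h:\mathbb{Z}_{>0}\to k$ by $$h(n)=\sum_{F\in\mathcal{F}_n}\ \prod_{v\in\mathcal{V}_{\mathrm{int}}(F)} g(\deg(v)),$$ where $\mathcal{V}_{\mathrm{int}}(F)$ is the set of internal vertices of $F$ (so $h(1)=g(1)$, and $g(2)$ is irrelevant). Let $G(x)=\sum_{n\ge 3}g(n)x^n$ and $H_{\mathrm{forest}}(x)=1+\sum_{n\ge 1}h(n)x^n$ in $k[[x]]$. Then $$x\,H_{\mathrm{forest}}(x)=\left(\frac{x}{1+\hat H_{\mathrm{tree}}(x)}\right)^{\langle -1\rangle}=\left(\frac{x}{1+h(1)x+x\left(x-\frac{G(x)}{x}\right)^{\langle -1\rangle}}\right)^{\langle -1\rangle},$$ where $\hat H_{\mathrm{tree}}(x)=\sum_{n\ge 1}\Big(\sum_{T\in\mathcal{T}_n}\prod_{v\in\mathcal{V}_{\mathrm{int}}(T)}g(\deg(v))\Big)x^n$ and $\mathcal{T}_n$ is the set of series-reduced planar trees on $n$ leaves.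
   Context: For a power series $f\in k[[x]]$ with zero constant term, $f^{\langle -1\rangle}$ denotes its compositional inverse: the power series $g$ with $f(g(x))=g(f(x))=x$. A planar forest on $n$ leaves is an acyclic graph properly embedded in a closed disk, considered up to homeomorphism, having $n$ boundary vertices, each of degree one, lying on the boundary of the disk and labelled $1,2,\dots,n$ in clockwise order; all other vertices are internal vertices, lie in the interior of the disk, and are path-connected to the boundary of the disk. A planar tree is a connected planar forest. It is series-reduced if it has no internal vertex of degree $2$. $\mathcal{T}_n$ (resp. $\mathcal{F}_n$) is the set of series-reduced planar trees (resp. forests) on $n$ leaves. For $n\ge 3$ all internal vertices of a tree in $\mathcal{T}_n$ have degree at least $3$, and $\mathcal{T}_n$ is in bijection with the dissections of a convex $n$-gon by pairwise non-crossing diagonals, an internal vertex of degree $d$ corresponding to a $d$-gonal cell. $\mathcal{T}_2$ consists of the single edge joining the two boundary vertices, with no internal vertices. $\mathcal{T}_1$ consists of one tree: one boundary vertex joined by an edge to one internal vertex of degree $1$. Equivalently, an element of $\mathcal{F}_n$ is a non-crossing partition of $\{1,\dots,n\}$ together with a choice, for each block of size $b$, of an element of $\mathcal{T}_b$ placed on the boundary vertices in that block (in their induced cyclic order). *)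

theory Defs
  imports
    "HOL-Combinatorics.Combinatorics"
    "HOL-Computational_Algebra.Formal_Power_Series"
begin

text \<open>
  Embedded graphs up to homeomorphism are encoded in the standard way, as combinatorial maps up to
  isomorphism. Every edge consists of two darts (its two directed versions), interchanged by
  \<open>opp\<close>; \<open>rot\<close> sends a dart to the next dart in clockwise order around its start vertex. Thus
  the vertices are the orbits of \<open>rot\<close>, and the degree of a vertex is the size of its orbit.
  In a graph with boundary vertices \<open>1, \<dots>, n\<close>, all of degree one, the only dart starting at the
  \<open>i\<close>-th boundary vertex is the number \<open>i\<close> itself.
  An isolated vertex has no dart and cannot be represented, but none occurs here: boundary
  vertices have degree one and internal vertices are connected to the boundary.
\<close>

record dart_map =
  darts :: "nat set"
  opp :: "nat \<Rightarrow> nat"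
  rot :: "nat \<Rightarrow> nat"

definition wf_map :: "nat \<Rightarrow> dart_map \<Rightarrow> bool" where
  "wf_map n M \<longleftrightarrow>
     finite (darts M) \<and> {1..n} \<subseteq> darts M \<and>
     opp M permutes darts M \<and> (\<forall>d\<in>darts M. opp M d \<noteq> d \<and> opp M (opp M d) = d) \<and>
     rot M permutes darts M \<and> (\<forall>i\<in>{1..n}. rot M i = i)"

definition internal_vertices :: "nat \<Rightarrow> dart_map \<Rightarrow> nat set set" where
  "internal_vertices n M = {orbit (rot M) d | d. d \<in> darts M - {1..n}}"

text \<open>Since \<open>opp\<close> and \<open>rot\<close> have finite order on the darts, the following reachability relation is
  already symmetric there.\<close>

definition linked :: "dart_map \<Rightarrow> nat \<Rightarrow> nat \<Rightarrow> bool" where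
  "linked M = (\<lambda>d e. e = opp M d \<or> e = rot M d)\<^sup>*\<^sup>*"

definition connected_map :: "dart_map \<Rightarrow> bool" where
  "connected_map M \<longleftrightarrow> (\<forall>d\<in>darts M. \<forall>e\<in>darts M. linked M d e)"

text \<open>Acyclicity of the graph (loops and multiple edges count as cycles): there is no closed walk
  without backtracking. Here \<open>d\<close> may be followed by any dart \<open>e\<close> which starts where \<open>d\<close> ends,
  except the reverse of \<open>d\<close>.\<close>

definition acyclic_map :: "dart_map \<Rightarrow> bool" where
  "acyclic_map M \<longleftrightarrow>
     acyclic {(d, e). d \<in> darts M \<and> e \<in> orbit (rot M) (opp M d) \<and> e \<noteq> opp M d}"

definition cyclic_less :: "nat \<Rightarrow> nat \<Rightarrow> nat \<Rightarrow> bool" where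
  "cyclic_less a b c \<longleftrightarrow> a < b \<and> b < c \<or> b < c \<and> c < a \<or> c < a \<and> a < b"

text \<open>Walking along the contour of a component means iterating \<open>rot \<circ> opp\<close>. The
  relation below says that \<open>j\<close> is the first boundary vertex met after \<open>i\<close>.\<close>

definition next_leaf :: "nat \<Rightarrow> dart_map \<Rightarrow> nat \<Rightarrow> nat \<Rightarrow> bool" where
  "next_leaf n M i j \<longleftrightarrow> i \<in> {1..n} \<and> j \<in> {1..n} \<and>
     (\<exists>k>0. ((rot M \<circ> opp M) ^^ k) i = j \<and>
        (\<forall>m. 0 < m \<and> m < k \<longrightarrow> ((rot M \<circ> opp M) ^^ m) i \<notin> {1..n}))"

text \<open>The combinatorial condition for an acyclic graph, each of whose components meets the boundary,
  to be properly embedded in the disk with the rotations \<open>rot\<close> and with the boundary vertices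
  \<open>1, \<dots>, n\<close> in clockwise order: the contour of each component meets its boundary vertices in
  clockwise order, and different components do not cross.\<close>

definition disk_planar :: "nat \<Rightarrow> dart_map \<Rightarrow> bool" where
  "disk_planar n M \<longleftrightarrow>
     (\<forall>i j l. next_leaf n M i j \<and> l \<in> {1..n} \<and> linked M i l \<longrightarrow> \<not> cyclic_less i l j) \<and>
     (\<forall>a\<in>{1..n}. \<forall>b\<in>{1..n}. \<forall>c\<in>{1..n}. \<forall>d\<in>{1..n}.
        a < b \<and> b < c \<and> c < d \<and> linked M a c \<and> linked M b d \<longrightarrow> linked M a b)"

definition planar_forest_map :: "nat \<Rightarrow> dart_map \<Rightarrow> bool" where
  "planar_forest_map n M \<longleftrightarrow>
     wf_map n M \<and> acyclic_map M \<and>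
     (\<forall>d\<in>darts M. \<exists>i\<in>{1..n}. linked M d i) \<and> disk_planar n M"

text \<open>Besides degree 2, dangling internal vertices have to be excluded: an internal vertex of degree 1
  occurs only in the unique tree with one leaf, i.e. when its neighbour is a boundary vertex
  (which itself has degree one). Otherwise internal vertices of degree 1 could be attached
  anywhere, and there would be infinitely many trees with a given number of leaves.\<close>

definition series_reduced :: "nat \<Rightarrow> dart_map \<Rightarrow> bool" where
  "series_reduced n M \<longleftrightarrow>
     (\<forall>v\<in>internal_vertices n M. card v \<noteq> 2 \<and> (card v = 1 \<longrightarrow> opp M ` v \<subseteq> {1..n}))"

definition map_iso :: "nat \<Rightarrow> (dart_map \<times> dart_map) set" where
  "map_iso n = {(M, N). wf_map n M \<and> wf_map n N \<and> (\<exists>f.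
       bij_betw f (darts M) (darts N) \<and> (\<forall>i\<in>{1..n}. f i = i) \<and>
       (\<forall>d\<in>darts M. f (opp M d) = opp N (f d) \<and> f (rot M d) = rot N (f d)))}"

definition planar_forests :: "nat \<Rightarrow> dart_map set set" where
  "planar_forests n = {M. planar_forest_map n M \<and> series_reduced n M} // map_iso n"

definition planar_trees :: "nat \<Rightarrow> dart_map set set" where
  "planar_trees n =
     {M. planar_forest_map n M \<and> series_reduced n M \<and> connected_map M} // map_iso n"

definition map_weight :: "(nat \<Rightarrow> 'k::field) \<Rightarrow> nat \<Rightarrow> dart_map \<Rightarrow> 'k" where
  "map_weight g n M = (\<Prod>v\<in>internal_vertices n M. g (card v))"

text \<open>Isomorphic maps have the same weight, so the weight of an isomorphism class is the
  single element of the image below.\<close>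

definition class_weight :: "(nat \<Rightarrow> 'k::field) \<Rightarrow> nat \<Rightarrow> dart_map set \<Rightarrow> 'k" where
  "class_weight g n F = the_elem (map_weight g n ` F)"

definition forest_sum :: "(nat \<Rightarrow> 'k::field) \<Rightarrow> nat \<Rightarrow> 'k" where
  "forest_sum g n = (\<Sum>F\<in>planar_forests n. class_weight g n F)"

definition tree_sum :: "(nat \<Rightarrow> 'k::field) \<Rightarrow> nat \<Rightarrow> 'k" where
  "tree_sum g n = (\<Sum>T\<in>planar_trees n. class_weight g n T)"

end

theory Submission
  imports Defs "HOL-Library.Countable"
begin

text \<open>
  The edge entered through a dart \<open>d\<close> of a forest has a plane tree hanging behind it, whose leaves
  are labelled by boundary vertices. Reading this tree off at the smallest leaf of every component
  gives an isomorphism invariant of the forest, its code. It is a complete invariant: each dart is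
  determined by the pair of trees at its two ends, and reversing or rotating a dart acts on these
  pairs by explicit formulas. The same formulas turn every admissible code into a map. Planarity means
  that the contour visits the leaves in increasing order and that blocks do not cross, so the
  sums over isomorphism classes become sums over non-crossing families of plane trees with increasing
  leaf words. Splitting a tree at its root vertex gives \<open>Y = x + (G / x) (Y)\<close> for the trees with
  a given leaf word, and splitting off the tree containing the first leaf, which leaves one forest in each
  gap, gives \<open>F = 1 + H_tree (x F)\<close>.
\<close>

section \<open>Darts of a planar forest and the trees behind them\<close>

text \<open>Darts have no canonical names, which is the obstacle to describing isomorphism classes.
  Labelled leaves remove it: a dart at a boundary vertex is recognised by its label, and recognition
  spreads along \<open>opp\<close> and \<open>rot\<close>, so an automorphism fixing the leaves is
  trivial. Acyclicity enters as termination: a walk without backtracking runs into ever smaller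
  trees, which makes the tree behind a dart definable by recursion. Rooting at a leaf explains the
  index shifts. A node with \<open>d\<close> children is a vertex of degree \<open>d + 1\<close>,
  whence \<open>G / x\<close>; a tree on \<open>n\<close> leaves is a plane tree with
  \<open>n - 1\<close> leaves hung on its smallest leaf, whence
  \<open>H_tree = g(1) x + x Y\<close>. The term \<open>g(1) x\<close> is the one-leaf tree, coded
  by \<open>Node []\<close>, which never occurs inside a larger tree. The series start out as
  compositional inverses whose coefficients obey recursions; sums over trees and forests are matched
  with them by strong induction on the number of leaves. A first tree on \<open>m + 1\<close> leaves
  leaves \<open>m + 1\<close> gaps, one after each of its leaves, so it contributes
  \<open>(x F)^(m+1)\<close>.\<close>

datatype ltree = Leaf nat | Node "ltree list"

primrec leaves :: "ltree \<Rightarrow> nat list" where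
  "leaves (Leaf i) = [i]"
| "leaves (Node ts) = concat (map leaves ts)"

text \<open>A dart is represented by the pair of trees beyond its two ends, first the one it points to; then
  \<open>edge_rot\<close> passes to the next dart with the same start vertex.\<close>

fun edge_rot :: "ltree \<times> ltree \<Rightarrow> ltree \<times> ltree" where
  "edge_rot (t, Node (s # ss)) = (s, Node (ss @ [t]))"
| "edge_rot p = p"

lemma inj_edge_rot: "edge_rot p = edge_rot q \<Longrightarrow> p = q"
  by (cases p rule: edge_rot.cases; cases q rule: edge_rot.cases) auto

text \<open>If \<open>E\<close> holds one dart of every component, the closure is the whole dart
  set, since \<open>opp\<close> and \<open>rot\<close> generate the relation
  \<open>linked\<close>.\<close>

inductive_set edge_closure :: "(ltree \<times> ltree) set \<Rightarrow> (ltree \<times> ltree) set" for E where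
  base: "p \<in> E \<Longrightarrow> p \<in> edge_closure E"
| swap: "p \<in> edge_closure E \<Longrightarrow> prod.swap p \<in> edge_closure E"
| rot: "p \<in> edge_closure E \<Longrightarrow> edge_rot p \<in> edge_closure E"

section \<open>Orbits and linkage in a finite dart map\<close>

locale wf_dart_map =
  fixes n :: nat and M :: dart_map
  assumes wf: "wf_map n M"
begin

lemma finite_darts: "finite (darts M)"
  and leaf_dart: "i \<in> {1..n} \<Longrightarrow> i \<in> darts M"
  and opp_permutes: "opp M permutes darts M"
  and rot_permutes: "rot M permutes darts M"
  and opp_neq: "d \<in> darts M \<Longrightarrow> opp M d \<noteq> d"
  and rot_leaf: "i \<in> {1..n} \<Longrightarrow> rot M i = i"
  using wf by (auto simp: wf_map_def)

lemma opp_opp [simp]: "opp M (opp M d) = d"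
  by (cases "d \<in> darts M") (use wf in \<open>auto simp: wf_map_def permutes_not_in\<close>)

lemma opp_in [simp]: "opp M d \<in> darts M \<longleftrightarrow> d \<in> darts M"
  by (meson opp_permutes permutes_in_image)

lemma rot_in [simp]: "rot M d \<in> darts M \<longleftrightarrow> d \<in> darts M"
  by (meson rot_permutes permutes_in_image)

lemma opp_eq_iff [simp]: "opp M d = opp M e \<longleftrightarrow> d = e"
  by (metis opp_opp)

lemma rot_permutation: "permutation (rot M)"
  using finite_darts rot_permutes permutation_permutes by blast

lemma self_in_orbit [simp]: "d \<in> orbit (rot M) d"
  by (rule permutation_self_in_orbit[OF rot_permutation])

lemma orbit_eq: "e \<in> orbit (rot M) d \<Longrightarrow> orbit (rot M) e = orbit (rot M) d"
  by (meson orbit_cyclic_eq3 cyclic_on_orbit' rot_permutation)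

lemma orbit_sym: "e \<in> orbit (rot M) d \<Longrightarrow> d \<in> orbit (rot M) e"
  using orbit_eq self_in_orbit by blast

lemma orbit_darts: "e \<in> orbit (rot M) d \<Longrightarrow> e \<in> darts M \<longleftrightarrow> d \<in> darts M"
  by (metis orbit_sym permutes_orbit_subset rot_permutes subsetD)

lemma orbit_leaf: "i \<in> {1..n} \<Longrightarrow> orbit (rot M) i = {i}"
  using orbit_eq_singleton_iff rot_leaf by metis

lemma orbit_eq_leaf: "e \<in> orbit (rot M) d \<Longrightarrow> e \<in> {1..n} \<or> d \<in> {1..n} \<Longrightarrow> e = d"
  by (metis orbit_leaf orbit_sym singletonD)

lemma card_orbit: "card (orbit (rot M) d) = funpow_dist1 (rot M) d d"
proof -
  have "orbit (rot M) d = (\<lambda>n. (rot M ^^ n) d) ` {0..<funpow_dist1 (rot M) d d}"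
    by (rule orbit_conv_funpow_dist1) simp
  moreover have "inj_on (\<lambda>n. (rot M ^^ n) d) {0..<funpow_dist1 (rot M) d d}"
    by (rule inj_on_funpow_dist1) simp
  ultimately show ?thesis by (simp add: card_image)
qed

lemma orbit_conv_funpow: "orbit (rot M) d = (\<lambda>j. (rot M ^^ j) d) ` {0..<card (orbit (rot M) d)}"
  unfolding card_orbit by (rule orbit_conv_funpow_dist1) simp

lemma inj_on_funpow_rot: "inj_on (\<lambda>j. (rot M ^^ j) d) {0..<card (orbit (rot M) d)}"
  unfolding card_orbit by (rule inj_on_funpow_dist1) simp

lemma funpow_card_orbit: "(rot M ^^ card (orbit (rot M) d)) d = d"
  unfolding card_orbit by (rule funpow_dist1_prop) simp

lemma card_orbit_pos: "0 < card (orbit (rot M) d)"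
  by (simp add: card_orbit)

lemma linked_refl [simp]: "linked M d d"
  by (simp add: linked_def)

lemma linked_trans: "linked M d e \<Longrightarrow> linked M e f \<Longrightarrow> linked M d f"
  unfolding linked_def by (rule rtranclp_trans)

lemma linked_opp: "linked M d (opp M d)" and linked_rot: "linked M d (rot M d)"
  by (auto simp: linked_def)

lemma linked_induct [consumes 1, case_names refl opp rot]:
  assumes "linked M d e" "P d" "\<And>e. linked M d e \<Longrightarrow> P e \<Longrightarrow> P (opp M e)"
    "\<And>e. linked M d e \<Longrightarrow> P e \<Longrightarrow> P (rot M e)"
  shows "P e"
  using assms(1) unfolding linked_def
proof (induction rule: rtranclp_induct)
  case base show ?case by (rule assms(2))
next
  case (step e f)
  then have "linked M d e" by (simp add: linked_def)
  from step(2) show ?case using assms(3,4)[OF \<open>linked M d e\<close> step(3)] by metis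
qed

lemma linked_orbit: "e \<in> orbit (rot M) d \<Longrightarrow> linked M d e"
  by (induction rule: orbit.induct) (rule linked_rot, rule linked_trans[OF _ linked_rot])

lemma linked_sym: "linked M d e \<Longrightarrow> linked M e d"
proof (induction rule: linked_induct)
  case (opp e)
  have "linked M (opp M e) e" using linked_opp[of "opp M e"] by simp
  then show ?case using opp linked_trans by blast
next
  case (rot e)
  have "linked M (rot M e) e" by (rule linked_orbit[OF orbit_sym[OF orbit.base]])
  then show ?case using rot linked_trans by blast
qed simp

lemma linked_darts: "linked M d e \<Longrightarrow> e \<in> darts M \<longleftrightarrow> d \<in> darts M"
  by (induction rule: linked_induct) auto

end

section \<open>Walks without backtracking and the trees they enter\<close>

locale forest_map = wf_dart_map +
  assumes acyclic_map: "acyclic_map M"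
    and reach: "\<And>d. d \<in> darts M \<Longrightarrow> \<exists>i\<in>{1..n}. linked M d i"
begin

text \<open>The relation of \<open>acyclic_map\<close>, named for reuse. Its reflexive transitive
  closure from \<open>d\<close> consists of the darts of the tree behind \<open>d\<close> that point
  away from \<open>d\<close>, together with \<open>d\<close>.\<close>

definition step :: "nat rel" where
  "step = {(d, e). d \<in> darts M \<and> e \<in> orbit (rot M) (opp M d) \<and> e \<noteq> opp M d}"

lemma step_darts: "(d, e) \<in> step \<Longrightarrow> d \<in> darts M" "(d, e) \<in> step \<Longrightarrow> e \<in> darts M"
  using orbit_darts by (auto simp: step_def)

lemma steps_darts: "(d, e) \<in> step\<^sup>* \<Longrightarrow> d \<in> darts M \<longleftrightarrow> e \<in> darts M"
  by (induction rule: rtrancl_induct) (auto dest: step_darts)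

lemma acyclic_step: "acyclic step"
  using acyclic_map unfolding acyclic_map_def step_def .

lemma no_step_cycle: "(d, e) \<in> step\<^sup>* \<Longrightarrow> (e, d) \<in> step \<Longrightarrow> False"
  using acyclic_step unfolding acyclic_def by (meson rtrancl_into_trancl1)

text \<open>Among finitely many darts an acyclic relation has no infinite forward walk. The
  recursion for \<open>subtree\<close> and all inductions over it rest on this.\<close>

lemma wf_step: "wf (step\<inverse>)"
proof -
  have "step \<subseteq> darts M \<times> darts M" using step_darts by auto
  then have "finite step" using finite_darts finite_subset by blast
  then show ?thesis by (rule finite_acyclic_wf_converse[OF _ acyclic_step])
qed

lemma step_opp: "(d, e) \<in> step \<Longrightarrow> (opp M e, opp M d) \<in> step"
  by (auto simp: step_def orbit_darts intro: orbit_sym)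

lemma steps_opp: "(d, e) \<in> step\<^sup>* \<Longrightarrow> (opp M e, opp M d) \<in> step\<^sup>*"
  by (induction rule: rtrancl_induct) (auto intro: step_opp converse_rtrancl_into_rtrancl)

lemma step_around: "d \<in> darts M \<Longrightarrow> e \<in> orbit (rot M) d \<Longrightarrow> e \<noteq> d \<Longrightarrow> (opp M d, e) \<in> step"
  by (auto simp: step_def)

text \<open>A walk without backtracking never traverses an edge in both directions: the innermost turn
  would close a cycle.\<close>

lemma no_turn: "d \<in> darts M \<Longrightarrow> (d, opp M d) \<notin> step\<^sup>*"
proof -
  have "d \<in> darts M \<Longrightarrow> (d, opp M d) \<in> step ^^ m \<Longrightarrow> False" for m d
  proof (induction m arbitrary: d rule: less_induct)
    case (less m)
    consider "m = 0" | "m = 1" | k where "m = Suc (Suc k)"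
      by (metis One_nat_def not0_implies_Suc)
    then show False
    proof cases
      case 1 then show ?thesis using less.prems opp_neq by force
    next
      case 2 then show ?thesis using less.prems by (auto simp: step_def)
    next
      case 3
      then obtain x y where x: "(d, x) \<in> step" and xy: "(x, y) \<in> step ^^ k" and y: "(y, opp M d) \<in> step"
        using less.prems(2) by (metis relpow_Suc_D2 relpow_Suc_E)
      have y': "opp M y \<in> orbit (rot M) (opp M d)" using step_opp[OF y] by (simp add: step_def)
      show False
      proof (cases "x = opp M y")
        case True
        then show False using less.IH[of k x] xy 3 step_darts[OF x] by auto
      next
        case False
        \<comment> \<open>Both \<open>x\<close> and \<open>opp M y\<close> start where
          \<open>d\<close> ends, so \<open>y\<close> may be followed by \<open>x\<close>, and the
          walk from \<open>x\<close> to \<open>y\<close> closes up.\<close>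
        have "(y, x) \<in> step" using False x y' step_darts(1)[OF y] orbit_eq[OF y'] by (auto simp: step_def)
        then show False using no_step_cycle xy relpow_imp_rtrancl by blast
      qed
    qed
  qed
  then show "d \<in> darts M \<Longrightarrow> (d, opp M d) \<notin> step\<^sup>*" by (meson rtrancl_imp_relpow)
qed

text \<open>Walking back from \<open>x\<close> to \<open>opp M e\<close>, turning into the sibling
  \<open>d\<close> and going on to \<open>x\<close> would be a walk from \<open>opp M x\<close> to
  \<open>x\<close>, excluded by \<open>no_turn\<close>.\<close>

lemma siblings_disjoint:
  assumes "d \<in> darts M" "e \<in> orbit (rot M) d" "e \<noteq> d" "(d, x) \<in> step\<^sup>*" "(e, x) \<in> step\<^sup>*"
  shows False
proof -
  have "(opp M e, d) \<in> step" by (rule step_around) (use assms orbit_darts orbit_sym in auto)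
  then have "(opp M x, x) \<in> step\<^sup>*"
    using steps_opp[OF assms(5)] assms(4) by (meson converse_rtrancl_into_rtrancl rtrancl_trans)
  then show False using no_turn[of "opp M x"] assms(1,4) steps_darts by simp
qed

text \<open>Index 0 is the reversed dart \<open>opp M d\<close> itself, so the range starts at 1:
  the children come in clockwise order, beginning after the edge of arrival.\<close>

definition kids :: "nat \<Rightarrow> nat list" where
  "kids d = map (\<lambda>j. (rot M ^^ j) (opp M d)) [1..<card (orbit (rot M) (opp M d))]"

lemma distinct_kids: "distinct (kids d)"
  unfolding kids_def distinct_map using inj_on_funpow_rot[of "opp M d"] by (auto intro: inj_on_subset)

lemma length_kids: "Suc (length (kids d)) = card (orbit (rot M) (opp M d))"
  using card_orbit_pos[of "opp M d"] by (simp add: kids_def)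

lemma set_kids: assumes "d \<in> darts M" shows "set (kids d) = {e. (d, e) \<in> step}"
proof -
  let ?k = "card (orbit (rot M) (opp M d))" and ?f = "\<lambda>j. (rot M ^^ j) (opp M d)"
  have "{e. (d, e) \<in> step} = orbit (rot M) (opp M d) - {opp M d}"
    using assms by (auto simp: step_def)
  also have "\<dots> = ?f ` {0..<?k} - ?f ` {0}" by (subst orbit_conv_funpow) simp
  also have "\<dots> = ?f ` ({0..<?k} - {0})"
    by (rule inj_on_image_set_diff[OF inj_on_funpow_rot, symmetric]) (use card_orbit_pos in auto)
  also have "{0..<?k} - {0} = set [1..<?k]" by auto
  finally show ?thesis by (simp add: kids_def)
qed

text \<open>\<open>Leaf 0\<close> is a dummy value for numbers that are no darts; with this guard
  every recursive call follows a \<open>step\<close>.\<close>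

function subtree :: "nat \<Rightarrow> ltree" where
  "subtree d = (if d \<notin> darts M then Leaf 0 else if opp M d \<in> {1..n} then Leaf (opp M d)
     else Node (map subtree (kids d)))"
  by auto
termination
  by (relation "step\<inverse>") (use wf_step set_kids in auto)

declare subtree.simps [simp del]

lemma subtree_Leaf: "i \<in> {1..n} \<Longrightarrow> subtree (opp M i) = Leaf i"
  by (subst subtree.simps) (use leaf_dart in auto)

lemma subtree_Node: "d \<in> darts M \<Longrightarrow> opp M d \<notin> {1..n} \<Longrightarrow> subtree d = Node (map subtree (kids d))"
  by (subst subtree.simps) auto

lemma subtree_induct [consumes 1, case_names leaf node]:
  assumes "d \<in> darts M"
    and "\<And>i. i \<in> {1..n} \<Longrightarrow> P (opp M i)"
    and "\<And>d. d \<in> darts M \<Longrightarrow> opp M d \<notin> {1..n} \<Longrightarrow> (\<And>e. (d, e) \<in> step \<Longrightarrow> P e) \<Longrightarrow> P d"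
  shows "P d"
  using wf_step assms(1)
proof (induction d rule: wf_induct_rule)
  case (less d)
  then show ?case using assms(2)[of "opp M d"] assms(3)[of d] step_darts(2) by (metis converse_iff opp_opp)
qed

definition edge :: "nat \<Rightarrow> ltree \<times> ltree" where
  "edge d = (subtree d, subtree (opp M d))"

lemma edge_of_opp: "edge (opp M d) = prod.swap (edge d)"
  by (simp add: edge_def)

text \<open>Moving on by one dart shifts the cyclic list of trees around the start vertex: the first
  child becomes the tree ahead, and the tree formerly ahead becomes the last child.\<close>

lemma edge_of_rot: assumes d: "d \<in> darts M" shows "edge (rot M d) = edge_rot (edge d)"
proof (cases "d \<in> {1..n}")
  case True
  then show ?thesis using subtree_Leaf by (auto simp: edge_def rot_leaf)
next
  case False
  let ?k = "card (orbit (rot M) d)"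
  have k: "card (orbit (rot M) (rot M d)) = ?k"
    by (metis permutation_orbit_step rot_permutation)
  have rd: "rot M d \<notin> {1..n}" using False orbit_eq_leaf[of "rot M d" d] orbit.base by metis
  have 1: "subtree (opp M d) = Node (map (\<lambda>j. subtree ((rot M ^^ j) d)) [1..<?k])"
    using subtree_Node[of "opp M d"] False d by (simp add: kids_def comp_def)
  have 2: "subtree (opp M (rot M d)) = Node (map (\<lambda>j. subtree ((rot M ^^ Suc j) d)) [1..<?k])"
    using subtree_Node[of "opp M (rot M d)"] rd d k by (simp add: kids_def comp_def funpow_swap1)
  show ?thesis
  \<comment> \<open>A vertex of degree one yields \<open>Node []\<close>, where
    \<open>edge_rot\<close> is the identity by its default equation.\<close>
  proof (cases "?k = 1")
    case True
    then have "rot M d = d" using funpow_card_orbit[of d] by simp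
    then show ?thesis using 1 True by (simp add: edge_def)
  next
    case False
    then obtain j where j: "?k = Suc (Suc j)"
      using card_orbit_pos[of d] by (metis One_nat_def gr0_implies_Suc not0_implies_Suc)
    have "[1..<?k] = 1 # map Suc [1..<Suc j]" unfolding j map_Suc_upt by (simp add: upt_conv_Cons)
    then have 3: "subtree (opp M d) = Node (subtree (rot M d) # map (\<lambda>j. subtree ((rot M ^^ Suc j) d)) [1..<Suc j])"
      unfolding 1 by (simp add: comp_def del: upt_Suc)
    have "[1..<?k] = [1..<Suc j] @ [Suc j]" unfolding j by simp
    then have 4: "subtree (opp M (rot M d)) = Node (map (\<lambda>j. subtree ((rot M ^^ Suc j) d)) [1..<Suc j] @ [subtree d])"
      unfolding 2 using funpow_card_orbit[of d] j by (simp del: upt_Suc)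
    show ?thesis by (simp add: edge_def 3 4)
  qed
qed

lemma linked_steps: "(d, e) \<in> step\<^sup>* \<Longrightarrow> linked M d e"
proof (induction rule: rtrancl_induct)
  case (step e f)
  have "linked M e (opp M e)" "linked M (opp M e) f"
    using step(2) linked_opp linked_orbit by (auto simp: step_def)
  then show ?case using step(3) linked_trans by blast
qed simp

lemma edge_Leaf:
  assumes "d \<in> darts M" "snd (edge d) = Leaf i"
  shows "d \<in> {1..n}" "d = i"
proof -
  show "d \<in> {1..n}"
  proof (rule ccontr)
    assume "d \<notin> {1..n}"
    then show False using subtree_Node[of "opp M d"] assms by (simp add: edge_def)
  qed
  then show "d = i" using subtree_Leaf[of d] assms(2) by (simp add: edge_def)
qed

text \<open>A boundary dart is the only dart whose second tree is its own leaf. Being the only dart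
  with a given pair passes on along \<open>opp\<close> and \<open>rot\<close>, because swapping and
  \<open>edge_rot\<close> are injective, and every dart is linked to a boundary dart.\<close>

lemma inj_on_edge: "inj_on edge (darts M)"
proof -
  have "\<forall>e\<in>darts M. edge e = edge d \<longrightarrow> e = d" if "linked M i d" "i \<in> {1..n}" for i d
    using that(1)
  proof (induction rule: linked_induct)
    case refl
    { fix e assume e: "e \<in> darts M" "edge e = edge i"
      then have "e = i" using edge_Leaf(2)[of e i] subtree_Leaf[OF that(2)] by (simp add: edge_def) }
    then show ?case by blast
  next
    case (opp d)
    { fix e assume e: "e \<in> darts M" "edge e = edge (opp M d)"
      then have "edge (opp M e) = edge d" by (simp add: edge_of_opp)
      then have "opp M e = d" using opp e by simp
      then have "e = opp M d" by auto }
    then show ?case by blast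
  next
    case (rot d)
    have d: "d \<in> darts M" using linked_darts[OF rot(1)] leaf_dart[OF that(2)] by simp
    { fix e assume e: "e \<in> darts M" "edge e = edge (rot M d)"
      obtain f where f: "e = rot M f" "f \<in> darts M"
        using e(1) rot_permutes by (metis permutes_inverses(1) rot_in)
      then have "f = d" using rot(2) e(2) d by (metis edge_of_rot inj_edge_rot)
      then have "e = rot M d" using f by simp }
    then show ?case by blast
  qed
  then show ?thesis using reach linked_sym by (intro inj_onI) metis
qed

end

section \<open>Leaf words and contours\<close>

lemma distinct_concat_map:
  assumes "distinct xs" "\<And>x. x \<in> set xs \<Longrightarrow> distinct (f x)"
    "\<And>x y. x \<in> set xs \<Longrightarrow> y \<in> set xs \<Longrightarrow> x \<noteq> y \<Longrightarrow> set (f x) \<inter> set (f y) = {}"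
  shows "distinct (concat (map f xs))"
  using assms
proof (induction xs)
  case (Cons x xs)
  have "set (f x) \<inter> set (concat (map f xs)) = {}"
  proof -
    have "set (f x) \<inter> set (f y) = {}" if "y \<in> set xs" for y
      using Cons.prems(1,3) that by (metis distinct.simps(2) list.set_intros(1,2))
    then show ?thesis by auto
  qed
  moreover have "distinct (concat (map f xs))"
    by (rule Cons.IH) (use Cons.prems in auto)
  ultimately show ?case using Cons.prems(2) by simp
qed simp

text \<open>Applied to the contour with the boundary vertices filtered out, this turns neighbours in
  a leaf word into pairs related by \<open>next_leaf\<close>.\<close>

lemma filter_consecutive:
  "filter P xs = us @ a # b # vs \<Longrightarrow>
    \<exists>p q. p < q \<and> q < length xs \<and> xs ! p = a \<and> xs ! q = b \<and> P a \<and> P b \<and>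
      (\<forall>m. p < m \<and> m < q \<longrightarrow> \<not> P (xs ! m))"
proof (induction xs arbitrary: us)
  case (Cons x xs)
  show ?case
  proof (cases "P x \<and> us = []")
    case True
    then have a: "x = a" "P a" and "filter P xs = b # vs" using Cons.prems by auto
    then obtain ys zs where ys: "xs = ys @ b # zs" "\<forall>y\<in>set ys. \<not> P y" "P b"
      by (metis filter_eq_ConsD)
    have "\<not> P ((x # xs) ! m)" if "0 < m \<and> m < Suc (length ys)" for m
      using that ys(1,2) by (cases m) (auto simp: nth_append)
    then show ?thesis
      by (intro exI[of _ 0] exI[of _ "Suc (length ys)"]) (use a ys in \<open>auto simp: nth_append\<close>)
  next
    case False
    then obtain us' where "filter P xs = us' @ a # b # vs"
      using Cons.prems by (cases us) (auto split: if_splits)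
    from Cons.IH[OF this] obtain p q where pq: "p < q" "q < length xs" "xs ! p = a" "xs ! q = b"
      "P a" "P b" "\<And>m. p < m \<Longrightarrow> m < q \<Longrightarrow> \<not> P (xs ! m)" by blast
    have "\<not> P ((x # xs) ! m)" if "Suc p < m \<and> m < Suc q" for m
      using that pq(7) by (cases m) auto
    then show ?thesis by (intro exI[of _ "Suc p"] exI[of _ "Suc q"]) (use pq in auto)
  qed
qed simp

text \<open>The vertex of a node has one more edge than the node has children, the one leading to
  its parent. Two children thus mean degree three; the same shift gives the argument of
  \<open>g\<close> in \<open>weight\<close>.\<close>

fun reduced :: "ltree \<Rightarrow> bool" where
  "reduced (Leaf i) \<longleftrightarrow> True"
| "reduced (Node ts) \<longleftrightarrow> 2 \<le> length ts \<and> (\<forall>t\<in>set ts. reduced t)"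

fun weight :: "(nat \<Rightarrow> 'k::field) \<Rightarrow> ltree \<Rightarrow> 'k" where
  "weight g (Leaf i) = 1"
| "weight g (Node ts) = g (Suc (length ts)) * (\<Prod>t\<leftarrow>ts. weight g t)"

definition block :: "nat \<times> ltree \<Rightarrow> nat set" where
  "block p = set (fst p # leaves (snd p))"

text \<open>Sortedness makes the root the least leaf of its block and carries the clockwise order of
  the contour; \<open>Node []\<close> admits the one-leaf tree. The ground set \<open>A\<close> is
  arbitrary because the forests left after removing a block live on an interval with points
  deleted.\<close>

definition valid_codes :: "nat set \<Rightarrow> (nat \<times> ltree) set set" where
  "valid_codes A = {S. finite S \<and>
     (\<forall>(i, t)\<in>S. sorted_wrt (<) (i # leaves t) \<and> (t = Node [] \<or> reduced t)) \<and>
     (\<forall>p\<in>S. \<forall>q\<in>S. p \<noteq> q \<longrightarrow> block p \<inter> block q = {}) \<and>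
     (\<Union>p\<in>S. block p) = A \<and>
     (\<forall>p\<in>S. \<forall>q\<in>S. \<forall>a\<in>block p. \<forall>b\<in>block q. \<forall>c\<in>block p. \<forall>d\<in>block q.
        a < b \<and> b < c \<and> c < d \<longrightarrow> p = q)}"

context forest_map
begin

lemma step_not_leaf: "(d, i) \<in> step \<Longrightarrow> i \<notin> {1..n}"
  using orbit_eq_leaf unfolding step_def by blast

lemma no_step_opp_leaf: "i \<in> {1..n} \<Longrightarrow> (opp M i, e) \<notin> step"
  using orbit_leaf by (auto simp: step_def)

lemma steps_leaf: "(d, i) \<in> step\<^sup>* \<Longrightarrow> i \<in> {1..n} \<Longrightarrow> d = i"
  using step_not_leaf by (metis rtranclE)

lemma steps_opp_leaf: "(opp M i, e) \<in> step\<^sup>* \<Longrightarrow> i \<in> {1..n} \<Longrightarrow> e = opp M i"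
  using no_step_opp_leaf by (metis converse_rtranclE)

lemma steps_iff:
  assumes "d \<in> darts M"
  shows "(d, x) \<in> step\<^sup>* \<longleftrightarrow> x = d \<or> (\<exists>e\<in>set (kids d). (e, x) \<in> step\<^sup>*)" (is "?L \<longleftrightarrow> ?R")
proof
  show ?R if ?L
    using that by (rule converse_rtranclE) (use set_kids[OF assms] in blast)+
  show ?L if ?R
    using that set_kids[OF assms] converse_rtrancl_into_rtrancl[of d _ step x] by blast
qed

lemma kids_disjoint:
  assumes d: "d \<in> darts M" and e: "e \<in> set (kids d)" "f \<in> set (kids d)" "e \<noteq> f"
    and x: "(e, x) \<in> step\<^sup>*" "(f, x) \<in> step\<^sup>*"
  shows False
proof -
  have "(d, e) \<in> step" "(d, f) \<in> step" using e set_kids[OF d] by auto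
  then have "f \<in> orbit (rot M) (opp M d)" "e \<in> orbit (rot M) (opp M d)" "e \<in> darts M"
    using step_darts(2) unfolding step_def by blast+
  then have "f \<in> orbit (rot M) e" using orbit_eq by metis
  then show False using siblings_disjoint[of e f x] \<open>e \<in> darts M\<close> e(3) x by blast
qed

lemma set_leaves_subtree:
  "d \<in> darts M \<Longrightarrow> set (leaves (subtree d)) = {i \<in> {1..n}. (d, opp M i) \<in> step\<^sup>*}"
proof (induction rule: subtree_induct)
  case (leaf i)
  have "j = i" if "(opp M i, opp M j) \<in> step\<^sup>*" for j
    using steps_opp_leaf[OF that leaf] by simp
  then show ?case using subtree_Leaf[OF leaf] leaf by auto
next
  case (node d)
  have "set (leaves (subtree d)) = (\<Union>e\<in>set (kids d). set (leaves (subtree e)))"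
    using subtree_Node[OF node(1,2)] by simp
  also have "\<dots> = (\<Union>e\<in>set (kids d). {i \<in> {1..n}. (e, opp M i) \<in> step\<^sup>*})"
    using node(3) set_kids[OF node(1)] by simp
  also have "\<dots> = {i \<in> {1..n}. (d, opp M i) \<in> step\<^sup>*}"
    using steps_iff[OF node(1)] node(2) by auto
  finally show ?case .
qed

lemma distinct_leaves_subtree: "d \<in> darts M \<Longrightarrow> distinct (leaves (subtree d))"
proof (induction rule: subtree_induct)
  case (leaf i)
  then show ?case by (simp add: subtree_Leaf)
next
  case (node d)
  have k: "e \<in> darts M" if "e \<in> set (kids d)" for e
    using that set_kids[OF node(1)] step_darts by blast
  have "distinct (concat (map (\<lambda>e. leaves (subtree e)) (kids d)))"
  proof (rule distinct_concat_map)
    fix e f assume ef: "e \<in> set (kids d)" "f \<in> set (kids d)" "e \<noteq> f"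
    show "set (leaves (subtree e)) \<inter> set (leaves (subtree f)) = {}"
      using kids_disjoint[OF node(1) ef] k ef by (auto simp: set_leaves_subtree)
  qed (use distinct_kids node set_kids[OF node(1)] in auto)
  then show ?case using subtree_Node[OF node(1,2)] by (simp add: comp_def)
qed

lemma root_notin_leaves: "i \<in> {1..n} \<Longrightarrow> i \<notin> set (leaves (subtree i))"
  using set_leaves_subtree[of i] leaf_dart[of i] no_turn[of i] by blast

text \<open>The darts pointing away from the root or towards it are closed under \<open>opp\<close>,
  which exchanges the two kinds, and under \<open>rot\<close>, which moves among the siblings and
  the reversed dart of their parent.\<close>

lemma linked_root:
  assumes i: "i \<in> {1..n}"
  shows "linked M i d \<Longrightarrow> (i, d) \<in> step\<^sup>* \<or> (i, opp M d) \<in> step\<^sup>*"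
proof (induction rule: linked_induct)
  case (rot d)
  have d: "d \<in> darts M" using rot(1) linked_darts i leaf_dart by blast
  show ?case using rot(2)
  proof
    assume 1: "(i, d) \<in> step\<^sup>*"
    show ?thesis
    proof (cases "d = i")
      case True
      then show ?thesis using i rot_leaf by simp
    next
      case False
      then obtain z where z: "(i, z) \<in> step\<^sup>*" "(z, d) \<in> step" using 1 by (metis rtranclE)
      then have "rot M d \<in> orbit (rot M) (opp M z)" "z \<in> darts M"
        by (auto simp: step_def intro: orbit.step)
      then have "rot M d = opp M z \<or> (z, rot M d) \<in> step" by (auto simp: step_def)
      then show ?thesis using z(1) by (metis opp_opp rtrancl_into_rtrancl)
    qed
  next
    assume 1: "(i, opp M d) \<in> step\<^sup>*"
    have "rot M d = d \<or> (opp M d, rot M d) \<in> step"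
      using step_around[OF d orbit.base] by blast
    then show ?thesis using 1 by (metis rtrancl_into_rtrancl)
  qed
qed auto

lemma set_word:
  assumes i: "i \<in> {1..n}"
  shows "set (i # leaves (subtree i)) = {l \<in> {1..n}. linked M i l}"
proof -
  have "linked M i l" if "(i, opp M l) \<in> step\<^sup>*" for l
    using linked_steps[OF that] linked_opp[of "opp M l"] linked_trans[of i "opp M l" l] by simp
  moreover have "l = i \<or> (i, opp M l) \<in> step\<^sup>*" if "linked M i l" "l \<in> {1..n}" for l
    using linked_root[OF i that(1)] steps_leaf[of i l] that(2) by blast
  ultimately show ?thesis
    using i set_leaves_subtree[OF leaf_dart[OF i]] by auto
qed

lemma distinct_word: "i \<in> {1..n} \<Longrightarrow> distinct (i # leaves (subtree i))"
  using root_notin_leaves distinct_leaves_subtree leaf_dart by simp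

text \<open>The list collects the boundary vertices met on the contour from \<open>d\<close> to
  \<open>e\<close>, without the start and with the end. This convention makes lists of composed
  walks concatenate.\<close>

definition walk :: "nat \<Rightarrow> nat list \<Rightarrow> nat \<Rightarrow> bool" where
  "walk d ws e \<longleftrightarrow> (\<exists>k. e = ((rot M \<circ> opp M) ^^ k) d \<and>
     ws = filter (\<lambda>x. x \<in> {1..n}) (map (\<lambda>m. ((rot M \<circ> opp M) ^^ m) d) [1..<Suc k]))"

lemma walk_step: "walk d (if rot M (opp M d) \<in> {1..n} then [rot M (opp M d)] else []) (rot M (opp M d))"
  unfolding walk_def by (rule exI[of _ 1]) auto

lemma walk_trans: assumes "walk d ws e" "walk e vs f" shows "walk d (ws @ vs) f"
proof -
  let ?c = "rot M \<circ> opp M"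
  obtain k where k: "e = (?c ^^ k) d" "ws = filter (\<lambda>x. x \<in> {1..n}) (map (\<lambda>m. (?c ^^ m) d) [1..<Suc k])"
    using assms(1) unfolding walk_def by blast
  obtain l where l: "f = (?c ^^ l) e" "vs = filter (\<lambda>x. x \<in> {1..n}) (map (\<lambda>m. (?c ^^ m) e) [1..<Suc l])"
    using assms(2) unfolding walk_def by blast
  have "[1..<Suc (l + k)] = [1..<Suc k] @ map (\<lambda>m. m + k) [1..<Suc l]"
    by (rule nth_equalityI) (auto simp: nth_append simp del: upt_Suc)
  then have "ws @ vs = filter (\<lambda>x. x \<in> {1..n}) (map (\<lambda>m. (?c ^^ m) d) [1..<Suc (l + k)])"
    unfolding k(2) l(2) k(1) by (simp add: funpow_add comp_def del: upt_Suc)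
  moreover have "f = (?c ^^ (l + k)) d" using k(1) l(1) by (simp add: funpow_add)
  ultimately show ?thesis unfolding walk_def by blast
qed

text \<open>The contour runs once around the tree behind \<open>d\<close>, meeting its leaves from
  left to right, and comes back along the same edge in the opposite direction.\<close>

lemma walk_subtree: "d \<in> darts M \<Longrightarrow> walk d (leaves (subtree d)) (opp M d)"
proof (induction rule: subtree_induct)
  case (leaf i)
  then show ?case using walk_step[of "opp M i"] by (simp add: subtree_Leaf rot_leaf)
next
  case (node d)
  let ?k = "card (orbit (rot M) (opp M d))" and ?c = "\<lambda>j. (rot M ^^ j) (opp M d)"
  have nl: "?c j \<notin> {1..n}" for j
    using orbit_eq_leaf[of "?c j" "opp M d"] node(2) funpow_in_orbit[OF self_in_orbit, of j] by metis
  \<comment> \<open>Induction over the children already surrounded: after \<open>m\<close> of them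
    the contour stands at the next dart around the vertex, and after the last one this dart is
    \<open>opp M d\<close> again.\<close>
  have "walk d (concat (map (\<lambda>j. leaves (subtree (?c j))) [1..<Suc m])) (?c (Suc m))" if "m < ?k" for m
    using that
  proof (induction m)
    case 0
    then show ?case using walk_step[of d] nl[of 1] by auto
  next
    case (Suc m)
    have "(d, ?c (Suc m)) \<in> step"
    proof -
      have "?c (Suc m) \<in> set (kids d)" using Suc.prems by (auto simp: kids_def simp del: funpow.simps)
      then show ?thesis using set_kids[OF node(1)] by blast
    qed
    then have "walk (?c (Suc m)) (leaves (subtree (?c (Suc m)))) (opp M (?c (Suc m)))"
      by (rule node(3))
    moreover have "walk (opp M (?c (Suc m))) [] (?c (Suc (Suc m)))"
      using walk_step[of "opp M (?c (Suc m))"] nl[of "Suc (Suc m)"] by auto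
    ultimately have "walk d (concat (map (\<lambda>j. leaves (subtree (?c j))) [1..<Suc m]) @
        leaves (subtree (?c (Suc m))) @ []) (?c (Suc (Suc m)))"
      using Suc by (intro walk_trans) auto
    then show ?case by (simp del: funpow.simps)
  qed
  from this[of "?k - 1"] have "walk d (concat (map (\<lambda>j. leaves (subtree (?c j))) [1..<?k])) (?c ?k)"
    using card_orbit_pos[of "opp M d"] by (simp del: upt_Suc funpow.simps)
  then show ?case using subtree_Node[OF node(1,2)] funpow_card_orbit[of "opp M d"]
    by (simp add: kids_def comp_def)
qed

text \<open>The extra \<open>i\<close> at the end closes the contour to a full round, so that the
  last leaf of the word also gets its successor, the root.\<close>

lemma next_leaf_word:
  assumes i: "i \<in> {1..n}" and w: "i # leaves (subtree i) @ [i] = us @ a # b # vs"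
  shows "next_leaf n M a b"
proof -
  let ?c = "rot M \<circ> opp M"
  have "walk i (leaves (subtree i) @ [i]) i"
    using walk_trans[OF walk_subtree[OF leaf_dart[OF i]] walk_step] i by (simp add: rot_leaf)
  then obtain k where "leaves (subtree i) @ [i] =
      filter (\<lambda>x. x \<in> {1..n}) (map (\<lambda>m. (?c ^^ m) i) [1..<Suc k])"
    unfolding walk_def by blast
  then have "us @ a # b # vs = filter (\<lambda>x. x \<in> {1..n}) (map (\<lambda>m. (?c ^^ m) i) (0 # [1..<Suc k]))"
    using i w by (simp del: upt_Suc)
  also have "0 # [1..<Suc k] = [0..<Suc k]" by (simp add: upt_rec[of 0])
  finally have "filter (\<lambda>x. x \<in> {1..n}) (map (\<lambda>m. (?c ^^ m) i) [0..<Suc k]) = us @ a # b # vs"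
    by (rule sym)
  note ex = filter_consecutive[OF this]
  have len: "length (map (\<lambda>m. (?c ^^ m) i) [0..<Suc k]) = Suc k" by simp
  obtain p q where pq: "p < q" "q < Suc k" and
    nth: "map (\<lambda>m. (?c ^^ m) i) [0..<Suc k] ! p = a" "map (\<lambda>m. (?c ^^ m) i) [0..<Suc k] ! q = b" and
    ab: "a \<in> {1..n}" "b \<in> {1..n}" and
    between: "\<forall>m. p < m \<and> m < q \<longrightarrow> map (\<lambda>m. (?c ^^ m) i) [0..<Suc k] ! m \<notin> {1..n}"
    using ex unfolding len by blast
  have at: "map (\<lambda>m. (?c ^^ m) i) [0..<Suc k] ! m = (?c ^^ m) i" if "m \<le> q" for m
    using that pq by (simp del: upt_Suc)
  have nth: "(?c ^^ p) i = a" "(?c ^^ q) i = b" using nth at pq(1) by simp_all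
  have between: "(?c ^^ m) i \<notin> {1..n}" if "p < m \<and> m < q" for m
    using between that at[of m] by (metis order.strict_implies_order)
  have shift: "(?c ^^ m) a = (?c ^^ (m + p)) i" for m
    using nth(1) by (simp add: funpow_add)
  show ?thesis
    unfolding next_leaf_def
    by (intro conjI ab exI[of _ "q - p"]) (use pq(1) nth(2) between shift in auto)
qed

lemma next_leaf_unique: "next_leaf n M a b \<Longrightarrow> next_leaf n M a c \<Longrightarrow> b = c"
  unfolding next_leaf_def by (metis linorder_neqE_nat)

end

section \<open>The code of a forest map\<close>

context forest_map
begin

definition root_leaves :: "nat set" where
  "root_leaves = {i \<in> {1..n}. \<forall>j\<in>{1..n}. linked M i j \<longrightarrow> i \<le> j}"

definition code :: "(nat \<times> ltree) set" where
  "code = (\<lambda>i. (i, subtree i)) ` root_leaves"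

lemma root_leaf: "i \<in> root_leaves \<Longrightarrow> i \<in> {1..n}"
  by (simp add: root_leaves_def)

lemma finite_root_leaves: "finite root_leaves"
  by (simp add: root_leaves_def)

lemma root_leaf_exists:
  assumes "d \<in> darts M"
  obtains i where "i \<in> root_leaves" "linked M i d"
proof -
  let ?A = "{i \<in> {1..n}. linked M i d}"
  have "?A \<noteq> {}" using reach[OF assms] linked_sym by blast
  then have m: "Min ?A \<in> ?A" by (intro Min_in) auto
  have "Min ?A \<le> j" if "j \<in> {1..n}" "linked M (Min ?A) j" for j
  proof -
    have "linked M j d" using m that(2) linked_sym linked_trans by blast
    then show ?thesis using that(1) by (intro Min_le) auto
  qed
  then show thesis using m that[of "Min ?A"] by (auto simp: root_leaves_def)
qed

lemma root_leaf_unique: "i \<in> root_leaves \<Longrightarrow> j \<in> root_leaves \<Longrightarrow> linked M i j \<Longrightarrow> i = j"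
  using linked_sym unfolding root_leaves_def by (blast intro: antisym)

lemma block_code: "i \<in> {1..n} \<Longrightarrow> block (i, subtree i) = {l \<in> {1..n}. linked M i l}"
  using set_word by (simp add: block_def)

lemma block_linked:
  assumes "p \<in> code" "a \<in> block p" "b \<in> block p"
  shows "linked M a b"
  using assms block_code root_leaf linked_sym linked_trans unfolding code_def by blast

lemma code_eq:
  assumes "p \<in> code" "q \<in> code" "a \<in> block p" "b \<in> block q" "linked M a b"
  shows "p = q"
proof -
  obtain i j where ij: "p = (i, subtree i)" "q = (j, subtree j)" "i \<in> root_leaves" "j \<in> root_leaves"
    using assms(1,2) by (auto simp: code_def)
  then have "linked M i a" "linked M j b"
    using assms(3,4) block_code root_leaf by auto
  then have "linked M i j" using assms(5) linked_sym linked_trans by blast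
  then show ?thesis using root_leaf_unique ij by blast
qed

lemma code_covers:
  assumes "l \<in> {1..n}"
  obtains p where "p \<in> code" "l \<in> block p"
proof -
  obtain i where "i \<in> root_leaves" "linked M i l"
    using root_leaf_exists[OF leaf_dart[OF assms]] .
  then show thesis using that[of "(i, subtree i)"] assms block_code root_leaf by (auto simp: code_def)
qed

text \<open>The contour order is cyclic while words are linear. Starting each word at its least leaf
  reconciles them: a descent between two neighbours would put that least leaf cyclically between
  them, and neighbours in an increasing word have nothing of the word between them.\<close>

lemma contour_ordered_iff:
  "(\<forall>i j l. next_leaf n M i j \<and> l \<in> {1..n} \<and> linked M i l \<longrightarrow> \<not> cyclic_less i l j) \<longleftrightarrow>
    (\<forall>(i, t)\<in>code. sorted_wrt (<) (i # leaves t))" (is "?L \<longleftrightarrow> ?R")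
proof
  assume L: ?L
  have "sorted_wrt (<) (i # leaves (subtree i))" if "i \<in> root_leaves" for i
  proof -
    let ?w = "i # leaves (subtree i)"
    have i: "i \<in> {1..n}" using that by (rule root_leaf)
    have "?w ! j < ?w ! Suc j" if j: "Suc j < length ?w" for j
    proof -
      let ?a = "?w ! j" and ?b = "?w ! Suc j"
      have "?w = take j ?w @ ?a # ?b # drop (Suc (Suc j)) ?w"
        using j by (metis Cons_nth_drop_Suc Suc_lessD id_take_nth_drop)
      then have "i # leaves (subtree i) @ [i] = take j ?w @ ?a # ?b # drop (Suc (Suc j)) ?w @ [i]"
        by (metis append_Cons append_assoc)
      then have nl: "next_leaf n M ?a ?b"
        by (rule next_leaf_word[OF i])
      have mem: "?a \<in> set ?w" "?b \<in> set ?w"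
        by (rule nth_mem, use j in simp)+
      have inj: "?w ! k = ?w ! l \<longleftrightarrow> k = l" if "k < length ?w" "l < length ?w" for k l
        by (rule nth_eq_iff_index_eq[OF distinct_word[OF i] that])
      have "?a \<noteq> ?b" using inj[of j "Suc j"] j by (metis Suc_lessD n_not_Suc_n)
      moreover have "?b \<noteq> i" using inj[of "Suc j" 0] j by (metis Zero_not_Suc nth_Cons_0 zero_less_Suc less_trans)
      ultimately have neq: "?a \<noteq> ?b" "?b \<noteq> i" by blast+
      have "linked M ?a i" "i \<le> ?b"
        using mem i linked_sym \<open>i \<in> root_leaves\<close> unfolding set_word[OF i] root_leaves_def by blast+
      \<comment> \<open>The hypothesis is used with the root \<open>i\<close> as the intermediate
        leaf; since \<open>i < ?b\<close>, it rules out \<open>?b < ?a\<close>.\<close>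
      then have "\<not> cyclic_less ?a i ?b" "i < ?b" using L nl i neq by auto
      then show ?thesis using neq by (auto simp: cyclic_less_def)
    qed
    then show ?thesis by (subst sorted_wrt_iff_nth_Suc_transp) auto
  qed
  then show ?R by (auto simp: code_def)
next
  assume R: ?R
  show ?L
  proof (intro allI impI, elim conjE)
    fix x y l assume nl: "next_leaf n M x y" and l: "l \<in> {1..n}" "linked M x l"
    have x: "x \<in> {1..n}" using nl by (simp add: next_leaf_def)
    obtain r where r: "r \<in> root_leaves" "linked M r x"
      using root_leaf_exists[OF leaf_dart[OF x]] .
    have r1: "r \<in> {1..n}" using r(1) by (rule root_leaf)
    let ?w = "r # leaves (subtree r)"
    have sorted: "sorted_wrt (<) ?w" using R r(1) by (auto simp: code_def)
    have mem: "x \<in> set ?w" "l \<in> set ?w"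
      using r l x linked_trans unfolding set_word[OF r1] by blast+
    then obtain us ws where w: "?w = us @ x # ws" by (metis split_list)
    show "\<not> cyclic_less x l y"
    proof (cases ws)
      case Nil
      then have "next_leaf n M x r" using w by (intro next_leaf_word[OF r1, of us x r "[]"]) simp
      then have "y = r" using next_leaf_unique nl by blast
      moreover have "r \<le> l" using sorted mem(2) by auto
      moreover have "l \<le> x" using sorted mem(2) unfolding w Nil by (auto simp: sorted_wrt_append)
      ultimately show ?thesis by (auto simp: cyclic_less_def)
    next
      case (Cons b vs)
      then have "next_leaf n M x b" using w by (intro next_leaf_word[OF r1, of us x b "vs @ [r]"]) simp
      then have "y = b" using next_leaf_unique nl by blast
      moreover have "l \<le> x \<or> b \<le> l" "x < b"
        using sorted mem(2) unfolding w Cons by (auto simp: sorted_wrt_append)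
      ultimately show ?thesis by (auto simp: cyclic_less_def)
    qed
  qed
qed

lemma noncrossing_iff:
  "(\<forall>a\<in>{1..n}. \<forall>b\<in>{1..n}. \<forall>c\<in>{1..n}. \<forall>d\<in>{1..n}.
      a < b \<and> b < c \<and> c < d \<and> linked M a c \<and> linked M b d \<longrightarrow> linked M a b) \<longleftrightarrow>
   (\<forall>p\<in>code. \<forall>q\<in>code. \<forall>a\<in>block p. \<forall>b\<in>block q. \<forall>c\<in>block p. \<forall>d\<in>block q.
      a < b \<and> b < c \<and> c < d \<longrightarrow> p = q)" (is "?L \<longleftrightarrow> ?R")
proof
  assume L: ?L
  have sub: "a \<in> {1..n}" if "p \<in> code" "a \<in> block p" for a p
    using that block_code root_leaf unfolding code_def by blast
  show ?R
  proof (intro ballI impI)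
    fix p q a b c d
    assume H: "p \<in> code" "q \<in> code" "a \<in> block p" "b \<in> block q" "c \<in> block p" "d \<in> block q"
      "a < b \<and> b < c \<and> c < d"
    have "a \<in> {1..n}" "b \<in> {1..n}" "c \<in> {1..n}" "d \<in> {1..n}" "linked M a c" "linked M b d"
      using H sub block_linked by blast+
    then have "linked M a b" using L H(7) by blast
    then show "p = q" using code_eq H by blast
  qed
next
  assume R: ?R
  show ?L
  proof (intro ballI impI, elim conjE)
    fix a b c d
    assume H: "a \<in> {1..n}" "b \<in> {1..n}" "c \<in> {1..n}" "d \<in> {1..n}" "a < b" "b < c" "c < d"
      "linked M a c" "linked M b d"
    obtain p where p: "p \<in> code" "a \<in> block p" using code_covers[OF H(1)] .
    obtain q where q: "q \<in> code" "b \<in> block q" using code_covers[OF H(2)] .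
    obtain p' where p': "p' \<in> code" "c \<in> block p'" using code_covers[OF H(3)] .
    obtain q' where q': "q' \<in> code" "d \<in> block q'" using code_covers[OF H(4)] .
    have "p' = p" using code_eq[OF p(1) p'(1) p(2) p'(2) H(8)] by simp
    moreover have "q' = q" using code_eq[OF q(1) q'(1) q(2) q'(2) H(9)] by simp
    ultimately have "p = q" using R p q p' q' H by blast
    then show "linked M a b" using block_linked p q by blast
  qed
qed

text \<open>The internal vertices of the tree behind \<open>d\<close>, each given through a dart
  \<open>e\<close> that enters it.\<close>

definition beyond :: "nat \<Rightarrow> nat set set" where
  "beyond d = {orbit (rot M) (opp M e) | e. (d, e) \<in> step\<^sup>* \<and> opp M e \<notin> {1..n}}"

lemma beyond_leaf: "i \<in> {1..n} \<Longrightarrow> beyond (opp M i) = {}"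
  using steps_opp_leaf unfolding beyond_def by fastforce

lemma beyond_node:
  assumes "d \<in> darts M" "opp M d \<notin> {1..n}"
  shows "beyond d = insert (orbit (rot M) (opp M d)) (\<Union>e\<in>set (kids d). beyond e)"
proof -
  let ?S = "\<lambda>d. {e. (d, e) \<in> step\<^sup>*} \<inter> {e. opp M e \<notin> {1..n}}"
  have beyond: "beyond d = (\<lambda>e. orbit (rot M) (opp M e)) ` ?S d" for d
    by (simp add: beyond_def image_def Int_def Collect_conj_eq[symmetric] conj_commute)
  have "?S d = insert d (\<Union>e\<in>set (kids d). ?S e)"
    by (intro set_eqI) (use steps_iff[OF assms(1)] assms(2) in \<open>simp, blast\<close>)
  then show ?thesis unfolding beyond by (simp only: image_insert image_UN)
qed

lemma finite_beyond: "d \<in> darts M \<Longrightarrow> finite (beyond d)"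
proof (induction rule: subtree_induct)
  case (leaf i)
  then show ?case by (simp add: beyond_leaf)
next
  case (node d)
  have "finite (beyond e)" if "e \<in> set (kids d)" for e
    using that node(3) set_kids[OF node(1)] by blast
  then show ?case by (simp add: beyond_node[OF node(1,2)])
qed

text \<open>Coming back to the end of \<open>d\<close> along another dart would allow the walk to
  continue with \<open>opp M d\<close>, contrary to \<open>no_turn\<close>.\<close>

lemma orbit_notin_beyond:
  assumes d: "d \<in> darts M" and e: "e \<in> set (kids d)"
  shows "orbit (rot M) (opp M d) \<notin> beyond e"
proof
  assume "orbit (rot M) (opp M d) \<in> beyond e"
  then obtain x where x: "orbit (rot M) (opp M x) = orbit (rot M) (opp M d)" "(e, x) \<in> step\<^sup>*"
    by (auto simp: beyond_def)
  have de: "(d, e) \<in> step" using e set_kids[OF d] by blast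
  then have dx: "(d, x) \<in> step\<^sup>*" using x(2) by (rule converse_rtrancl_into_rtrancl)
  have "d \<noteq> x" using no_step_cycle[OF x(2)] de by blast
  then have "(x, opp M d) \<in> step"
    using x(1) self_in_orbit[of "opp M d"] dx steps_darts d by (auto simp: step_def)
  then show False using dx no_turn[OF d] by (meson rtrancl_into_rtrancl)
qed

text \<open>If walks through two siblings met in a vertex, one could go out through
  \<open>e\<close>, return through the reverse of \<open>f\<close> and enter \<open>e\<close> again,
  which is a cycle.\<close>

lemma beyond_disjoint:
  assumes d: "d \<in> darts M" and ef: "e \<in> set (kids d)" "f \<in> set (kids d)" "e \<noteq> f"
  shows "beyond e \<inter> beyond f = {}"
proof (rule ccontr)
  assume "beyond e \<inter> beyond f \<noteq> {}"
  then obtain x y where xy: "(e, x) \<in> step\<^sup>*" "(f, y) \<in> step\<^sup>*"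
      "orbit (rot M) (opp M x) = orbit (rot M) (opp M y)"
    by (auto simp: beyond_def)
  have "(d, e) \<in> step" "(d, f) \<in> step" using ef set_kids[OF d] by auto
  then have o: "e \<in> orbit (rot M) (opp M d)" "f \<in> orbit (rot M) (opp M d)" "e \<in> darts M" "f \<in> darts M"
    using step_darts(2) unfolding step_def by blast+
  have "x \<noteq> y" using kids_disjoint[OF d ef] xy by blast
  moreover have "x \<in> darts M" using steps_darts[OF xy(1)] o by simp
  ultimately have "(x, opp M y) \<in> step"
    using xy(3) self_in_orbit[of "opp M y"] by (auto simp: step_def)
  moreover have "(opp M f, e) \<in> step"
    using o orbit_eq[OF o(2)] ef(3) by (intro step_around) auto
  ultimately have "(opp M f, opp M y) \<in> step\<^sup>*"
    using xy(1) by (meson converse_rtrancl_into_rtrancl rtrancl_into_rtrancl)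
  then have "(x, opp M f) \<in> step\<^sup>*"
    using steps_opp[OF xy(2)] \<open>(x, opp M y) \<in> step\<close> by (meson converse_rtrancl_into_rtrancl)
  then have "(e, opp M f) \<in> step\<^sup>*" using xy(1) by (meson rtrancl_trans)
  then show False using no_step_cycle \<open>(opp M f, e) \<in> step\<close> by blast
qed

lemma prod_beyond:
  fixes g :: "nat \<Rightarrow> 'k::field"
  shows "d \<in> darts M \<Longrightarrow> (\<Prod>v\<in>beyond d. g (card v)) = weight g (subtree d)"
proof (induction rule: subtree_induct)
  case (leaf i)
  then show ?case by (simp add: beyond_leaf subtree_Leaf)
next
  case (node d)
  have k: "(d, e) \<in> step" "e \<in> darts M" if "e \<in> set (kids d)" for e
    using that set_kids[OF node(1)] step_darts by blast+
  have "(\<Prod>v\<in>beyond d. g (card v)) =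
      g (card (orbit (rot M) (opp M d))) * (\<Prod>v\<in>(\<Union>e\<in>set (kids d). beyond e). g (card v))"
    unfolding beyond_node[OF node(1,2)]
    using orbit_notin_beyond[OF node(1)] finite_beyond k(2) by (subst prod.insert) auto
  also have "(\<Prod>v\<in>(\<Union>e\<in>set (kids d). beyond e). g (card v)) =
      (\<Prod>e\<in>set (kids d). \<Prod>v\<in>beyond e. g (card v))"
    using finite_beyond k(2) beyond_disjoint[OF node(1)] by (intro prod.UNION_disjoint) auto
  also have "\<dots> = (\<Prod>e\<in>set (kids d). weight g (subtree e))"
    using node(3) k(1) by (intro prod.cong) auto
  also have "\<dots> = (\<Prod>e\<leftarrow>kids d. weight g (subtree e))"
    by (rule prod.distinct_set_conv_list[OF distinct_kids])
  finally show ?case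
    using subtree_Node[OF node(1,2)] by (simp add: length_kids[symmetric] comp_def)
qed

lemma beyond_linked:
  assumes "v \<in> beyond i" "d \<in> v"
  shows "linked M i d"
proof -
  obtain e where "(i, e) \<in> step\<^sup>*" "d \<in> orbit (rot M) (opp M e)"
    using assms by (auto simp: beyond_def)
  then have "linked M i e" "linked M (opp M e) d" using linked_steps linked_orbit by auto
  then show ?thesis using linked_opp linked_trans by blast
qed

lemma internal_vertices_eq: "internal_vertices n M = (\<Union>i\<in>root_leaves. beyond i)"
proof (intro equalityI subsetI)
  fix v assume "v \<in> internal_vertices n M"
  then obtain d where d: "v = orbit (rot M) d" "d \<in> darts M" "d \<notin> {1..n}"
    by (auto simp: internal_vertices_def)
  obtain i where i: "i \<in> root_leaves" "linked M i d" using root_leaf_exists[OF d(2)] .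
  consider "(i, d) \<in> step\<^sup>*" | "(i, opp M d) \<in> step\<^sup>*"
    using linked_root[OF root_leaf[OF i(1)] i(2)] by blast
  then have "v \<in> beyond i"
  proof cases
    case 1
    moreover have "d \<noteq> i" using d(3) root_leaf[OF i(1)] by blast
    ultimately obtain z where z: "(i, z) \<in> step\<^sup>*" "(z, d) \<in> step" by (metis rtranclE)
    then have dz: "d \<in> orbit (rot M) (opp M z)" by (simp add: step_def)
    then have "v = orbit (rot M) (opp M z)" using orbit_eq d(1) by simp
    moreover have "opp M z \<notin> {1..n}" using dz d(3) orbit_eq_leaf by metis
    ultimately show ?thesis using z(1) unfolding beyond_def by blast
  next
    case 2
    then show ?thesis using d unfolding beyond_def by (intro CollectI exI[of _ "opp M d"]) simp
  qed
  then show "v \<in> (\<Union>i\<in>root_leaves. beyond i)" using i(1) by blast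
next
  fix v assume "v \<in> (\<Union>i\<in>root_leaves. beyond i)"
  then obtain i e where e: "i \<in> root_leaves" "(i, e) \<in> step\<^sup>*" "opp M e \<notin> {1..n}"
      "v = orbit (rot M) (opp M e)"
    by (auto simp: beyond_def)
  have "opp M e \<in> darts M" using steps_darts[OF e(2)] leaf_dart[OF root_leaf[OF e(1)]] by simp
  then show "v \<in> internal_vertices n M" using e(3,4) unfolding internal_vertices_def by blast
qed

text \<open>Every internal vertex lies behind the root dart of exactly one component, so the product
  over vertices factors over the code.\<close>

lemma map_weight_eq:
  fixes g :: "nat \<Rightarrow> 'k::field"
  shows "map_weight g n M = (\<Prod>(i, t)\<in>code. weight g t)"
proof -
  have disj: "beyond i \<inter> beyond j = {}" if "i \<in> root_leaves" "j \<in> root_leaves" "i \<noteq> j" for i j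
  proof (rule ccontr)
    assume "beyond i \<inter> beyond j \<noteq> {}"
    then obtain v where v: "v \<in> beyond i" "v \<in> beyond j" by blast
    then obtain d where "d \<in> v" unfolding beyond_def using self_in_orbit by blast
    then have "linked M i j" using v beyond_linked linked_sym linked_trans by blast
    then show False using root_leaf_unique that by blast
  qed
  have "map_weight g n M = (\<Prod>i\<in>root_leaves. \<Prod>v\<in>beyond i. g (card v))"
    unfolding map_weight_def internal_vertices_eq
    by (rule prod.UNION_disjoint)
      (use finite_root_leaves finite_beyond leaf_dart root_leaf disj in auto)
  also have "\<dots> = (\<Prod>i\<in>root_leaves. weight g (subtree i))"
    by (intro prod.cong refl prod_beyond leaf_dart root_leaf)
  also have "\<dots> = (\<Prod>(i, t)\<in>code. weight g t)"
    unfolding code_def by (subst prod.reindex) (auto simp: inj_on_def)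
  finally show ?thesis .
qed

lemma reduced_subtree_iff:
  "d \<in> darts M \<Longrightarrow> reduced (subtree d) \<longleftrightarrow> (\<forall>v\<in>beyond d. 3 \<le> card v)"
proof (induction rule: subtree_induct)
  case (leaf i)
  then show ?case by (simp add: beyond_leaf subtree_Leaf)
next
  case (node d)
  then show ?case
    using length_kids[of d] set_kids[OF node(1)]
    by (auto simp: subtree_Node beyond_node)
qed

lemma vertex_neighbour_leaf:
  assumes e: "e \<in> darts M" "card (orbit (rot M) (opp M e)) = 1"
  shows "opp M ` orbit (rot M) (opp M e) = {e}"
proof -
  have "orbit (rot M) (opp M e) = {opp M e}"
    using e(2) self_in_orbit[of "opp M e"] by (metis card_1_singletonE singletonD)
  then show ?thesis by simp
qed

text \<open>A vertex of degree one may only have a boundary vertex as neighbour. A walk from the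
  root meets no other dart starting at the boundary, so that neighbour is the root and the component
  is the one-leaf tree \<open>Node []\<close>.\<close>

lemma series_reduced_iff:
  "series_reduced n M \<longleftrightarrow> (\<forall>(i, t)\<in>code. t = Node [] \<or> reduced t)" (is "?L \<longleftrightarrow> ?R")
proof
  assume L: ?L
  have "subtree i = Node [] \<or> reduced (subtree i)" if i: "i \<in> root_leaves" for i
  proof (rule disjCI)
    have i1: "i \<in> {1..n}" "i \<in> darts M" using root_leaf[OF i] leaf_dart by auto
    assume nr: "\<not> reduced (subtree i)"
    then obtain v where v: "v \<in> beyond i" "card v < 3" using reduced_subtree_iff[OF i1(2)] by force
    then obtain e where e: "(i, e) \<in> step\<^sup>*" "v = orbit (rot M) (opp M e)" by (auto simp: beyond_def)
    have "v \<in> internal_vertices n M" using v(1) i internal_vertices_eq by blast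
    then have "card v \<noteq> 2" "card v = 1 \<Longrightarrow> opp M ` v \<subseteq> {1..n}"
      using L by (auto simp: series_reduced_def)
    moreover have "0 < card v" using card_orbit_pos e(2) by blast
    ultimately have "card v = 1" "opp M ` v \<subseteq> {1..n}" using v(2) by linarith+
    moreover have ed: "e \<in> darts M" using steps_darts[OF e(1)] i1 by simp
    ultimately have "e \<in> {1..n}" using vertex_neighbour_leaf e(2) by auto
    then have "e = i" using steps_leaf e(1) by blast
    then have "kids i = []" using length_kids[of i] \<open>card v = 1\<close> e(2) by simp
    moreover have "opp M i \<notin> {1..n}"
    proof
      assume "opp M i \<in> {1..n}"
      then show False using nr subtree_Leaf[of "opp M i"] by simp
    qed
    ultimately show "subtree i = Node []" using subtree_Node[OF i1(2)] by simp
  qed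
  then show ?R by (auto simp: code_def)
next
  assume R: ?R
  show ?L unfolding series_reduced_def
  proof
    fix v assume "v \<in> internal_vertices n M"
    then obtain i where i: "i \<in> root_leaves" "v \<in> beyond i" using internal_vertices_eq by blast
    have i1: "i \<in> {1..n}" "i \<in> darts M" using root_leaf[OF i(1)] leaf_dart by auto
    consider "subtree i = Node []" | "reduced (subtree i)" using R i(1) by (auto simp: code_def)
    then show "card v \<noteq> 2 \<and> (card v = 1 \<longrightarrow> opp M ` v \<subseteq> {1..n})"
    proof cases
      case 1
      have o: "opp M i \<notin> {1..n}" using 1 subtree_Leaf[of "opp M i"] by auto
      have k: "kids i = []" using 1 subtree_Node[OF i1(2) o] by simp
      then have v: "v = orbit (rot M) (opp M i)" using i(2) beyond_node[OF i1(2) o] by simp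
      moreover have "card v = 1" using length_kids[of i] k v by simp
      ultimately show ?thesis using vertex_neighbour_leaf[OF i1(2)] i1(1) by simp
    next
      case 2
      then show ?thesis using reduced_subtree_iff[OF i1(2)] i(2) by force
    qed
  qed
qed

lemma valid_code_iff:
  "disk_planar n M \<and> series_reduced n M \<longleftrightarrow> code \<in> valid_codes {1..n}"
proof -
  have "finite code" using finite_root_leaves by (simp add: code_def)
  moreover have "block p \<inter> block q = {}" if "p \<in> code" "q \<in> code" "p \<noteq> q" for p q
    using that code_eq by (metis disjoint_iff linked_refl)
  moreover have "(\<Union>p\<in>code. block p) = {1..n}"
  proof
    show "(\<Union>p\<in>code. block p) \<subseteq> {1..n}"
      using block_code root_leaf unfolding code_def by blast
    show "{1..n} \<subseteq> (\<Union>p\<in>code. block p)" using code_covers by blast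
  qed
  ultimately show ?thesis
    unfolding disk_planar_def contour_ordered_iff noncrossing_iff series_reduced_iff valid_codes_def
    by auto
qed

lemma connected_map_iff:
  assumes "1 \<le> n"
  shows "connected_map M \<longleftrightarrow> (\<exists>t. code = {(1, t)})"
proof
  have one: "1 \<in> root_leaves" using assms by (auto simp: root_leaves_def)
  assume "connected_map M"
  then have "i = 1" if "i \<in> root_leaves" for i
    using root_leaf_unique[OF that one] root_leaf[OF that] root_leaf[OF one] leaf_dart
    unfolding connected_map_def by blast
  then have "root_leaves = {1}" using one by blast
  then show "\<exists>t. code = {(1, t)}" by (simp add: code_def)
next
  assume "\<exists>t. code = {(1, t)}"
  then have "root_leaves \<subseteq> {1}" by (auto simp: code_def)
  then have "linked M 1 d" if "d \<in> darts M" for d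
    using root_leaf_exists[OF that] by blast
  then show "connected_map M" unfolding connected_map_def using linked_sym linked_trans by blast
qed

end

section \<open>Codes determine maps up to isomorphism\<close>

text \<open>The seeds are the root darts: the tree \<open>t\<close> ahead, the boundary vertex
  \<open>i\<close> behind.\<close>

definition code_edges :: "(nat \<times> ltree) set \<Rightarrow> (ltree \<times> ltree) set" where
  "code_edges S = edge_closure ((\<lambda>(i, t). (t, Leaf i)) ` S)"

context forest_map
begin

lemma edge_image: "edge ` darts M = code_edges code"
proof (intro equalityI subsetI)
  fix p assume "p \<in> edge ` darts M"
  then obtain d where d: "p = edge d" "d \<in> darts M" by blast
  obtain i where i: "i \<in> root_leaves" "linked M i d" using root_leaf_exists[OF d(2)] .
  have i1: "i \<in> darts M" using i(1) root_leaf leaf_dart by blast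
  have "edge d \<in> code_edges code"
    using i(2)
  proof (induction rule: linked_induct)
    case refl
    have "edge i = (\<lambda>(i, t). (t, Leaf i)) (i, subtree i)"
      using subtree_Leaf[OF root_leaf[OF i(1)]] by (simp add: edge_def)
    then show ?case unfolding code_edges_def code_def using i(1) by (intro edge_closure.base) blast
  next
    case (opp d)
    then show ?case unfolding code_edges_def edge_of_opp by (intro edge_closure.swap)
  next
    case (rot d)
    have "d \<in> darts M" using linked_darts[OF rot(1)] i1 by simp
    then show ?case using rot(2) unfolding code_edges_def edge_of_rot[OF \<open>d \<in> darts M\<close>]
      by (intro edge_closure.rot)
  qed
  then show "p \<in> code_edges code" using d by simp
next
  fix p assume "p \<in> code_edges code"
  then show "p \<in> edge ` darts M" unfolding code_edges_def
  proof (induction rule: edge_closure.induct)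
    case (base p)
    then obtain i where i: "i \<in> root_leaves" "p = (subtree i, Leaf i)" by (auto simp: code_def)
    then have "p = edge i" using subtree_Leaf root_leaf by (simp add: edge_def)
    then show ?case using i(1) root_leaf leaf_dart by blast
  next
    case (swap p)
    then obtain d where "p = edge d" "d \<in> darts M" by blast
    then show ?case using edge_of_opp[of d] by (metis image_eqI opp_in)
  next
    case (rot p)
    then obtain d where "p = edge d" "d \<in> darts M" by blast
    then show ?case using edge_of_rot[of d] by (metis image_eqI rot_in)
  qed
qed

end

text \<open>Both maps have the same set of dart pairs, generated from the common code, and pairs
  determine darts. Matching darts with equal pairs respects \<open>opp\<close> and
  \<open>rot\<close> because these act on pairs by the same formulas in both maps.\<close>

lemma map_iso_of_code_eq:
  assumes M: "forest_map n M" and N: "forest_map n N"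
    and eq: "forest_map.code n M = forest_map.code n N"
  shows "(M, N) \<in> map_iso n"
proof -
  interpret M: forest_map n M by (rule M)
  interpret N: forest_map n N by (rule N)
  define f where "f = (\<lambda>d. inv_into (darts N) N.edge (M.edge d))"
  have im: "M.edge ` darts M = N.edge ` darts N"
    by (simp add: M.edge_image N.edge_image eq)
  have bM: "bij_betw M.edge (darts M) (N.edge ` darts N)"
    using M.inj_on_edge im by (simp add: bij_betw_def)
  have bN: "bij_betw N.edge (darts N) (N.edge ` darts N)"
    using N.inj_on_edge by (simp add: bij_betw_def)
  have bij: "bij_betw f (darts M) (darts N)"
    using bij_betw_trans[OF bM bij_betw_inv_into[OF bN]] by (simp add: f_def comp_def)
  have f: "f d \<in> darts N" "N.edge (f d) = M.edge d" if "d \<in> darts M" for d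
  proof -
    have "M.edge d \<in> N.edge ` darts N" using that im by blast
    then show "f d \<in> darts N" "N.edge (f d) = M.edge d"
      unfolding f_def by (auto intro: inv_into_into f_inv_into_f)
  qed
  have uniq: "e = f d" if "d \<in> darts M" "e \<in> darts N" "N.edge e = M.edge d" for d e
    using f[OF that(1)] that(2,3) N.inj_on_edge by (metis inj_onD)
  have "f i = i" if "i \<in> {1..n}" for i
  proof -
    have "i \<in> darts M" using that by (rule M.leaf_dart)
    moreover have "snd (M.edge i) = Leaf i" using M.subtree_Leaf[OF that] by (simp add: M.edge_def)
    ultimately show ?thesis using N.edge_Leaf(2)[of "f i" i] f by simp
  qed
  moreover have "f (opp M d) = opp N (f d)" "f (rot M d) = rot N (f d)" if d: "d \<in> darts M" for d
    using uniq[of "opp M d" "opp N (f d)"] uniq[of "rot M d" "rot N (f d)"] f[OF d] d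
    by (simp_all add: M.edge_of_opp N.edge_of_opp M.edge_of_rot N.edge_of_rot)
  ultimately show ?thesis
    unfolding map_iso_def using bij M.wf N.wf by blast
qed

text \<open>One direction of an isomorphism. Invariance of a property follows by applying the lemmas
  below in each of the two directions.\<close>

definition map_hom :: "nat \<Rightarrow> dart_map \<Rightarrow> dart_map \<Rightarrow> (nat \<Rightarrow> nat) \<Rightarrow> bool" where
  "map_hom n M N f \<longleftrightarrow> f ` darts M \<subseteq> darts N \<and> inj_on f (darts M) \<and> (\<forall>i\<in>{1..n}. f i = i) \<and>
     (\<forall>d\<in>darts M. f (opp M d) = opp N (f d) \<and> f (rot M d) = rot N (f d))"

lemma map_iso_sym:
  assumes "(M, N) \<in> map_iso n"
  shows "(N, M) \<in> map_iso n"
proof -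
  obtain f where wf: "wf_map n M" "wf_map n N" and f: "bij_betw f (darts M) (darts N)"
    "\<And>i. i \<in> {1..n} \<Longrightarrow> f i = i"
    "\<And>d. d \<in> darts M \<Longrightarrow> f (opp M d) = opp N (f d) \<and> f (rot M d) = rot N (f d)"
    using assms by (auto simp: map_iso_def)
  interpret M: wf_dart_map n M by unfold_locales (rule wf)
  interpret N: wf_dart_map n N by unfold_locales (rule wf)
  let ?g = "inv_into (darts M) f"
  have inj: "?g (f d) = d" if "d \<in> darts M" for d
    using f(1) that by (simp add: bij_betw_def)
  have g: "?g e \<in> darts M" "f (?g e) = e" if "e \<in> darts N" for e
    using f(1) that by (auto simp: bij_betw_def intro: inv_into_into f_inv_into_f)
  have "?g i = i" if "i \<in> {1..n}" for i
    using inj[OF M.leaf_dart[OF that]] f(2)[OF that] by simp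
  moreover have "?g (opp N e) = opp M (?g e) \<and> ?g (rot N e) = rot M (?g e)" if "e \<in> darts N" for e
    using f(3)[OF g(1)[OF that]] g[OF that] inj[of "opp M (?g e)"] inj[of "rot M (?g e)"] by simp
  ultimately show ?thesis
    unfolding map_iso_def using wf bij_betw_inv_into[OF f(1)] by blast
qed

lemma map_iso_hom:
  assumes "(M, N) \<in> map_iso n"
  obtains f where "map_hom n M N f"
  using assms unfolding map_iso_def map_hom_def bij_betw_def by blast

lemma map_iso_wf: "(M, N) \<in> map_iso n \<Longrightarrow> wf_map n M" "(M, N) \<in> map_iso n \<Longrightarrow> wf_map n N"
  by (auto simp: map_iso_def)

lemma map_iso_refl: "wf_map n M \<Longrightarrow> (M, M) \<in> map_iso n"
  unfolding map_iso_def by (auto intro!: exI[of _ id])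

lemma map_iso_trans:
  assumes "(M, N) \<in> map_iso n" "(N, K) \<in> map_iso n"
  shows "(M, K) \<in> map_iso n"
proof -
  obtain f where f: "bij_betw f (darts M) (darts N)" "\<forall>i\<in>{1..n}. f i = i"
    "\<forall>d\<in>darts M. f (opp M d) = opp N (f d) \<and> f (rot M d) = rot N (f d)"
    using assms(1) by (auto simp: map_iso_def)
  obtain g where g: "bij_betw g (darts N) (darts K)" "\<forall>i\<in>{1..n}. g i = i"
    "\<forall>d\<in>darts N. g (opp N d) = opp K (g d) \<and> g (rot N d) = rot K (g d)"
    using assms(2) by (auto simp: map_iso_def)
  have "bij_betw (g \<circ> f) (darts M) (darts K)" by (rule bij_betw_trans[OF f(1) g(1)])
  moreover have "f d \<in> darts N" if "d \<in> darts M" for d using f(1) that by (rule bij_betwE[rule_format])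
  ultimately show ?thesis
    using f(2,3) g(2,3) map_iso_wf[OF assms(1)] map_iso_wf[OF assms(2)]
    unfolding map_iso_def by (auto intro!: exI[of _ "g \<circ> f"])
qed

section \<open>Structure carried along an injective homomorphism of dart maps\<close>

context
  fixes n M N f
  assumes M: "wf_map n M" and N: "wf_map n N" and hom: "map_hom n M N f"
begin

interpretation M: wf_dart_map n M by unfold_locales (rule M)
interpretation N: wf_dart_map n N by unfold_locales (rule N)

lemma hom_darts: "d \<in> darts M \<Longrightarrow> f d \<in> darts N"
  and hom_leaf: "i \<in> {1..n} \<Longrightarrow> f i = i"
  and hom_opp: "d \<in> darts M \<Longrightarrow> f (opp M d) = opp N (f d)"
  and hom_rot: "d \<in> darts M \<Longrightarrow> f (rot M d) = rot N (f d)"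
  and hom_inj: "d \<in> darts M \<Longrightarrow> e \<in> darts M \<Longrightarrow> f d = f e \<longleftrightarrow> d = e"
  using hom by (auto simp: map_hom_def inj_on_eq_iff)

lemma hom_linked:
  assumes "d \<in> darts M"
  shows "linked M d e \<Longrightarrow> linked N (f d) (f e)"
proof (induction rule: M.linked_induct)
  case (opp e)
  then have "e \<in> darts M" using M.linked_darts assms by blast
  then show ?case using N.linked_trans[OF opp(2) N.linked_opp] by (simp add: hom_opp)
next
  case (rot e)
  then have "e \<in> darts M" using M.linked_darts assms by blast
  then show ?case using N.linked_trans[OF rot(2) N.linked_rot] by (simp add: hom_rot)
qed simp

lemma hom_funpow_rot:
  assumes "d \<in> darts M"
  shows "f ((rot M ^^ j) d) = (rot N ^^ j) (f d) \<and> (rot M ^^ j) d \<in> darts M"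
  by (induction j) (use assms in \<open>auto simp: hom_rot\<close>)

lemma hom_orbit: "d \<in> darts M \<Longrightarrow> orbit (rot N) (f d) = f ` orbit (rot M) d"
  unfolding orbit_altdef using hom_funpow_rot[of d] by (auto simp: image_iff) metis

lemma hom_leaf_iff: "d \<in> darts M \<Longrightarrow> f d \<in> {1..n} \<longleftrightarrow> d \<in> {1..n}"
  using hom_leaf hom_inj M.leaf_dart by metis

text \<open>The image of a closed walk is a closed walk; injectivity keeps it free of
  backtracking.\<close>

lemma hom_acyclic:
  assumes "acyclic_map N"
  shows "acyclic_map M"
proof -
  let ?s = "\<lambda>M. {(d, e). d \<in> darts M \<and> e \<in> orbit (rot M) (opp M d) \<and> e \<noteq> opp M d}"
  have image: "(f d, f e) \<in> ?s N" if "(d, e) \<in> ?s M" for d e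
  proof -
    have d: "d \<in> darts M" "e \<in> orbit (rot M) (opp M d)" "e \<noteq> opp M d" using that by auto
    then have "e \<in> darts M" using M.orbit_darts by simp
    then have "f e \<noteq> opp N (f d)" using d hom_inj hom_opp by (metis M.opp_in)
    moreover have "f e \<in> orbit (rot N) (opp N (f d))"
      using hom_orbit[of "opp M d"] hom_opp d by simp
    ultimately show ?thesis using hom_darts d by blast
  qed
  have "(f d, f e) \<in> (?s N)\<^sup>+" if "(d, e) \<in> (?s M)\<^sup>+" for d e
    using that
  proof (induction rule: trancl_induct)
    case (base e)
    show ?case by (rule r_into_trancl[OF image[OF base]])
  next
    case (step e e')
    show ?case by (rule trancl_into_trancl[OF step(3) image[OF step(2)]])
  qed
  then show ?thesis using assms unfolding acyclic_map_def acyclic_def by blast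
qed

lemma hom_subtree:
  assumes "forest_map n M" "forest_map n N"
  shows "d \<in> darts M \<Longrightarrow> forest_map.subtree n N (f d) = forest_map.subtree n M d"
proof -
  interpret FM: forest_map n M by fact
  interpret FN: forest_map n N by fact
  show "FN.subtree (f d) = FM.subtree d" if "d \<in> darts M"
    using that
  proof (induction rule: FM.subtree_induct)
    case (leaf i)
    then show ?case using hom_opp[of i] hom_leaf[of i] M.leaf_dart[of i] FM.subtree_Leaf FN.subtree_Leaf
      by simp
  next
    case (node d)
    have o: "opp N (f d) = f (opp M d)" using hom_opp node(1) by simp
    have od: "opp M d \<in> darts M" using node(1) by simp
    have "card (orbit (rot N) (f (opp M d))) = card (orbit (rot M) (opp M d))"
      unfolding hom_orbit[OF od] using hom od M.orbit_darts
      by (intro card_image) (auto simp: map_hom_def intro: inj_on_subset)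
    then have "FN.kids (f d) = map f (FM.kids d)"
      unfolding FN.kids_def FM.kids_def o using hom_funpow_rot[OF od] by simp
    moreover have "FN.subtree (f e) = FM.subtree e" if "e \<in> set (FM.kids d)" for e
      using that node(3) FM.set_kids[OF node(1)] by blast
    moreover have "opp N (f d) \<notin> {1..n}" using hom_leaf_iff[OF od] o node(2) by simp
    ultimately show ?case
      using FM.subtree_Node[OF node(1,2)] FN.subtree_Node[of "f d"] hom_darts[OF node(1)] by simp
  qed
qed

end

lemma forest_map_iso:
  assumes "forest_map n M" and iso: "(M, N) \<in> map_iso n"
  shows "forest_map n N" and "forest_map.code n N = forest_map.code n M"
proof -
  interpret M: forest_map n M by fact
  have N: "wf_map n N" using iso by (rule map_iso_wf)
  obtain f where f: "map_hom n M N f" using iso by (rule map_iso_hom)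
  obtain g where g: "map_hom n N M g" using map_iso_sym[OF iso] by (rule map_iso_hom)
  interpret N: wf_dart_map n N by unfold_locales (rule N)
  \<comment> \<open>Injections in both directions between finite sets force equal cardinalities,
    hence \<open>f\<close> is onto.\<close>
  have surj: "darts N \<subseteq> f ` darts M"
  proof -
    have "card (darts N) \<le> card (f ` darts M)"
      using card_inj_on_le[of g "darts N" "darts M"] g f M.finite_darts
      by (auto simp: map_hom_def card_image)
    then show ?thesis
      using card_seteq[of "darts N" "f ` darts M"] f N.finite_darts by (auto simp: map_hom_def)
  qed
  show FN: "forest_map n N"
  proof unfold_locales
    show "acyclic_map N" by (rule hom_acyclic[OF N M.wf g M.acyclic_map])
    fix e assume "e \<in> darts N"
    then obtain d where d: "e = f d" "d \<in> darts M" using surj by blast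
    obtain i where i: "i \<in> {1..n}" "linked M d i" using M.reach[OF d(2)] by blast
    then have "linked N e i" using hom_linked[OF M.wf N f d(2) i(2)] hom_leaf[OF M.wf N f i(1)] d by simp
    then show "\<exists>i\<in>{1..n}. linked N e i" using i(1) by blast
  qed
  interpret N: forest_map n N by (rule FN)
  have "linked N i j \<longleftrightarrow> linked M i j" if "i \<in> {1..n}" "j \<in> {1..n}" for i j
    using hom_linked[OF M.wf N f M.leaf_dart[OF that(1)], of j] hom_leaf[OF M.wf N f that(1)]
      hom_leaf[OF M.wf N f that(2)] hom_linked[OF N M.wf g N.leaf_dart[OF that(1)], of j]
      hom_leaf[OF N M.wf g that(1)] hom_leaf[OF N M.wf g that(2)] by auto
  then have "N.root_leaves = M.root_leaves"
    unfolding N.root_leaves_def M.root_leaves_def by auto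
  moreover have "N.subtree i = M.subtree i" if "i \<in> {1..n}" for i
    using hom_subtree[OF M.wf N f \<open>forest_map n M\<close> FN M.leaf_dart[OF that]] hom_leaf[OF M.wf N f that] by simp
  ultimately show "N.code = M.code"
    unfolding N.code_def M.code_def using M.root_leaf by (intro image_cong) auto
qed

section \<open>Rerooting a plane tree at its edges\<close>

text \<open>Darts have to be natural numbers; \<open>to_nat\<close> will number the pairs of
  trees.\<close>

instance ltree :: countable
  by countable_datatype

text \<open>The second dart is one that may follow the first on a walk without backtracking.\<close>

definition child_edge :: "(ltree \<times> ltree) rel" where
  "child_edge = {((Node (bef @ a # aft), u), (a, Node (aft @ u # bef))) | bef a aft u. True}"

lemma child_edgeI: "((Node (bef @ a # aft), u), (a, Node (aft @ u # bef))) \<in> child_edge"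
  by (auto simp: child_edge_def)

lemma child_edgeE:
  assumes "(p, q) \<in> child_edge"
  obtains bef a aft u where "p = (Node (bef @ a # aft), u)" "q = (a, Node (aft @ u # bef))"
  using assms by (auto simp: child_edge_def)

lemma child_edge_Leaf: "((Leaf i, u), q) \<notin> child_edge" "(p, (s, Leaf i)) \<notin> child_edge"
  by (auto simp: child_edge_def)

lemma child_edge_iff:
  "((Node ts, u), q) \<in> child_edge \<longleftrightarrow> (\<exists>bef a aft. ts = bef @ a # aft \<and> q = (a, Node (aft @ u # bef)))"
  by (auto simp: child_edge_def)

lemma child_edge_size: "(p, q) \<in> child_edge \<Longrightarrow> size (fst q) < size (fst p)"
  by (erule child_edgeE) simp

text \<open>A move into a child only shifts leaves from the tree ahead to the tree behind; the
  multiset of all leaves of the component stays the same.\<close>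

lemma child_edge_leaves:
  assumes "(p, q) \<in> child_edge"
  shows "mset (leaves (fst q)) + mset (leaves (snd q)) = mset (leaves (fst p)) + mset (leaves (snd p))"
    and "set (leaves (fst q)) \<subseteq> set (leaves (fst p))"
    and "set (leaves (snd p)) \<subseteq> set (leaves (snd q))"
  using assms by (auto elim!: child_edgeE)

lemma child_edges_leaves:
  assumes "(p, q) \<in> child_edge\<^sup>*"
  shows "mset (leaves (fst q)) + mset (leaves (snd q)) = mset (leaves (fst p)) + mset (leaves (snd p)) \<and>
    set (leaves (fst q)) \<subseteq> set (leaves (fst p)) \<and> set (leaves (snd p)) \<subseteq> set (leaves (snd q))"
  using assms
proof (induction rule: rtrancl_induct)
  case (step q r)
  then show ?case using child_edge_leaves[OF step(2)] by auto
qed simp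

lemma child_edge_reduced: "(p, q) \<in> child_edge \<Longrightarrow> reduced (fst p) \<Longrightarrow> reduced (fst q)"
  by (erule child_edgeE) auto

lemma child_edges_reduced: "(p, q) \<in> child_edge\<^sup>* \<Longrightarrow> reduced (fst p) \<Longrightarrow> reduced (fst q)"
  by (induction rule: rtrancl_induct) (auto dest: child_edge_reduced)

lemma reduced_leaves: "reduced t \<Longrightarrow> leaves t \<noteq> []"
proof (induction t)
  case (Node ts)
  then show ?case by (cases ts) auto
qed simp

lemma child_edges_Leaf: "((t, Leaf r), (s, Leaf i)) \<in> child_edge\<^sup>* \<Longrightarrow> s = t \<and> i = r"
  by (erule rtranclE) (auto simp: child_edge_Leaf)

lemma finite_child_edges: "finite {q. (p, q) \<in> child_edge\<^sup>*}"
proof (induction "size (fst p)" arbitrary: p rule: less_induct)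
  case less
  have fin: "finite {q. (p, q) \<in> child_edge}"
  proof -
    obtain t u where p: "p = (t, u)" by force
    show ?thesis
    proof (cases t)
      case (Leaf i)
      then show ?thesis using child_edge_Leaf p by simp
    next
      case (Node ts)
      have "{q. (p, q) \<in> child_edge} \<subseteq>
          (\<lambda>j. (ts ! j, Node (drop (Suc j) ts @ u # take j ts))) ` {..<length ts}"
      proof
        fix q assume "q \<in> {q. (p, q) \<in> child_edge}"
        then obtain bef a aft where "ts = bef @ a # aft" "q = (a, Node (aft @ u # bef))"
          using child_edge_iff p Node by auto
        then show "q \<in> (\<lambda>j. (ts ! j, Node (drop (Suc j) ts @ u # take j ts))) ` {..<length ts}"
          by (intro image_eqI[of _ _ "length bef"]) auto
      qed
      then show ?thesis by (rule finite_subset) simp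
    qed
  qed
  have "{q. (p, q) \<in> child_edge\<^sup>*} = insert p (\<Union>q\<in>{q. (p, q) \<in> child_edge}. {r. (q, r) \<in> child_edge\<^sup>*})"
    by (intro set_eqI iffI) (auto elim: converse_rtranclE intro: converse_rtrancl_into_rtrancl)
  then show ?case using fin less child_edge_size by simp
qed

text \<open>With distinct leaves, \<open>i\<close> occurs in a single child at each node, so the
  descent towards it is forced, and with it the tree behind \<open>i\<close>.\<close>

lemma unique_leaf_edge:
  assumes "distinct (leaves (fst p))" "(p, (Leaf i, v)) \<in> child_edge\<^sup>*" "(p, (Leaf i, w)) \<in> child_edge\<^sup>*"
  shows "v = w"
  using assms
proof (induction "size (fst p)" arbitrary: p rule: less_induct)
  case less
  obtain t u where p: "p = (t, u)" by force
  show ?case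
  proof (cases t)
    case (Leaf j)
    then have "q = p" if "(p, q) \<in> child_edge\<^sup>*" for q
      using that child_edge_Leaf(1) p by (metis converse_rtranclE)
    from this[OF less.prems(2)] this[OF less.prems(3)] show ?thesis by (metis prod.inject)
  next
    case (Node ts)
    have "\<exists>bef a aft. ts = bef @ a # aft \<and> ((a, Node (aft @ u # bef)), (Leaf i, v)) \<in> child_edge\<^sup>* \<and> i \<in> set (leaves a)"
      if "(p, (Leaf i, v)) \<in> child_edge\<^sup>*" for v
      using that
    proof (cases rule: converse_rtranclE)
      case base
      then show ?thesis using p Node by simp
    next
      case (step q)
      then obtain bef a aft where "ts = bef @ a # aft" "q = (a, Node (aft @ u # bef))"
        using child_edge_iff p Node by auto
      then show ?thesis using child_edges_leaves[OF step(2)] step(2) by auto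
    qed
    from this[OF less.prems(2)] this[OF less.prems(3)]
    obtain bef a aft bef' a' aft' where
      1: "ts = bef @ a # aft" "((a, Node (aft @ u # bef)), (Leaf i, v)) \<in> child_edge\<^sup>*" "i \<in> set (leaves a)" and
      2: "ts = bef' @ a' # aft'" "((a', Node (aft' @ u # bef')), (Leaf i, w)) \<in> child_edge\<^sup>*" "i \<in> set (leaves a')"
      by blast
    have d: "distinct (concat (map leaves ts))" using less.prems(1) p Node by simp
    have "i \<notin> set (leaves b)" if "b \<in> set bef \<union> set aft" for b
      using d that 1(3) unfolding 1(1) by auto
    moreover have "i \<notin> set (leaves b)" if "b \<in> set bef' \<union> set aft'" for b
      using d that 2(3) unfolding 2(1) by auto
    ultimately have "a' \<notin> set bef" "a \<notin> set bef'" using 1 2 by auto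
    then have "bef = bef' \<and> a = a' \<and> aft = aft'"
      using 1(1) 2(1) by (auto simp: append_eq_append_conv2 append_eq_Cons_conv Cons_eq_append_conv)
    then show ?thesis
      using less.hyps[of "(a, Node (aft @ u # bef))"] 1 2 d p Node by (auto simp: child_edge_size)
  qed
qed

text \<open>Single rotations pass over the children in \<open>bef\<close> one at a time until
  \<open>a\<close> is reached.\<close>

lemma edge_closure_descend:
  "(u, Node (bef @ a # aft)) \<in> edge_closure E \<Longrightarrow> (a, Node (aft @ u # bef)) \<in> edge_closure E"
proof (induction bef arbitrary: u aft)
  case Nil
  then show ?case using edge_closure.rot by fastforce
next
  case (Cons b bef)
  then have "(b, Node (bef @ a # aft @ [u])) \<in> edge_closure E" using edge_closure.rot by fastforce
  from Cons.IH[OF this] show ?case by simp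
qed

lemma edge_closure_child_edge:
  "(p, q) \<in> child_edge \<Longrightarrow> p \<in> edge_closure E \<Longrightarrow> q \<in> edge_closure E"
  by (erule child_edgeE) (metis edge_closure.swap edge_closure_descend swap_simp)

lemma edge_closure_child_edges:
  "(p, q) \<in> child_edge\<^sup>* \<Longrightarrow> p \<in> edge_closure E \<Longrightarrow> q \<in> edge_closure E"
  by (induction rule: rtrancl_induct) (auto intro: edge_closure_child_edge)

text \<open>Turning around the vertex where \<open>(s, u)\<close> ends gives its reverse and its
  children. Hence \<open>child_edge\<close> is the counterpart on pairs of a step without
  backtracking.\<close>

lemma orbit_edge_rot:
  "p \<in> orbit edge_rot (u, s) \<Longrightarrow> p = (u, s) \<or> ((s, u), p) \<in> child_edge"
proof (cases s)
  case (Leaf i)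
  assume "p \<in> orbit edge_rot (u, s)"
  then show ?thesis using Leaf orbit_eq_singleton_iff[of edge_rot "(u, s)"] by auto
next
  case (Node ts)
  have step: "edge_rot p = (u, s) \<or> ((s, u), edge_rot p) \<in> child_edge"
    if p: "p = (u, s) \<or> ((s, u), p) \<in> child_edge" for p
  proof -
    consider "p = (u, Node ts)" | bef a aft where "ts = bef @ a # aft" "p = (a, Node (aft @ u # bef))"
      using p unfolding Node child_edge_iff by blast
    then show ?thesis
    proof cases
      case 1
      then show ?thesis unfolding Node child_edge_iff by (cases ts) auto
    next
      case 2
      show ?thesis
      proof (cases aft)
        case Nil
        then show ?thesis using 2 Node by simp
      next
        case (Cons b aft')
        then show ?thesis using 2 Node child_edgeI[of "bef @ [a]" b aft' u] by simp
      qed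
    qed
  qed
  assume "p \<in> orbit edge_rot (u, s)"
  then show ?thesis by (induction rule: orbit.induct) (use step in blast)+
qed

text \<open>The counterpart of \<open>linked_root\<close> for codes: pairs pointing away from a root
  or towards it are closed under swapping and rotating. All properties of the closure can then be
  checked along descents from the roots.\<close>

lemma code_edges_iff:
  "p \<in> code_edges S \<longleftrightarrow>
    (\<exists>(i, t)\<in>S. ((t, Leaf i), p) \<in> child_edge\<^sup>* \<or> ((t, Leaf i), prod.swap p) \<in> child_edge\<^sup>*)"
  (is "_ \<longleftrightarrow> ?U p")
proof
  assume "p \<in> code_edges S"
  then show "?U p" unfolding code_edges_def
  proof (induction rule: edge_closure.induct)
    case (base p)
    then show ?case by auto
  next
    case (swap p)
    then show ?case by (simp, blast)
  next
    case (rot p)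
    then obtain i t where it: "(i, t) \<in> S"
      and or: "((t, Leaf i), p) \<in> child_edge\<^sup>* \<or> ((t, Leaf i), prod.swap p) \<in> child_edge\<^sup>*"
      by blast
    from or have "((t, Leaf i), edge_rot p) \<in> child_edge\<^sup>* \<or> ((t, Leaf i), prod.swap (edge_rot p)) \<in> child_edge\<^sup>*"
    proof
      assume "((t, Leaf i), prod.swap p) \<in> child_edge\<^sup>*"
      moreover obtain u s where p: "p = (u, s)" by force
      have "edge_rot p = p \<or> ((s, u), edge_rot p) \<in> child_edge"
        using orbit_edge_rot[OF orbit.base[of edge_rot "(u, s)"]] p by simp
      ultimately show ?thesis using p by (metis rtrancl_into_rtrancl swap_simp)
    next
      assume "((t, Leaf i), p) \<in> child_edge\<^sup>*"
      then show ?thesis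
      proof (cases rule: rtranclE)
        case base
        then have "p = (t, Leaf i)" by simp
        then show ?thesis by simp
      next
        case (step q)
        from step(2) obtain bef a aft u where q: "q = (Node (bef @ a # aft), u)" "p = (a, Node (aft @ u # bef))"
          by (elim child_edgeE)
        show ?thesis
        proof (cases aft)
          \<comment> \<open>Rotating past the last child leads back to the edge of the parent,
            reversed.\<close>
          case Nil
          then have "prod.swap (edge_rot p) = q" using q by simp
          then show ?thesis using step(1) by simp
        next
          case (Cons b aft')
          then have "(q, edge_rot p) \<in> child_edge"
            using q child_edgeI[of "bef @ [a]" b aft' u] by simp
          then show ?thesis using step(1) by (meson rtrancl_into_rtrancl)
        qed
      qed
    qed
    then show ?case using it by blast
  qed
next
  assume "?U p"
  then obtain i t where it: "(i, t) \<in> S"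
    and p: "((t, Leaf i), p) \<in> child_edge\<^sup>* \<or> ((t, Leaf i), prod.swap p) \<in> child_edge\<^sup>*"
    by blast
  have "(t, Leaf i) \<in> edge_closure ((\<lambda>(i, t). (t, Leaf i)) ` S)"
    using it by (intro edge_closure.base) force
  then have "p \<in> edge_closure ((\<lambda>(i, t). (t, Leaf i)) ` S) \<or> prod.swap p \<in> edge_closure ((\<lambda>(i, t). (t, Leaf i)) ` S)"
    using p edge_closure_child_edges by blast
  then show "p \<in> code_edges S" unfolding code_edges_def using edge_closure.swap by fastforce
qed

section \<open>Realising every valid code\<close>

text \<open>A pair with a leaf behind it starts at a boundary vertex, and \<open>wf_map\<close>
  wants such a dart to be the label itself. All other pairs are numbered above
  \<open>n\<close>.\<close>

definition encode :: "nat \<Rightarrow> ltree \<times> ltree \<Rightarrow> nat" where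
  "encode n p = (case snd p of Leaf i \<Rightarrow> i | Node _ \<Rightarrow> Suc n + to_nat p)"

text \<open>Conjugates \<open>h\<close> by the numbering; being the identity elsewhere is part of
  what \<open>permutes\<close> demands.\<close>

definition transport :: "nat \<Rightarrow> (ltree \<times> ltree) set \<Rightarrow> (ltree \<times> ltree \<Rightarrow> ltree \<times> ltree) \<Rightarrow> nat \<Rightarrow> nat" where
  "transport n E h x = (if x \<in> encode n ` E then encode n (h (inv_into E (encode n) x)) else x)"

definition code_map :: "nat \<Rightarrow> (nat \<times> ltree) set \<Rightarrow> dart_map" where
  "code_map n S = \<lparr>darts = encode n ` code_edges S,
     opp = transport n (code_edges S) prod.swap, rot = transport n (code_edges S) edge_rot\<rparr>"

lemma code_edges_swap: "p \<in> code_edges S \<Longrightarrow> prod.swap p \<in> code_edges S"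
  and code_edges_rot: "p \<in> code_edges S \<Longrightarrow> edge_rot p \<in> code_edges S"
  unfolding code_edges_def by (rule edge_closure.intros, assumption)+

lemma code_edges_root: "(i, t) \<in> S \<Longrightarrow> (t, Leaf i) \<in> code_edges S"
  unfolding code_edges_def by (rule edge_closure.base) force

locale valid_code =
  fixes n :: nat and S :: "(nat \<times> ltree) set"
  assumes valid: "S \<in> valid_codes {1..n}"
begin

abbreviation "E \<equiv> code_edges S"

lemma finite_code: "finite S"
  and code_sorted: "(i, t) \<in> S \<Longrightarrow> sorted_wrt (<) (i # leaves t)"
  and code_reduced: "(i, t) \<in> S \<Longrightarrow> t = Node [] \<or> reduced t"
  and blocks_cover: "(\<Union>p\<in>S. block p) = {1..n}"
  using valid by (auto simp: valid_codes_def)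

lemma block_disjoint: "p \<in> S \<Longrightarrow> q \<in> S \<Longrightarrow> a \<in> block p \<Longrightarrow> a \<in> block q \<Longrightarrow> p = q"
proof -
  have "\<forall>p\<in>S. \<forall>q\<in>S. p \<noteq> q \<longrightarrow> block p \<inter> block q = {}"
    using valid by (simp add: valid_codes_def)
  then show "p \<in> S \<Longrightarrow> q \<in> S \<Longrightarrow> a \<in> block p \<Longrightarrow> a \<in> block q \<Longrightarrow> p = q" by blast
qed

lemma block_exists:
  assumes "i \<in> {1..n}"
  obtains r t where "(r, t) \<in> S" "i \<in> block (r, t)"
proof -
  have "i \<in> (\<Union>p\<in>S. block p)" using assms unfolding blocks_cover .
  then obtain p where "p \<in> S" "i \<in> block p" by blast
  then show thesis using that by (cases p) blast
qed

lemma code_distinct: "(i, t) \<in> S \<Longrightarrow> distinct (i # leaves t)"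
  using code_sorted strict_sorted_iff by blast

lemma finite_edges: "finite E"
proof -
  have "E \<subseteq> (\<Union>(i, t)\<in>S. {q. ((t, Leaf i), q) \<in> child_edge\<^sup>*} \<union> prod.swap ` {q. ((t, Leaf i), q) \<in> child_edge\<^sup>*})"
  proof
    fix p assume "p \<in> E"
    then obtain i t where "(i, t) \<in> S" "((t, Leaf i), p) \<in> child_edge\<^sup>* \<or> ((t, Leaf i), prod.swap p) \<in> child_edge\<^sup>*"
      unfolding code_edges_iff by blast
    moreover have "p = prod.swap (prod.swap p)" by simp
    ultimately show "p \<in> (\<Union>(i, t)\<in>S. {q. ((t, Leaf i), q) \<in> child_edge\<^sup>*} \<union> prod.swap ` {q. ((t, Leaf i), q) \<in> child_edge\<^sup>*})"
      by blast
  qed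
  then show ?thesis
    by (rule finite_subset) (use finite_code finite_child_edges in auto)
qed

text \<open>Descents preserve the leaf multiset, which is duplicate-free in a valid code. A tree
  ahead without leaves is not reduced, so it can only be the whole \<open>Node []\<close> at the
  root.\<close>

lemma descendant:
  assumes S: "(r, t) \<in> S" and p: "((t, Leaf r), p) \<in> child_edge\<^sup>*"
  shows "distinct (leaves (fst p) @ leaves (snd p))"
    and "set (leaves (fst p)) \<union> set (leaves (snd p)) = block (r, t)"
    and "set (leaves (fst p)) \<subseteq> set (leaves t)"
    and "r \<in> set (leaves (snd p))"
    and "leaves (fst p) = [] \<Longrightarrow> p = (t, Leaf r)"
proof -
  have m: "mset (leaves (fst p) @ leaves (snd p)) = mset (leaves t @ [r])"
    using child_edges_leaves[OF p] by simp
  show "distinct (leaves (fst p) @ leaves (snd p))"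
    using mset_eq_imp_distinct_iff[OF m] code_distinct[OF S] by auto
  show "set (leaves (fst p)) \<union> set (leaves (snd p)) = block (r, t)"
    using mset_eq_setD[OF m] by (auto simp: block_def)
  show "set (leaves (fst p)) \<subseteq> set (leaves t)" "r \<in> set (leaves (snd p))"
    using child_edges_leaves[OF p] by auto
  show "p = (t, Leaf r)" if l: "leaves (fst p) = []"
  proof -
    have "\<not> reduced t" using child_edges_reduced[OF p] reduced_leaves l by auto
    then have "t = Node []" using code_reduced[OF S] by blast
    then show ?thesis using p by (auto elim!: converse_rtranclE simp: child_edge_def)
  qed
qed

text \<open>The two sides share no leaf, and one of them contains the root label, so they differ.
  This gives \<open>opp M d \<noteq> d\<close> for the constructed map.\<close>

lemma edge_neq: "(s, u) \<in> E \<Longrightarrow> s \<noteq> u"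
  unfolding code_edges_iff using descendant(1,4) by fastforce

lemma edge_leaves_nonempty: "(Node ts, u) \<in> E \<Longrightarrow> ts \<noteq> [] \<Longrightarrow> leaves u \<noteq> []"
  unfolding code_edges_iff using descendant(4,5) by fastforce

lemma edge_leaves_disjoint: "(s, u) \<in> E \<Longrightarrow> set (leaves s) \<inter> set (leaves u) = {}"
  unfolding code_edges_iff using descendant(1) by fastforce

text \<open>The label \<open>i\<close> fixes the component because blocks are disjoint, and within
  it the descent to \<open>i\<close> is unique. This makes \<open>encode\<close> injective on
  boundary darts.\<close>

lemma leaf_edge_unique:
  assumes "(s, Leaf i) \<in> E" "(s', Leaf i) \<in> E"
  shows "s = s'"
proof -
  have *: "\<exists>t. (i, t) \<in> S \<and> s = t \<or> (\<exists>r. (r, t) \<in> S \<and> ((t, Leaf r), (Leaf i, s)) \<in> child_edge\<^sup>* \<and>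
      i \<in> set (leaves t) \<and> i \<in> block (r, t))" if s: "(s, Leaf i) \<in> E" for s
  proof -
    obtain r t where rt: "(r, t) \<in> S"
      and or: "((t, Leaf r), (s, Leaf i)) \<in> child_edge\<^sup>* \<or> ((t, Leaf r), (Leaf i, s)) \<in> child_edge\<^sup>*"
      using s unfolding code_edges_iff by auto
    from or show ?thesis
    proof
      assume "((t, Leaf r), (s, Leaf i)) \<in> child_edge\<^sup>*"
      then show ?thesis using child_edges_Leaf rt by blast
    next
      assume d: "((t, Leaf r), (Leaf i, s)) \<in> child_edge\<^sup>*"
      then show ?thesis using rt descendant(2,3)[OF rt d] by auto
    qed
  qed
  have root: "i \<in> block (i, t)" for t by (simp add: block_def)
  have notin: "i \<notin> set (leaves t)" if "(i, t) \<in> S" for t using code_distinct[OF that] by simp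
  from *[OF assms(1)] obtain t where t: "(i, t) \<in> S \<and> s = t \<or> (\<exists>r. (r, t) \<in> S \<and>
      ((t, Leaf r), (Leaf i, s)) \<in> child_edge\<^sup>* \<and> i \<in> set (leaves t) \<and> i \<in> block (r, t))" by blast
  from *[OF assms(2)] obtain t' where t': "(i, t') \<in> S \<and> s' = t' \<or> (\<exists>r. (r, t') \<in> S \<and>
      ((t', Leaf r), (Leaf i, s')) \<in> child_edge\<^sup>* \<and> i \<in> set (leaves t') \<and> i \<in> block (r, t'))" by blast
  have same: "r = r' \<and> t = t'" if "(r, t) \<in> S" "(r', t') \<in> S" "i \<in> block (r, t)" "i \<in> block (r', t')" for r r'
    using block_disjoint[OF that] by simp
  show ?thesis
    using t t'
  proof (elim disjE exE conjE)
    fix r r'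
    assume 1: "(r, t) \<in> S" "((t, Leaf r), Leaf i, s) \<in> child_edge\<^sup>*" "i \<in> block (r, t)"
      "(r', t') \<in> S" "((t', Leaf r'), Leaf i, s') \<in> child_edge\<^sup>*" "i \<in> block (r', t')"
    then have "r = r' \<and> t = t'" using same by blast
    then show "s = s'" using unique_leaf_edge[of "(t, Leaf r)" i s s'] 1 code_distinct[OF 1(1)] by simp
  qed (use same root notin in blast)+
qed

lemma edge_Leaf_range: "(s, Leaf i) \<in> E \<Longrightarrow> i \<in> {1..n}"
proof -
  assume "(s, Leaf i) \<in> E"
  then obtain r t where rt: "(r, t) \<in> S"
    and or: "((t, Leaf r), (s, Leaf i)) \<in> child_edge\<^sup>* \<or> ((t, Leaf r), (Leaf i, s)) \<in> child_edge\<^sup>*"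
    unfolding code_edges_iff by auto
  then have "i \<in> block (r, t)" using descendant(2)[OF rt] by fastforce
  then show "i \<in> {1..n}" using blocks_cover rt by blast
qed

lemma leaf_edge_exists:
  assumes "i \<in> {1..n}"
  obtains s where "(s, Leaf i) \<in> E"
proof -
  obtain r t where rt: "(r, t) \<in> S" "i \<in> block (r, t)" using block_exists[OF assms] .
  have down: "\<exists>v. (Leaf i, v) \<in> E" if "(s, u) \<in> E" "i \<in> set (leaves s)" for s u
    using that
  proof (induction s arbitrary: u)
    case (Leaf j)
    then show ?case by auto
  next
    case (Node ts)
    then obtain a where a: "a \<in> set ts" "i \<in> set (leaves a)" by auto
    then obtain bef aft where ts: "ts = bef @ a # aft" by (metis split_list)
    have "(a, Node (aft @ u # bef)) \<in> E"
      using edge_closure_child_edge[OF child_edgeI] Node.prems(1) unfolding ts code_edges_def .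
    then show ?case using Node.IH a by blast
  qed
  have E: "(t, Leaf r) \<in> E" using rt(1) by (rule code_edges_root)
  consider "i = r" | "i \<in> set (leaves t)" using rt(2) by (auto simp: block_def)
  then show thesis
  proof cases
    case 1
    then show thesis using that E by simp
  next
    case 2
    then obtain v where "(Leaf i, v) \<in> E" using down[OF E] by blast
    then show thesis using that code_edges_swap[of "(Leaf i, v)" S] by simp
  qed
qed

lemma inj_encode: "inj_on (encode n) E"
proof (rule inj_onI)
  fix p q assume p: "p \<in> E" and q: "q \<in> E" and eq: "encode n p = encode n q"
  obtain s u where su: "p = (s, u)" by force
  obtain s' u' where su': "q = (s', u')" by force
  show "p = q"
  proof (cases u; cases u')
    fix i j assume "u = Leaf i" "u' = Leaf j"
    then show ?thesis using leaf_edge_unique p q eq su su' by (auto simp: encode_def)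
  next
    fix i ts assume u: "u = Leaf i" "u' = Node ts"
    then show ?thesis using edge_Leaf_range[of s i] p eq su su' by (auto simp: encode_def)
  next
    fix i ts assume u: "u = Node ts" "u' = Leaf i"
    then show ?thesis using edge_Leaf_range[of s' i] q eq su su' by (auto simp: encode_def)
  next
    fix ts ts' assume u: "u = Node ts" "u' = Node ts'"
    then show ?thesis using eq su su' by (auto simp: encode_def)
  qed
qed

abbreviation "e \<equiv> encode n"
abbreviation "K \<equiv> code_map n S"

lemma darts_K: "darts K = e ` E"
  by (simp add: code_map_def)

lemma opp_K: "p \<in> E \<Longrightarrow> opp K (e p) = e (prod.swap p)"
  and rot_K: "p \<in> E \<Longrightarrow> rot K (e p) = e (edge_rot p)"
  using inj_encode by (auto simp: code_map_def transport_def)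

lemma e_eq_iff: "p \<in> E \<Longrightarrow> q \<in> E \<Longrightarrow> e p = e q \<longleftrightarrow> p = q"
  using inj_encode by (rule inj_on_eq_iff)

lemma transport_permutes:
  assumes "\<And>p. p \<in> E \<Longrightarrow> h p \<in> E" "inj_on h E"
  shows "transport n E h permutes e ` E"
proof (rule bij_imp_permutes)
  have "h ` E = E" using endo_inj_surj[OF finite_edges _ assms(2)] assms(1) by blast
  then have "bij_betw (e \<circ> h) E (e ` E)"
    using bij_betw_trans[of h E E e "e ` E"] assms(2) inj_encode by (simp add: bij_betw_def)
  moreover have "bij_betw (inv_into E e) (e ` E) E"
    using inj_encode by (intro bij_betw_inv_into) (simp add: bij_betw_def)
  ultimately have "bij_betw (e \<circ> h \<circ> inv_into E e) (e ` E) (e ` E)" by (rule bij_betw_trans[rotated])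
  then show "bij_betw (transport n E h) (e ` E) (e ` E)"
    by (rule bij_betw_cong[THEN iffD1, rotated]) (auto simp: transport_def)
qed (auto simp: transport_def)

lemma leaf_K:
  assumes "i \<in> {1..n}"
  obtains s where "(s, Leaf i) \<in> E" "e (s, Leaf i) = i"
proof -
  obtain s where "(s, Leaf i) \<in> E" using leaf_edge_exists[OF assms] .
  then show thesis using that by (simp add: encode_def)
qed

lemma wf_K: "wf_map n K"
  unfolding wf_map_def
proof (intro conjI ballI)
  show "finite (darts K)" using finite_edges by (simp add: darts_K)
  show "{1..n} \<subseteq> darts K"
  proof
    fix i assume "i \<in> {1..n}"
    then obtain s where "(s, Leaf i) \<in> E" "e (s, Leaf i) = i" using leaf_K by blast
    then show "i \<in> darts K" unfolding darts_K by (metis image_eqI)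
  qed
  show "opp K permutes darts K"
    using transport_permutes[of prod.swap] code_edges_swap by (simp add: code_map_def)
  show "rot K permutes darts K"
    using transport_permutes[of edge_rot] code_edges_rot inj_edge_rot
    by (simp add: code_map_def inj_on_def)
next
  fix d assume "d \<in> darts K"
  then obtain p where p: "d = e p" "p \<in> E" by (auto simp: darts_K)
  have "prod.swap p \<noteq> p" using edge_neq p(2) by (cases p) auto
  then show "opp K d \<noteq> d" "opp K (opp K d) = d"
    using p code_edges_swap by (simp_all add: opp_K e_eq_iff)
next
  fix i assume "i \<in> {1..n}"
  then obtain s where s: "(s, Leaf i) \<in> E" "e (s, Leaf i) = i" using leaf_K by blast
  show "rot K i = i" using rot_K[OF s(1)] s(2) by simp
qed

lemma funpow_rot_K: "p \<in> E \<Longrightarrow> (rot K ^^ j) (e p) = e ((edge_rot ^^ j) p) \<and> (edge_rot ^^ j) p \<in> E"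
  by (induction j) (auto simp: rot_K code_edges_rot)

lemma orbit_K: "p \<in> E \<Longrightarrow> orbit (rot K) (e p) = e ` orbit edge_rot p"
  unfolding orbit_altdef using funpow_rot_K[of p] by (auto simp: image_iff)

lemma orbit_edges: "q \<in> orbit edge_rot p \<Longrightarrow> p \<in> E \<Longrightarrow> q \<in> E"
  by (induction rule: orbit.induct) (auto intro: code_edges_rot)

text \<open>Each step without backtracking enters a child of the tree ahead, so the size of that
  tree is a decreasing measure.\<close>

lemma acyclic_K: "acyclic_map K"
proof -
  let ?r = "{(d, x). d \<in> darts K \<and> x \<in> orbit (rot K) (opp K d) \<and> x \<noteq> opp K d}"
  have "?r\<inverse> \<subseteq> measure (\<lambda>d. size (fst (inv_into E e d)))"
  proof (intro subrelI, unfold converse_iff)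
    fix x d assume "(d, x) \<in> ?r"
    then obtain s u where su: "d = e (s, u)" "(s, u) \<in> E"
      and x: "x \<in> orbit (rot K) (opp K d)" "x \<noteq> opp K d"
      by (auto simp: darts_K)
    have us: "(u, s) \<in> E" using code_edges_swap[OF su(2)] by simp
    then obtain q where q: "x = e q" "q \<in> orbit edge_rot (u, s)"
      using x(1) opp_K[OF su(2)] orbit_K su(1) by auto
    have "q \<noteq> (u, s)" using x(2) q(1) opp_K[OF su(2)] su(1) by auto
    then have "((s, u), q) \<in> child_edge" using orbit_edge_rot[OF q(2)] by blast
    then have "size (fst q) < size s" using child_edge_size by fastforce
    then show "(x, d) \<in> measure (\<lambda>d. size (fst (inv_into E e d)))"
      using su q(1) orbit_edges[OF q(2) us] inj_encode by simp
  qed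
  then have "wf (?r\<inverse>)" by (rule wf_subset[OF wf_measure])
  then have "acyclic (?r\<inverse>)" by (rule wf_acyclic)
  then show ?thesis unfolding acyclic_map_def acyclic_converse .
qed

interpretation wf_dart_map n K by unfold_locales (rule wf_K)

lemma linked_edges: "p \<in> E \<Longrightarrow> \<exists>i\<in>{1..n}. linked K (e p) i"
  unfolding code_edges_def
proof (induction rule: edge_closure.induct)
  case (base p)
  then obtain i t where "p = (t, Leaf i)" "(i, t) \<in> S" by auto
  then show ?case using edge_Leaf_range[OF code_edges_root] by (auto simp: encode_def intro!: bexI[of _ i])
next
  case (swap p)
  have "linked K (e (prod.swap p)) (e p)"
    using linked_opp[of "e p"] opp_K swap(1) linked_sym unfolding code_edges_def by metis
  then show ?case using swap(2) linked_trans by blast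
next
  case (rot p)
  have "linked K (e (edge_rot p)) (e p)"
    using linked_rot[of "e p"] rot_K rot(1) linked_sym unfolding code_edges_def by metis
  then show ?case using rot(2) linked_trans by blast
qed

lemma forest_map_K: "forest_map n K"
  by unfold_locales (use acyclic_K linked_edges darts_K in auto)

interpretation forest_map n K by (rule forest_map_K)

lemma funpow_edge_rot:
  "j < length ts \<Longrightarrow> (edge_rot ^^ Suc j) (u, Node ts) = (ts ! j, Node (drop (Suc j) ts @ u # take j ts))"
proof (induction j)
  case 0
  then show ?case by (cases ts) auto
next
  case (Suc j)
  have "drop (Suc j) ts = ts ! Suc j # drop (Suc (Suc j)) ts"
    using Suc.prems by (simp add: Cons_nth_drop_Suc)
  then show ?case using Suc by (simp add: take_Suc_conv_app_nth)
qed

lemma funpow_edge_rot_length: "(edge_rot ^^ Suc (length ts)) (u, Node ts) = (u, Node ts)"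
proof (cases ts rule: rev_cases)
  case (snoc xs x)
  then show ?thesis using funpow_edge_rot[of "length xs" ts u] by simp
qed simp

text \<open>A full turn takes one rotation per child and one more. An earlier return would make the
  tree \<open>u\<close> behind equal to one of the children, although \<open>u\<close> has a leaf
  and shares none with them.\<close>

lemma card_orbit_K:
  assumes "(Node ts, u) \<in> E"
  shows "card (orbit (rot K) (e (u, Node ts))) = Suc (length ts)"
proof -
  have E: "(u, Node ts) \<in> E" using code_edges_swap[OF assms] by simp
  let ?k = "card (orbit (rot K) (e (u, Node ts)))"
  have "(rot K ^^ Suc (length ts)) (e (u, Node ts)) = e (u, Node ts)"
    using funpow_rot_K[OF E, of "Suc (length ts)"] funpow_edge_rot_length by metis
  then have le: "?k \<le> Suc (length ts)"
    unfolding card_orbit by (intro funpow_dist1_le_self) auto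
  have "e ((edge_rot ^^ ?k) (u, Node ts)) = e (u, Node ts)"
    using funpow_card_orbit[of "e (u, Node ts)"] funpow_rot_K[OF E] by metis
  then have fixed: "(edge_rot ^^ ?k) (u, Node ts) = (u, Node ts)"
    using funpow_rot_K[OF E] E e_eq_iff by blast
  obtain j where j: "?k = Suc j" using card_orbit_pos gr0_implies_Suc by blast
  have False if "j < length ts"
  proof -
    have "u = ts ! j" using fixed funpow_edge_rot[OF that] j by simp
    then have "u \<in> set ts" "ts \<noteq> []" using that by auto
    moreover from this have "leaves u \<noteq> []" using edge_leaves_nonempty[OF assms] by simp
    ultimately show False using edge_leaves_disjoint[OF assms] by (cases "leaves u") auto
  qed
  then have "\<not> j < length ts" by blast
  then show ?thesis using j le by linarith
qed

lemma subtree_K: "(s, u) \<in> E \<Longrightarrow> subtree (e (s, u)) = s"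
proof (induction "size s" arbitrary: s u rule: less_induct)
  case less
  have us: "(u, s) \<in> E" using code_edges_swap[OF less.prems] by simp
  have d: "e (s, u) \<in> darts K" using less.prems by (simp add: darts_K)
  have o: "opp K (e (s, u)) = e (u, s)" using opp_K[OF less.prems] by simp
  show ?case
  proof (cases s)
    case (Leaf i)
    then have "opp K (e (s, u)) = i" using o by (simp add: encode_def)
    then have "opp K i = e (s, u)" by (metis opp_opp)
    then show ?thesis using subtree_Leaf[of i] edge_Leaf_range us Leaf by metis
  next
    case (Node ts)
    have "opp K (e (s, u)) \<notin> {1..n}" unfolding o by (simp add: Node encode_def)
    then have "subtree (e (s, u)) = Node (map subtree (kids (e (s, u))))"
      by (rule subtree_Node[OF d])
    moreover have "map subtree (kids (e (s, u))) = ts"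
    proof (rule nth_equalityI)
      show len: "length (map subtree (kids (e (s, u)))) = length ts"
        using length_kids[of "e (s, u)"] card_orbit_K[of ts u] less.prems unfolding o by (simp add: Node)
      fix j assume "j < length (map subtree (kids (e (s, u))))"
      then have j: "j < length ts" "j < length (kids (e (s, u)))" using len by auto
      have "kids (e (s, u)) ! j = (rot K ^^ Suc j) (e (u, s))"
        using j unfolding kids_def o by (simp del: funpow.simps upt_Suc)
      also have "\<dots> = e (ts ! j, Node (drop (Suc j) ts @ u # take j ts))"
        using funpow_rot_K[OF us, of "Suc j"] funpow_edge_rot[OF j(1)] Node by metis
      finally have "kids (e (s, u)) ! j = e (ts ! j, Node (drop (Suc j) ts @ u # take j ts))" .
      moreover have "(ts ! j, Node (drop (Suc j) ts @ u # take j ts)) \<in> E"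
        using funpow_rot_K[OF us, of "Suc j"] funpow_edge_rot[OF j(1)] Node by metis
      moreover have "size (ts ! j) < size s"
        using Node j(1) child_edge_size[of "(s, u)" "(ts ! j, _)"] child_edgeI[of "take j ts" "ts ! j"]
        by (metis fst_conv id_take_nth_drop)
      ultimately show "map subtree (kids (e (s, u))) ! j = ts ! j"
        using less.hyps j(2) by simp
    qed
    ultimately show ?thesis using Node by simp
  qed
qed

text \<open>Sorted words make each root of \<open>S\<close> the least leaf of its component, so
  reading the map off again starts at the same roots.\<close>

lemma code_K: "code = S"
proof -
  have root: "r \<in> root_leaves \<and> subtree r = t" if "(r, t) \<in> S" for r t
  proof -
    have E: "(t, Leaf r) \<in> E" using that by (rule code_edges_root)
    have r: "r \<in> {1..n}" using E by (rule edge_Leaf_range)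
    have "subtree r = t" using subtree_K[OF E] by (simp add: encode_def)
    moreover have "r \<le> j" if "j \<in> {1..n}" "linked K r j" for j
    proof -
      have "j \<in> set (r # leaves t)"
        using that \<open>subtree r = t\<close> set_word[OF r] by blast
      then show ?thesis using code_sorted[OF \<open>(r, t) \<in> S\<close>] by auto
    qed
    ultimately show ?thesis using r by (auto simp: root_leaves_def)
  qed
  show ?thesis
  proof (intro equalityI subsetI)
    fix p assume "p \<in> S"
    then show "p \<in> code" using root[of "fst p" "snd p"] unfolding code_def by (cases p) auto
  next
    fix p assume "p \<in> code"
    then obtain i where i: "i \<in> root_leaves" "p = (i, subtree i)" by (auto simp: code_def)
    obtain r t where rt: "(r, t) \<in> S" "i \<in> block (r, t)"
      using block_exists[OF root_leaf[OF i(1)]] .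
    have r: "r \<in> root_leaves" "subtree r = t" using root[OF rt(1)] by auto
    then have "linked K r i" using block_code[OF root_leaf[OF r(1)]] rt(2) by auto
    then have "r = i" using root_leaf_unique r(1) i(1) by blast
    then show "p \<in> S" using rt(1) r(2) i(2) by simp
  qed
qed

end

section \<open>Sums over isomorphism classes as sums over codes\<close>

lemma planar_forest_map_iff: "planar_forest_map n M \<longleftrightarrow> forest_map n M \<and> disk_planar n M"
  by (auto simp: planar_forest_map_def forest_map_def forest_map_axioms_def wf_dart_map_def)

lemma map_iso_class_eq:
  assumes "(M, N) \<in> map_iso n"
  shows "map_iso n `` {M} = map_iso n `` {N}"
  using assms map_iso_sym map_iso_trans by blast

text \<open>The predicate \<open>Q\<close> covers forests and trees at once: it is any property of
  maps visible in the code. Classes correspond to valid codes through \<open>code_map\<close>, since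
  codes are complete invariants and all valid codes are realised.\<close>

lemma class_sum_eq_code_sum:
  fixes g :: "nat \<Rightarrow> 'k::field"
  assumes Q: "\<And>M. forest_map n M \<Longrightarrow> Q M \<longleftrightarrow> R (forest_map.code n M)"
  shows "(\<Sum>F\<in>{M. planar_forest_map n M \<and> series_reduced n M \<and> Q M} // map_iso n. class_weight g n F) =
    (\<Sum>S\<in>{S \<in> valid_codes {1..n}. R S}. \<Prod>(i, t)\<in>S. weight g t)"
proof -
  let ?P = "{M. planar_forest_map n M \<and> series_reduced n M \<and> Q M}"
  let ?V = "{S \<in> valid_codes {1..n}. R S}"
  let ?h = "\<lambda>S. map_iso n `` {code_map n S}"
  have P: "M \<in> ?P \<longleftrightarrow> forest_map n M \<and> forest_map.code n M \<in> ?V" for M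
    using forest_map.valid_code_iff[of n M] Q[of M] by (auto simp: planar_forest_map_iff)
  have K: "forest_map n (code_map n S)" "forest_map.code n (code_map n S) = S" if "S \<in> ?V" for S
    using that valid_code.forest_map_K valid_code.code_K by (auto simp: valid_code_def)
  have inj: "inj_on ?h ?V"
  proof (rule inj_onI)
    fix S S' assume S: "S \<in> ?V" "S' \<in> ?V" "?h S = ?h S'"
    have "wf_map n (code_map n S')" using K(1)[OF S(2)] by (simp add: forest_map_def wf_dart_map_def)
    then have "(code_map n S, code_map n S') \<in> map_iso n" using S(3) map_iso_refl by blast
    then show "S = S'" using forest_map_iso(2)[OF K(1)[OF S(1)]] K(2) S by metis
  qed
  have image: "?h ` ?V = ?P // map_iso n"
  proof (intro equalityI subsetI)
    fix C assume "C \<in> ?h ` ?V"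
    then obtain S where S: "S \<in> ?V" "C = ?h S" by blast
    then have "code_map n S \<in> ?P" using P K by simp
    then show "C \<in> ?P // map_iso n" unfolding S(2) by (rule quotientI)
  next
    fix C assume "C \<in> ?P // map_iso n"
    then obtain M where M: "M \<in> ?P" "C = map_iso n `` {M}" by (auto elim: quotientE)
    let ?S = "forest_map.code n M"
    have S: "?S \<in> ?V" and FM: "forest_map n M" using M(1) P by auto
    have "(M, code_map n ?S) \<in> map_iso n"
      using map_iso_of_code_eq[OF FM K(1)[OF S]] K(2)[OF S] by simp
    then have "C = ?h ?S" using M(2) map_iso_class_eq by blast
    then show "C \<in> ?h ` ?V" using S by blast
  qed
  have w: "class_weight g n (?h S) = (\<Prod>(i, t)\<in>S. weight g t)" if S: "S \<in> ?V" for S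
  proof -
    have const: "map_weight g n N = (\<Prod>(i, t)\<in>S. weight g t)" if "(code_map n S, N) \<in> map_iso n" for N
      using forest_map.map_weight_eq[OF forest_map_iso(1)[OF K(1)[OF S] that]]
        forest_map_iso(2)[OF K(1)[OF S] that] K(2)[OF S] by simp
    have "code_map n S \<in> ?h S"
      using K(1)[OF S] map_iso_refl by (simp add: forest_map_def wf_dart_map_def)
    then have "(\<lambda>_. \<Prod>(i, t)\<in>S. weight g t) ` ?h S = {\<Prod>(i, t)\<in>S. weight g t}"
      by (rule image_constant)
    moreover have "map_weight g n ` ?h S = (\<lambda>_. \<Prod>(i, t)\<in>S. weight g t) ` ?h S"
      by (rule image_cong) (simp_all add: const)
    ultimately have "map_weight g n ` ?h S = {\<Prod>(i, t)\<in>S. weight g t}" by simp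
    then show ?thesis by (simp add: class_weight_def)
  qed
  have "(\<Sum>F\<in>?P // map_iso n. class_weight g n F) = (\<Sum>S\<in>?V. class_weight g n (?h S))"
    unfolding image[symmetric] sum.reindex[OF inj] comp_def ..
  also have "\<dots> = (\<Sum>S\<in>?V. \<Prod>(i, t)\<in>S. weight g t)" by (intro sum.cong refl w)
  finally show ?thesis .
qed

lemma forest_sum_eq: "forest_sum g n = (\<Sum>S\<in>valid_codes {1..n}. \<Prod>(i, t)\<in>S. weight g t)"
  using class_sum_eq_code_sum[of n "\<lambda>_. True" "\<lambda>_. True" g]
  by (simp add: forest_sum_def planar_forests_def)

definition trees_on :: "nat list \<Rightarrow> ltree set" where
  "trees_on xs = {t. leaves t = xs \<and> (t = Node [] \<or> reduced t)}"

lemma single_code_valid_iff: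
  assumes "1 \<le> n"
  shows "{(1, t)} \<in> valid_codes {1..n} \<longleftrightarrow> t \<in> trees_on [2..<Suc n]"
proof -
  have "sorted_wrt (<) (1 # leaves t) \<and> block (1, t) = {1..n} \<longleftrightarrow> leaves t = [2..<Suc n]"
  proof
    assume l: "sorted_wrt (<) (1 # leaves t) \<and> block (1, t) = {1..n}"
    then have "1 \<notin> set (leaves t)" by auto
    moreover have "insert 1 (set (leaves t)) = {1..n}" using l by (simp add: block_def)
    ultimately have "set (leaves t) = {1..n} - {1}" by blast
    also have "\<dots> = set [2..<Suc n]" by auto
    finally have "set (leaves t) = set [2..<Suc n]" .
    moreover have "sorted_wrt (<) (leaves t)" using l by simp
    ultimately show "leaves t = [2..<Suc n]"
      using strict_sorted_equal sorted_wrt_upt by blast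
  next
    assume "leaves t = [2..<Suc n]"
    then show "sorted_wrt (<) (1 # leaves t) \<and> block (1, t) = {1..n}"
      using assms by (auto simp: block_def sorted_wrt_upt simp del: upt_Suc)
  qed
  then show ?thesis unfolding valid_codes_def trees_on_def by auto
qed

lemma tree_sum_eq:
  assumes "1 \<le> n"
  shows "tree_sum g n = (\<Sum>t\<in>trees_on [2..<Suc n]. weight g t)"
proof -
  let ?V = "{S \<in> valid_codes {1..n}. \<exists>t. S = {(1, t)}}"
  have "tree_sum g n = (\<Sum>S\<in>?V. \<Prod>(i, t)\<in>S. weight g t)"
    unfolding tree_sum_def planar_trees_def
    by (rule class_sum_eq_code_sum) (rule forest_map.connected_map_iff[OF _ assms])
  also have "?V = (\<lambda>t. {(1, t)}) ` trees_on [2..<Suc n]"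
    using single_code_valid_iff[OF assms] by blast
  also have "(\<Sum>S\<in>\<dots>. \<Prod>(i, t)\<in>S. weight g t) = (\<Sum>t\<in>trees_on [2..<Suc n]. weight g t)"
    by (subst sum.reindex) (auto simp: inj_on_def)
  finally show ?thesis .
qed

section \<open>Counting trees\<close>

definition reduced_trees_on :: "nat list \<Rightarrow> ltree set" where
  "reduced_trees_on xs = {t. leaves t = xs \<and> reduced t}"

definition tree_lists_on :: "nat \<Rightarrow> nat list \<Rightarrow> ltree list set" where
  "tree_lists_on d xs = {ts. length ts = d \<and> (\<forall>t\<in>set ts. reduced t) \<and> concat (map leaves ts) = xs}"

lemma tree_list_length: "ts \<in> tree_lists_on d xs \<Longrightarrow> d \<le> length xs"
proof (induction ts arbitrary: d xs)
  case (Cons t ts)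
  then have "ts \<in> tree_lists_on (length ts) (concat (map leaves ts))" "reduced t"
    by (auto simp: tree_lists_on_def)
  then have "length ts \<le> length (concat (map leaves ts))" "1 \<le> length (leaves t)"
    using Cons.IH reduced_leaves by (auto simp: Suc_le_eq)
  then show ?case using Cons.prems unfolding tree_lists_on_def by auto
qed (simp add: tree_lists_on_def)

lemma tree_lists_on_Suc:
  "tree_lists_on (Suc d) xs = (\<Union>j\<in>{0..length xs}. (\<lambda>(t, ts). t # ts) `
     (reduced_trees_on (take j xs) \<times> tree_lists_on d (drop j xs)))" (is "_ = (\<Union>j\<in>_. ?A j)")
proof (intro equalityI subsetI)
  fix us assume us: "us \<in> tree_lists_on (Suc d) xs"
  then obtain t ts where us': "us = t # ts" by (cases us) (auto simp: tree_lists_on_def)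
  then have xs: "xs = leaves t @ concat (map leaves ts)" using us by (simp add: tree_lists_on_def)
  have "us \<in> ?A (length (leaves t))"
    unfolding us' using us us' xs
    by (intro image_eqI[of _ _ "(t, ts)"]) (auto simp: tree_lists_on_def reduced_trees_on_def)
  moreover have "length (leaves t) \<in> {0..length xs}" using xs by simp
  ultimately show "us \<in> (\<Union>j\<in>{0..length xs}. ?A j)" by blast
next
  fix us assume "us \<in> (\<Union>j\<in>{0..length xs}. ?A j)"
  then show "us \<in> tree_lists_on (Suc d) xs"
    by (auto simp: tree_lists_on_def reduced_trees_on_def)
qed

lemma reduced_trees_on_eq:
  "reduced_trees_on xs = (if length xs = 1 then {Leaf (hd xs)} else {}) \<union>
     (\<Union>d\<in>{2..length xs}. Node ` tree_lists_on d xs)" (is "_ = ?R")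
proof (intro equalityI subsetI)
  fix t assume t: "t \<in> reduced_trees_on xs"
  show "t \<in> ?R"
  proof (cases t)
    case (Leaf i)
    then show ?thesis using t by (auto simp: reduced_trees_on_def)
  next
    case (Node ts)
    then have "ts \<in> tree_lists_on (length ts) xs" "2 \<le> length ts"
      using t by (auto simp: reduced_trees_on_def tree_lists_on_def)
    then show ?thesis using tree_list_length[of ts "length ts" xs] Node by auto
  qed
next
  fix t assume "t \<in> ?R"
  then show "t \<in> reduced_trees_on xs"
    by (auto simp: reduced_trees_on_def tree_lists_on_def length_Suc_conv split: if_splits)
qed

unbundle fps_syntax

text \<open>The assumption is \<open>Y = x + (G / x) (Y)\<close> written out in coefficients. The
  sum stops at \<open>n\<close>, as \<open>Y\<close> has no constant term and its
  \<open>d\<close>-th power starts in degree \<open>d\<close>.\<close>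

context
  fixes g :: "nat \<Rightarrow> 'k::field" and Y :: "'k fps"
  assumes Y: "\<And>n. Y $ n = (if n = 1 then 1 else 0) + (\<Sum>d=2..n. g (Suc d) * (Y ^ d) $ n)"
begin

lemma Y_0: "Y $ 0 = 0"
  using Y[of 0] by simp

text \<open>On a word of length \<open>N\<close> the induction hypothesis reaches the single trees
  only if there are at least two of them, each taking a leaf; on shorter words any number of trees
  is fine.\<close>

lemma sum_tree_lists_on:
  assumes IH: "\<And>ys. length ys < N \<Longrightarrow>
      finite (reduced_trees_on ys) \<and> (\<Sum>t\<in>reduced_trees_on ys. weight g t) = Y $ length ys"
  shows "length xs < N \<or> length xs = N \<and> 2 \<le> d \<Longrightarrow>
      finite (tree_lists_on d xs) \<and>
      (\<Sum>ts\<in>tree_lists_on d xs. \<Prod>t\<leftarrow>ts. weight g t) = (Y ^ d) $ length xs"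
proof (induction d arbitrary: xs)
  case 0
  have "tree_lists_on 0 xs = (if xs = [] then {[]} else {})" by (auto simp: tree_lists_on_def)
  then show ?case by auto
next
  case (Suc d)
  let ?A = "\<lambda>j. (\<lambda>(t, ts). t # ts) ` (reduced_trees_on (take j xs) \<times> tree_lists_on d (drop j xs))"
  have A: "finite (?A j) \<and> (\<Sum>ts\<in>?A j. \<Prod>t\<leftarrow>ts. weight g t) = Y $ j * (Y ^ d) $ (length xs - j)"
    if j: "j \<in> {0..length xs}" for j
  proof -
    \<comment> \<open>The first tree takes \<open>j\<close> leaves. For \<open>j = 0\<close> there
      is no such tree, and for \<open>j = N\<close> nothing remains for the others; both extremes
      give zero on either side.\<close>
    consider "j = 0" | "j = N" "length xs = N" "1 \<le> d" | "0 < j" "j < N" "length xs - j < N"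
      using j Suc.prems by force
    then show ?thesis
    proof cases
      case 1
      then have "reduced_trees_on (take j xs) = {}"
        using reduced_leaves by (auto simp: reduced_trees_on_def)
      then show ?thesis using 1 Y_0 by simp
    next
      case 2
      then have "tree_lists_on d (drop j xs) = {}"
        using tree_list_length[of _ d "drop j xs"] by fastforce
      then show ?thesis using 2 Y_0 by (simp add: fps_power_zeroth_eq_one startsby_zero_power)
    next
      case 3
      have 1: "finite (reduced_trees_on (take j xs))"
        "(\<Sum>t\<in>reduced_trees_on (take j xs). weight g t) = Y $ j"
        using IH[of "take j xs"] j 3 by auto
      have 2: "finite (tree_lists_on d (drop j xs))"
        "(\<Sum>ts\<in>tree_lists_on d (drop j xs). \<Prod>t\<leftarrow>ts. weight g t) = (Y ^ d) $ (length xs - j)"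
        using Suc.IH[of "drop j xs"] 3 by auto
      have "(\<Sum>ts\<in>?A j. \<Prod>t\<leftarrow>ts. weight g t) =
          (\<Sum>(t, ts)\<in>reduced_trees_on (take j xs) \<times> tree_lists_on d (drop j xs).
             weight g t * (\<Prod>t\<leftarrow>ts. weight g t))"
        by (subst sum.reindex) (auto simp: inj_on_def intro!: sum.cong)
      also have "\<dots> = Y $ j * (Y ^ d) $ (length xs - j)"
        unfolding 1(2)[symmetric] 2(2)[symmetric] sum_product sum.cartesian_product ..
      finally show ?thesis using 1(1) 2(1) by simp
    qed
  qed
  have disj: "?A i \<inter> ?A j = {}" if "i \<in> {0..length xs}" "j \<in> {0..length xs}" "i \<noteq> j" for i j
  proof -
    have "take i xs \<noteq> take j xs" using that by (metis atLeastAtMost_iff length_take min.absorb2)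
    then show ?thesis by (auto simp: reduced_trees_on_def)
  qed
  have "(\<Sum>ts\<in>tree_lists_on (Suc d) xs. \<Prod>t\<leftarrow>ts. weight g t) =
      (\<Sum>j\<in>{0..length xs}. \<Sum>ts\<in>?A j. \<Prod>t\<leftarrow>ts. weight g t)"
    unfolding tree_lists_on_Suc
  proof (rule sum.UNION_disjoint)
    show "\<forall>j\<in>{0..length xs}. finite (?A j)" using A by blast
    show "\<forall>i\<in>{0..length xs}. \<forall>j\<in>{0..length xs}. i \<noteq> j \<longrightarrow> ?A i \<inter> ?A j = {}"
      using disj by blast
  qed simp
  also have "\<dots> = (\<Sum>j\<in>{0..length xs}. Y $ j * (Y ^ d) $ (length xs - j))"
    by (rule sum.cong) (use A in auto)
  also have "\<dots> = (Y ^ Suc d) $ length xs" by (simp add: fps_mult_nth)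
  finally show ?case unfolding tree_lists_on_Suc using A by blast
qed

lemma sum_reduced_trees_on:
  "finite (reduced_trees_on xs) \<and> (\<Sum>t\<in>reduced_trees_on xs. weight g t) = Y $ length xs"
proof (induction "length xs" arbitrary: xs rule: less_induct)
  case less
  let ?L = "if length xs = 1 then {Leaf (hd xs)} else {}"
  have C: "finite (tree_lists_on d xs)"
    "(\<Sum>ts\<in>tree_lists_on d xs. \<Prod>t\<leftarrow>ts. weight g t) = (Y ^ d) $ length xs" if "d \<in> {2..length xs}" for d
    using sum_tree_lists_on[of "length xs" xs d] less that by auto
  have node: "(\<Sum>t\<in>Node ` tree_lists_on d xs. weight g t) = g (Suc d) * (Y ^ d) $ length xs"
    if "d \<in> {2..length xs}" for d
  proof -
    have "(\<Sum>t\<in>Node ` tree_lists_on d xs. weight g t) =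
        (\<Sum>ts\<in>tree_lists_on d xs. g (Suc d) * (\<Prod>t\<leftarrow>ts. weight g t))"
      by (subst sum.reindex) (auto simp: inj_on_def tree_lists_on_def intro!: sum.cong)
    then show ?thesis using C(2)[OF that] by (simp add: sum_distrib_left[symmetric])
  qed
  have fin: "finite (\<Union>d\<in>{2..length xs}. Node ` tree_lists_on d xs)" using C by auto
  have "(\<Sum>t\<in>reduced_trees_on xs. weight g t) =
      (\<Sum>t\<in>?L. weight g t) + (\<Sum>t\<in>(\<Union>d\<in>{2..length xs}. Node ` tree_lists_on d xs). weight g t)"
    unfolding reduced_trees_on_eq by (rule sum.union_disjoint) (use fin in auto)
  also have "(\<Sum>t\<in>(\<Union>d\<in>{2..length xs}. Node ` tree_lists_on d xs). weight g t) =
      (\<Sum>d=2..length xs. \<Sum>t\<in>Node ` tree_lists_on d xs. weight g t)"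
    by (rule sum.UNION_disjoint) (use C in \<open>auto simp: tree_lists_on_def\<close>)
  also have "\<dots> = (\<Sum>d=2..length xs. g (Suc d) * (Y ^ d) $ length xs)"
    by (rule sum.cong) (use node in auto)
  also have "(\<Sum>t\<in>?L. weight g t) = (if length xs = 1 then 1 else 0)" by simp
  finally have "(\<Sum>t\<in>reduced_trees_on xs. weight g t) = Y $ length xs"
    unfolding Y[of "length xs", symmetric] .
  moreover have "finite (reduced_trees_on xs)" unfolding reduced_trees_on_eq using fin by simp
  ultimately show ?case by simp
qed

lemma sum_trees_on:
  "finite (trees_on xs)"
  "(\<Sum>t\<in>trees_on xs. weight g t) = (if xs = [] then g 1 else 0) + Y $ length xs"
proof -
  have t: "trees_on xs = (if xs = [] then {Node []} else {}) \<union> reduced_trees_on xs"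
    by (auto simp: trees_on_def reduced_trees_on_def)
  show "finite (trees_on xs)" unfolding t using sum_reduced_trees_on by simp
  have "Node [] \<notin> reduced_trees_on xs" by (simp add: reduced_trees_on_def)
  then show "(\<Sum>t\<in>trees_on xs. weight g t) = (if xs = [] then g 1 else 0) + Y $ length xs"
    unfolding t using sum_reduced_trees_on[of xs] by (cases "xs = []") auto
qed

end

section \<open>Decomposing forests at the first leaf\<close>

text \<open>Next to a block consisting of \<open>X\<close> and a point below all of
  \<open>A\<close>, not crossing means precisely that a block lies on one side of every point of
  \<open>X\<close>. These are the forests that fill the gaps.\<close>

definition gap_codes :: "nat set \<Rightarrow> nat set \<Rightarrow> (nat \<times> ltree) set set" where
  "gap_codes X A = {S \<in> valid_codes (A - X). \<forall>p\<in>S. \<forall>x\<in>X. block p \<subseteq> {..<x} \<or> block p \<subseteq> {x<..}}"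

abbreviation code_weight :: "(nat \<Rightarrow> 'k::field) \<Rightarrow> (nat \<times> ltree) set \<Rightarrow> 'k" where
  "code_weight g S \<equiv> (\<Prod>(i, t)\<in>S. weight g t)"

lemma fst_in_block: "fst p \<in> block p"
  by (simp add: block_def)

lemma valid_codesD:
  assumes "S \<in> valid_codes A"
  shows "finite S"
    and "(i, t) \<in> S \<Longrightarrow> sorted_wrt (<) (i # leaves t)"
    and "(i, t) \<in> S \<Longrightarrow> t = Node [] \<or> reduced t"
    and "p \<in> S \<Longrightarrow> q \<in> S \<Longrightarrow> x \<in> block p \<Longrightarrow> x \<in> block q \<Longrightarrow> p = q"
    and "p \<in> S \<Longrightarrow> block p \<subseteq> A"
    and "x \<in> A \<Longrightarrow> \<exists>p\<in>S. x \<in> block p"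
    and "p \<in> S \<Longrightarrow> q \<in> S \<Longrightarrow> a \<in> block p \<Longrightarrow> b \<in> block q \<Longrightarrow> c \<in> block p \<Longrightarrow> d \<in> block q \<Longrightarrow>
      a < b \<Longrightarrow> b < c \<Longrightarrow> c < d \<Longrightarrow> p = q"
proof -
  have *: "finite S" "\<forall>(i, t)\<in>S. sorted_wrt (<) (i # leaves t) \<and> (t = Node [] \<or> reduced t)"
    "\<forall>p\<in>S. \<forall>q\<in>S. p \<noteq> q \<longrightarrow> block p \<inter> block q = {}" "(\<Union>p\<in>S. block p) = A"
    "\<forall>p\<in>S. \<forall>q\<in>S. \<forall>a\<in>block p. \<forall>b\<in>block q. \<forall>c\<in>block p. \<forall>d\<in>block q.
        a < b \<and> b < c \<and> c < d \<longrightarrow> p = q"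
    using assms unfolding valid_codes_def by simp_all
  show "finite S" by (rule *)
  show "(i, t) \<in> S \<Longrightarrow> sorted_wrt (<) (i # leaves t)" "(i, t) \<in> S \<Longrightarrow> t = Node [] \<or> reduced t"
    using *(2) by auto
  show "p \<in> S \<Longrightarrow> q \<in> S \<Longrightarrow> x \<in> block p \<Longrightarrow> x \<in> block q \<Longrightarrow> p = q" using *(3) by blast
  show "p \<in> S \<Longrightarrow> block p \<subseteq> A" "x \<in> A \<Longrightarrow> \<exists>p\<in>S. x \<in> block p" using *(4) by blast+
  show "p \<in> S \<Longrightarrow> q \<in> S \<Longrightarrow> a \<in> block p \<Longrightarrow> b \<in> block q \<Longrightarrow> c \<in> block p \<Longrightarrow> d \<in> block q \<Longrightarrow>
      a < b \<Longrightarrow> b < c \<Longrightarrow> c < d \<Longrightarrow> p = q" using *(5) by blast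
qed

lemma valid_codesI:
  assumes "finite S"
    and "\<And>i t. (i, t) \<in> S \<Longrightarrow> sorted_wrt (<) (i # leaves t) \<and> (t = Node [] \<or> reduced t)"
    and "\<And>p q x. p \<in> S \<Longrightarrow> q \<in> S \<Longrightarrow> x \<in> block p \<Longrightarrow> x \<in> block q \<Longrightarrow> p = q"
    and "\<And>p. p \<in> S \<Longrightarrow> block p \<subseteq> A"
    and "\<And>x. x \<in> A \<Longrightarrow> \<exists>p\<in>S. x \<in> block p"
    and "\<And>p q a b c d. p \<in> S \<Longrightarrow> q \<in> S \<Longrightarrow> a \<in> block p \<Longrightarrow> b \<in> block q \<Longrightarrow> c \<in> block p \<Longrightarrow> d \<in> block q \<Longrightarrow>
      a < b \<Longrightarrow> b < c \<Longrightarrow> c < d \<Longrightarrow> p = q"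
  shows "S \<in> valid_codes A"
  unfolding valid_codes_def mem_Collect_eq
proof (intro conjI ballI impI)
  show "(\<Union>p\<in>S. block p) = A" using assms(4,5) by blast
qed (use assms(1,2,3,6) in blast)+

lemma valid_codes_mono:
  assumes "S \<in> valid_codes A" "T \<subseteq> S"
  shows "T \<in> valid_codes (\<Union>p\<in>T. block p)"
proof (rule valid_codesI)
  show "finite T" using assms(2) valid_codesD(1)[OF assms(1)] by (rule finite_subset)
next
  fix i t assume "(i, t) \<in> T"
  then show "sorted_wrt (<) (i # leaves t) \<and> (t = Node [] \<or> reduced t)"
    using assms(2) valid_codesD(2,3)[OF assms(1)] by blast
next
  fix p q x assume "p \<in> T" "q \<in> T" "x \<in> block p" "x \<in> block q"
  then show "p = q" using assms(2) valid_codesD(4)[OF assms(1), of p q x] by blast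
next
  fix p q a b c d
  assume "p \<in> T" "q \<in> T" "a \<in> block p" "b \<in> block q" "c \<in> block p" "d \<in> block q"
    "a < b" "b < c" "c < d"
  then show "p = q" using assms(2) valid_codesD(7)[OF assms(1), of p q a b c d] by blast
qed auto

lemma valid_codes_empty: "valid_codes {} = {{}}"
proof -
  have "S = {}" if "S \<in> valid_codes {}" for S
    using valid_codesD(5)[OF that] fst_in_block by blast
  moreover have "{} \<in> valid_codes {}" by (rule valid_codesI) auto
  ultimately show ?thesis by blast
qed

lemma insert_block:
  assumes X: "X \<subseteq> {Suc a..<b}" and t: "t \<in> trees_on (sorted_list_of_set X)"
    and S: "S \<in> gap_codes X {Suc a..<b}" and ab: "a < b"
  shows "insert (a, t) S \<in> valid_codes {a..<b}" and "(a, t) \<notin> S" and "block (a, t) = insert a X"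
proof -
  have X_fin: "finite X" using X finite_subset by blast
  have lt: "leaves t = sorted_list_of_set X" "t = Node [] \<or> reduced t"
    using t by (auto simp: trees_on_def)
  show bl: "block (a, t) = insert a X" using lt(1) X_fin by (simp add: block_def)
  have V: "S \<in> valid_codes ({Suc a..<b} - X)" using S by (simp add: gap_codes_def)
  have sub: "block p \<subseteq> {Suc a..<b} - X" if "p \<in> S" for p using valid_codesD(5)[OF V that] .
  have gap: "block p \<subseteq> {..<x} \<or> block p \<subseteq> {x<..}" if "p \<in> S" "x \<in> X" for p x
    using S that by (simp add: gap_codes_def)
  show "(a, t) \<notin> S" using sub[of "(a, t)"] bl by auto
  have disj: "x \<notin> block (a, t)" if "p \<in> S" "x \<in> block p" for p x
    using sub[OF that(1)] that(2) unfolding bl by auto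
  \<comment> \<open>In either crossing pattern an element of the new block lies between two entries
    of \<open>block p\<close>. It cannot be the least point \<open>a\<close>, so it belongs to
    \<open>X\<close>, against the gap condition.\<close>
  have cross1: False if "p \<in> S" "u \<in> block (a, t)" "v \<in> block p" "w \<in> block (a, t)" "z \<in> block p"
    "u < v" "v < w" "w < z" for p u v w z
  proof -
    have "w \<in> X" using that X unfolding bl by auto
    then show False using gap[OF that(1)] that by fastforce
  qed
  have cross2: False if "p \<in> S" "u \<in> block p" "v \<in> block (a, t)" "w \<in> block p" "z \<in> block (a, t)"
    "u < v" "v < w" "w < z" for p u v w z
  proof -
    have "v \<in> X" using that sub[OF that(1)] X unfolding bl by fastforce
    then show False using gap[OF that(1)] that by fastforce
  qed
  show "insert (a, t) S \<in> valid_codes {a..<b}"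
  proof (rule valid_codesI)
    show "finite (insert (a, t) S)" using valid_codesD(1)[OF V] by simp
  next
    fix i s assume "(i, s) \<in> insert (a, t) S"
    moreover have "sorted_wrt (<) (a # leaves t)" using lt(1) X X_fin by auto
    ultimately show "sorted_wrt (<) (i # leaves s) \<and> (s = Node [] \<or> reduced s)"
      using lt(2) valid_codesD(2,3)[OF V] by blast
  next
    fix p q x assume "p \<in> insert (a, t) S" "q \<in> insert (a, t) S" "x \<in> block p" "x \<in> block q"
    then show "p = q" using valid_codesD(4)[OF V] disj by blast
  next
    fix p assume "p \<in> insert (a, t) S"
    then show "block p \<subseteq> {a..<b}" using sub[of p] bl X ab by fastforce
  next
    fix x assume "x \<in> {a..<b}"
    then have "x \<in> block (a, t) \<or> x \<in> {Suc a..<b} - X" unfolding bl by auto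
    then show "\<exists>p\<in>insert (a, t) S. x \<in> block p" using valid_codesD(6)[OF V] by blast
  next
    fix p q u v w z
    assume "p \<in> insert (a, t) S" "q \<in> insert (a, t) S" "u \<in> block p" "v \<in> block q" "w \<in> block p"
      "z \<in> block q" "u < v" "v < w" "w < z"
    then show "p = q" using valid_codesD(7)[OF V, of p q u v w z] cross1[of q u v w z] cross2[of p u v w z] by blast
  qed
qed

lemma remove_block:
  assumes S: "S \<in> valid_codes {a..<b}" and ab: "a < b"
  obtains X t T where "X \<subseteq> {Suc a..<b}" "t \<in> trees_on (sorted_list_of_set X)"
    "T \<in> gap_codes X {Suc a..<b}" "S = insert (a, t) T"
proof -
  obtain p where p: "p \<in> S" "a \<in> block p" using valid_codesD(6)[OF S, of a] ab by auto
  obtain i t where it: "p = (i, t)" by force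
  have sorted: "sorted_wrt (<) (i # leaves t)" using valid_codesD(2)[OF S] p it by blast
  have "i \<in> {a..<b}" using valid_codesD(5)[OF S p(1)] fst_in_block[of p] it by auto
  moreover have "i \<le> a" using sorted p(2) it by (auto simp: block_def)
  ultimately have i: "i = a" by simp
  let ?X = "set (leaves t)" and ?T = "S - {p}"
  have bl: "block p = insert a ?X" using it i by (simp add: block_def)
  have X: "?X \<subseteq> {Suc a..<b}" using valid_codesD(5)[OF S p(1)] sorted i unfolding bl by fastforce
  have "sorted_list_of_set ?X = leaves t"
    using sorted by (intro sorted_list_of_set.idem_if_sorted_distinct) (auto simp: strict_sorted_iff)
  then have t: "t \<in> trees_on (sorted_list_of_set ?X)"
    using valid_codesD(3)[OF S] p(1) it by (auto simp: trees_on_def)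
  have "(\<Union>q\<in>?T. block q) = {a..<b} - block p"
  proof (intro equalityI subsetI)
    fix x assume "x \<in> (\<Union>q\<in>?T. block q)"
    then obtain q where q: "q \<in> S" "q \<noteq> p" "x \<in> block q" by blast
    then show "x \<in> {a..<b} - block p"
      using valid_codesD(4)[OF S q(1) p(1) q(3)] valid_codesD(5)[OF S q(1)] by blast
  next
    fix x assume x: "x \<in> {a..<b} - block p"
    then obtain q where "q \<in> S" "x \<in> block q" using valid_codesD(6)[OF S, of x] by blast
    then show "x \<in> (\<Union>q\<in>?T. block q)" using x by blast
  qed
  also have "\<dots> = {Suc a..<b} - ?X" unfolding bl using X by auto
  finally have T: "?T \<in> valid_codes ({Suc a..<b} - ?X)" using valid_codes_mono[OF S, of ?T] by auto
  have "block q \<subseteq> {..<x} \<or> block q \<subseteq> {x<..}" if q: "q \<in> ?T" and x: "x \<in> ?X" for q x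
  proof (rule ccontr)
    assume "\<not> ?thesis"
    then obtain y z where yz: "y \<in> block q" "z \<in> block q" "z \<le> x" "x \<le> y" by fastforce
    have q': "block q \<subseteq> {Suc a..<b} - ?X" using valid_codesD(5)[OF T q] .
    then have "a < z" "z \<noteq> x" "x \<noteq> y" using yz x by auto
    \<comment> \<open>A block straddling \<open>x\<close> gives the crossing
      \<open>a < z < x < y\<close> with the block of \<open>a\<close>.\<close>
    then have "p = q"
      using valid_codesD(7)[OF S p(1), of q a z x y] q yz x p(2) bl by auto
    then show False using q by simp
  qed
  then have "?T \<in> gap_codes ?X {Suc a..<b}" using T by (simp add: gap_codes_def)
  then show thesis using that[OF X t] p(1) it i by auto
qed

text \<open>\<open>X\<close> is the set of further leaves in the tree of the first leaf
  \<open>a\<close>. Only one block contains \<open>a\<close>, so the union determines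
  \<open>t\<close>, and then \<open>X\<close> and the rest.\<close>

lemma valid_codes_decompose:
  assumes "a < b"
  shows "bij_betw (\<lambda>(X, t, T). insert (a, t) T)
    (SIGMA X:Pow {Suc a..<b}. trees_on (sorted_list_of_set X) \<times> gap_codes X {Suc a..<b})
    (valid_codes {a..<b})" (is "bij_betw ?f ?D _")
proof (rule bij_betw_imageI)
  show "inj_on ?f ?D"
  proof (rule inj_onI)
    fix P Q assume PQ: "P \<in> ?D" "Q \<in> ?D" "?f P = ?f Q"
    obtain X t T X' t' T' where P: "P = (X, t, T)" and Q: "Q = (X', t', T')" by (metis prod_cases3)
    have X: "X \<subseteq> {Suc a..<b}" and t: "t \<in> trees_on (sorted_list_of_set X)"
      and T: "T \<in> gap_codes X {Suc a..<b}"
      and X': "X' \<subseteq> {Suc a..<b}" and t': "t' \<in> trees_on (sorted_list_of_set X')"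
      and T': "T' \<in> gap_codes X' {Suc a..<b}"
      and eq: "insert (a, t) T = insert (a, t') T'"
      using PQ unfolding P Q by auto
    note i = insert_block[OF X t T assms] and i' = insert_block[OF X' t' T' assms]
    have "(a, t') \<in> insert (a, t) T" using eq by simp
    then have "(a, t) = (a, t')"
      using valid_codesD(4)[OF i(1), of "(a, t)" "(a, t')" a] i(3) i'(3) by blast
    then have tt: "t = t'" by simp
    have "a \<notin> X" "a \<notin> X'" using X X' by auto
    then have "X = X'" using i(3) i'(3) tt by (metis insert_ident)
    moreover have "T = T'" using eq i(2) i'(2) tt by (metis insert_ident)
    ultimately show "P = Q" using P Q tt by simp
  qed
  show "?f ` ?D = valid_codes {a..<b}"
  proof (intro equalityI subsetI)
    fix S assume "S \<in> ?f ` ?D"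
    then show "S \<in> valid_codes {a..<b}" using insert_block(1)[OF _ _ _ assms] by auto
  next
    fix S assume "S \<in> valid_codes {a..<b}"
    then obtain X t T where "X \<subseteq> {Suc a..<b}" "t \<in> trees_on (sorted_list_of_set X)"
      "T \<in> gap_codes X {Suc a..<b}" "S = insert (a, t) T" using remove_block[OF _ assms] by metis
    then show "S \<in> ?f ` ?D" by (intro image_eqI[of _ _ "(X, t, T)"]) auto
  qed
qed

lemma gap_codes_empty: "gap_codes {} A = valid_codes A"
  by (simp add: gap_codes_def)

text \<open>Cutting at the least marked point \<open>x\<close>: an unrestricted forest stands to its
  left, and the remaining marks only constrain what stands to its right. Blocks are nonempty, so
  their position relative to \<open>x\<close> tells the two parts apart.\<close>

lemma gap_codes_split:
  assumes x: "x \<in> {a..<b}" and X: "X \<subseteq> {Suc x..<b}"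
  shows "bij_betw (\<lambda>(S, T). S \<union> T) (valid_codes {a..<x} \<times> gap_codes X {Suc x..<b})
      (gap_codes (insert x X) {a..<b})" (is "bij_betw ?f (?V \<times> ?G) ?R")
    and "S \<in> valid_codes {a..<x} \<Longrightarrow> T \<in> gap_codes X {Suc x..<b} \<Longrightarrow> S \<inter> T = {}"
proof -
  have lo: "block p \<subseteq> {..<x}" "block p \<subseteq> {a..<x}" if "S \<in> ?V" "p \<in> S" for S p
    using valid_codesD(5)[OF that] by auto
  have hi: "block p \<subseteq> {x<..}" "block p \<subseteq> {Suc x..<b} - X" if "T \<in> ?G" "p \<in> T" for T p
    using that valid_codesD(5)[of T "{Suc x..<b} - X" p] by (fastforce simp: gap_codes_def)+
  have not_both: "\<not> (block p \<subseteq> {..<x} \<and> block p \<subseteq> {x<..})" for p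
  proof
    assume "block p \<subseteq> {..<x} \<and> block p \<subseteq> {x<..}"
    then have "fst p \<in> {..<x}" "fst p \<in> {x<..}" using fst_in_block[of p] by blast+
    then show False by simp
  qed
  have recover: "S = {p \<in> S \<union> T. block p \<subseteq> {..<x}} \<and> T = {p \<in> S \<union> T. block p \<subseteq> {x<..}}"
    if "S \<in> ?V" "T \<in> ?G" for S T
  proof -
    have "block p \<subseteq> {..<x} \<and> \<not> block p \<subseteq> {x<..}" if "p \<in> S" for p
      using lo(1)[OF \<open>S \<in> ?V\<close> that] not_both by blast
    moreover have "\<not> block p \<subseteq> {..<x} \<and> block p \<subseteq> {x<..}" if "p \<in> T" for p
      using hi(1)[OF \<open>T \<in> ?G\<close> that] not_both by blast
    ultimately show ?thesis by blast
  qed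
  show "S \<in> ?V \<Longrightarrow> T \<in> ?G \<Longrightarrow> S \<inter> T = {}"
    using lo(1)[of S] hi(1)[of T] not_both by fast
  have into: "S \<union> T \<in> ?R" if S: "S \<in> ?V" and T: "T \<in> ?G" for S T
  proof -
    have T': "T \<in> valid_codes ({Suc x..<b} - X)" using T by (simp add: gap_codes_def)
    have sep: "u < v" if "p \<in> S" "q \<in> T" "u \<in> block p" "v \<in> block q" for p q u v
      using lo(1)[OF S that(1)] hi(1)[OF T that(2)] that(3,4) by fastforce
    have "S \<union> T \<in> valid_codes ({a..<b} - insert x X)"
    proof (rule valid_codesI)
      show "finite (S \<union> T)" using valid_codesD(1)[OF S] valid_codesD(1)[OF T'] by simp
    next
      fix i t assume "(i, t) \<in> S \<union> T"
      then show "sorted_wrt (<) (i # leaves t) \<and> (t = Node [] \<or> reduced t)"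
        using valid_codesD(2,3)[OF S] valid_codesD(2,3)[OF T'] by blast
    next
      fix p q y assume "p \<in> S \<union> T" "q \<in> S \<union> T" "y \<in> block p" "y \<in> block q"
      then show "p = q"
        using valid_codesD(4)[OF S] valid_codesD(4)[OF T'] sep by (metis UnE less_irrefl)
    next
      fix p assume "p \<in> S \<union> T"
      then show "block p \<subseteq> {a..<b} - insert x X"
      proof
        assume "p \<in> S"
        then show ?thesis using lo(2)[OF S, of p] x X by fastforce
      next
        assume "p \<in> T"
        then show ?thesis using hi(2)[OF T, of p] x by fastforce
      qed
    next
      fix y assume "y \<in> {a..<b} - insert x X"
      then have "y \<in> {a..<x} \<or> y \<in> {Suc x..<b} - X" by auto
      then show "\<exists>p\<in>S \<union> T. y \<in> block p" using valid_codesD(6)[OF S] valid_codesD(6)[OF T'] by blast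
    next
      fix p q u v w z
      assume "p \<in> S \<union> T" "q \<in> S \<union> T" "u \<in> block p" "v \<in> block q" "w \<in> block p" "z \<in> block q"
        "u < v" "v < w" "w < z"
      then show "p = q"
        using valid_codesD(7)[OF S, of p q u v w z] valid_codesD(7)[OF T', of p q u v w z] sep[of p q w v] sep[of q p v u]
        by auto
    qed
    moreover have "block p \<subseteq> {..<y} \<or> block p \<subseteq> {y<..}" if p: "p \<in> S \<union> T" and y: "y \<in> insert x X" for p y
      using p
    proof
      assume "p \<in> S"
      moreover have "x \<le> y" using y X by auto
      ultimately show ?thesis using lo(1)[OF S, of p] by fastforce
    next
      assume "p \<in> T"
      then show ?thesis using hi(1)[OF T, of p] T y unfolding gap_codes_def by blast
    qed
    ultimately show ?thesis by (simp add: gap_codes_def)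
  qed
  show "bij_betw ?f (?V \<times> ?G) ?R"
  proof (rule bij_betw_imageI)
    show "inj_on ?f (?V \<times> ?G)"
    proof (rule inj_onI)
      fix P Q assume PQ: "P \<in> ?V \<times> ?G" "Q \<in> ?V \<times> ?G" "?f P = ?f Q"
      obtain S T S' T' where P: "P = (S, T)" and Q: "Q = (S', T')" by force
      have H: "S \<in> ?V" "T \<in> ?G" "S' \<in> ?V" "T' \<in> ?G" "S \<union> T = S' \<union> T'"
        using PQ unfolding P Q by auto
      have "S = S' \<and> T = T'" using recover[OF H(1,2)] recover[OF H(3,4)] H(5) by simp
      then show "P = Q" using P Q by simp
    qed
    show "?f ` (?V \<times> ?G) = ?R"
    proof (intro equalityI subsetI)
      fix U assume "U \<in> ?f ` (?V \<times> ?G)"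
      then show "U \<in> ?R" using into by auto
    next
      fix U assume U: "U \<in> ?R"
      then have V: "U \<in> valid_codes ({a..<b} - insert x X)"
        and sep: "\<And>p y. p \<in> U \<Longrightarrow> y \<in> insert x X \<Longrightarrow> block p \<subseteq> {..<y} \<or> block p \<subseteq> {y<..}"
        by (auto simp: gap_codes_def)
      let ?S = "{p \<in> U. block p \<subseteq> {..<x}}" and ?T = "{p \<in> U. block p \<subseteq> {x<..}}"
      have UST: "U = ?S \<union> ?T" using sep[of _ x] by blast
      note sub = valid_codesD(5)[OF V] and cov = valid_codesD(6)[OF V]
      have "(\<Union>p\<in>?S. block p) = {a..<x}"
      proof (intro equalityI subsetI)
        fix y assume "y \<in> (\<Union>p\<in>?S. block p)"
        then show "y \<in> {a..<x}" using sub by fastforce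
      next
        fix y assume y: "y \<in> {a..<x}"
        then have "y \<in> {a..<b} - insert x X" using x X by auto
        then obtain p where "p \<in> U" "y \<in> block p" using cov by blast
        moreover from this have "block p \<subseteq> {..<x}" using sep[of p x] y by auto
        ultimately show "y \<in> (\<Union>p\<in>?S. block p)" by blast
      qed
      then have "?S \<in> ?V" using valid_codes_mono[OF V, of ?S] by auto
      moreover have "(\<Union>p\<in>?T. block p) = {Suc x..<b} - X"
      proof (intro equalityI subsetI)
        fix y assume "y \<in> (\<Union>p\<in>?T. block p)"
        then show "y \<in> {Suc x..<b} - X" using sub by fastforce
      next
        fix y assume y: "y \<in> {Suc x..<b} - X"
        then have "y \<in> {a..<b} - insert x X" using x by auto
        then obtain p where "p \<in> U" "y \<in> block p" using cov by blast
        moreover from this have "block p \<subseteq> {x<..}" using sep[of p x] y by auto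
        ultimately show "y \<in> (\<Union>p\<in>?T. block p)" by blast
      qed
      then have "?T \<in> valid_codes ({Suc x..<b} - X)" using valid_codes_mono[OF V, of ?T] by auto
      then have "?T \<in> ?G" using sep by (auto simp: gap_codes_def)
      ultimately show "U \<in> ?f ` (?V \<times> ?G)"
        by (intro image_eqI[of _ _ "(?S, ?T)"]) (use UST in auto)
    qed
  qed
qed

section \<open>Generating functions\<close>

lemma subsets_by_least:
  "bij_betw (\<lambda>(x, X). insert x X) (SIGMA x:{a..<b}. {X. X \<subseteq> {Suc x..<b} \<and> card X = m})
    {X. X \<subseteq> {a..<b::nat} \<and> card X = Suc m}" (is "bij_betw ?f ?D ?R")
proof (rule bij_betw_imageI)
  show "inj_on ?f ?D"
  proof (rule inj_onI)
    fix P Q assume PQ: "P \<in> ?D" "Q \<in> ?D" "?f P = ?f Q"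
    obtain x X y Y where P: "P = (x, X)" and Q: "Q = (y, Y)" by force
    have X: "X \<subseteq> {Suc x..<b}" "Y \<subseteq> {Suc y..<b}" "insert x X = insert y Y" using PQ P Q by auto
    then have "x \<in> insert y Y" "y \<in> insert x X" by auto
    then have "x = y" using X(1,2) by fastforce
    moreover have "x \<notin> X" "y \<notin> Y" using X by auto
    ultimately show "P = Q" using X(3) P Q by (metis insert_ident)
  qed
  show "?f ` ?D = ?R"
  proof (intro equalityI subsetI)
    fix Z assume "Z \<in> ?f ` ?D"
    then obtain x X where x: "Z = insert x X" "x \<in> {a..<b}" "X \<subseteq> {Suc x..<b}" "card X = m" by auto
    then have "finite X" "x \<notin> X" using finite_subset by auto
    then show "Z \<in> ?R" using x by auto
  next
    fix Z assume Z: "Z \<in> ?R"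
    then have fin: "finite Z" "Z \<noteq> {}" using finite_subset by auto
    let ?x = "Min Z"
    have x: "?x \<in> Z" "\<And>z. z \<in> Z \<Longrightarrow> ?x \<le> z" using fin by auto
    have "Z - {?x} \<subseteq> {Suc ?x..<b}"
    proof
      fix z assume "z \<in> Z - {?x}"
      then show "z \<in> {Suc ?x..<b}" using x(2)[of z] Z by auto
    qed
    moreover have "card (Z - {?x}) = m" using Z x(1) fin by simp
    ultimately have "(?x, Z - {?x}) \<in> ?D" using x(1) Z by auto
    moreover have "Z = ?f (?x, Z - {?x})" using x(1) by auto
    ultimately show "Z \<in> ?f ` ?D" by (rule rev_image_eqI)
  qed
qed

text \<open>The recursion is the coefficient of \<open>x^(N+1)\<close> in
  \<open>F = 1 + H_tree (x F)\<close>: the index \<open>m\<close> stands for a first tree on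
  \<open>m + 1\<close> leaves, and one factor \<open>x\<close> has been cancelled.\<close>

context
  fixes g :: "nat \<Rightarrow> 'k::field" and Y F :: "'k fps"
  assumes Y: "\<And>n. Y $ n = (if n = 1 then 1 else 0) + (\<Sum>d=2..n. g (Suc d) * (Y ^ d) $ n)"
    and F_0: "F $ 0 = 1"
    and F_Suc: "\<And>N. F $ Suc N =
      (\<Sum>m=0..N. ((if m = 0 then g 1 else 0) + Y $ m) * (F * (fps_X * F) ^ m) $ N)"
begin

text \<open>Marking \<open>m\<close> points of an interval creates \<open>m + 1\<close> gaps, each
  filled by a forest independently, so the sum over all positions is a coefficient of
  \<open>x^m F^(m+1)\<close>. Induction on \<open>m\<close> detaches the leftmost mark with the gap
  before it.\<close>

lemma sum_gap_codes:
  assumes IH: "\<And>a b. b - a \<le> N \<Longrightarrow>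
    finite (valid_codes {a..<b}) \<and> (\<Sum>S\<in>valid_codes {a..<b}. code_weight g S) = F $ (b - a)"
  shows "b - a \<le> N \<Longrightarrow>
    (\<forall>X. X \<subseteq> {a..<b} \<and> card X = m \<longrightarrow> finite (gap_codes X {a..<b})) \<and>
    (\<Sum>X | X \<subseteq> {a..<b} \<and> card X = m. \<Sum>S\<in>gap_codes X {a..<b}. code_weight g S) =
      (F * (fps_X * F) ^ m) $ (b - a)"
proof (induction m arbitrary: a)
  case 0
  have empty: "X \<subseteq> {a..<b} \<and> card X = 0 \<longleftrightarrow> X = {}" for X
    using finite_subset[of X "{a..<b}"] by auto
  then have "{X. X \<subseteq> {a..<b} \<and> card X = 0} = {{}}" by (simp add: singleton_def)
  then show ?case using IH[OF 0] by (simp only: empty) (simp add: gap_codes_empty)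
next
  case (Suc m)
  let ?K = "F * (fps_X * F) ^ m"
  let ?D = "SIGMA x:{a..<b}. {X. X \<subseteq> {Suc x..<b} \<and> card X = m}"
  have split: "finite (gap_codes (insert x X) {a..<b})"
    "(\<Sum>S\<in>gap_codes (insert x X) {a..<b}. code_weight g S) =
      F $ (x - a) * (\<Sum>S\<in>gap_codes X {Suc x..<b}. code_weight g S)"
    if x: "x \<in> {a..<b}" and X: "X \<subseteq> {Suc x..<b}" "card X = m" for x X
  proof -
    have V: "finite (valid_codes {a..<x})" "(\<Sum>S\<in>valid_codes {a..<x}. code_weight g S) = F $ (x - a)"
      using IH[of x a] Suc.prems x by auto
    have G: "finite (gap_codes X {Suc x..<b})" using Suc.IH[of "Suc x"] Suc.prems x X by auto
    note bij = gap_codes_split(1)[OF x X(1)]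
    show "finite (gap_codes (insert x X) {a..<b})"
      using bij_betw_finite[OF bij] V(1) G by simp
    have "(\<Sum>S\<in>gap_codes (insert x X) {a..<b}. code_weight g S) =
        (\<Sum>(S, T)\<in>valid_codes {a..<x} \<times> gap_codes X {Suc x..<b}. code_weight g (S \<union> T))"
      using sum.reindex_bij_betw[OF bij, of "code_weight g"] by (simp add: case_prod_beta)
    also have "\<dots> = (\<Sum>(S, T)\<in>valid_codes {a..<x} \<times> gap_codes X {Suc x..<b}. code_weight g S * code_weight g T)"
    proof (intro sum.cong refl, clarify)
      fix S T assume ST: "S \<in> valid_codes {a..<x}" "T \<in> gap_codes X {Suc x..<b}"
      have "finite S" "finite T" using ST valid_codesD(1) by (auto simp: gap_codes_def)
      then show "code_weight g (S \<union> T) = code_weight g S * code_weight g T"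
        using gap_codes_split(2)[OF x X(1) ST] by (rule prod.union_disjoint)
    qed
    also have "\<dots> = F $ (x - a) * (\<Sum>S\<in>gap_codes X {Suc x..<b}. code_weight g S)"
      unfolding V(2)[symmetric] sum_product sum.cartesian_product ..
    finally show "(\<Sum>S\<in>gap_codes (insert x X) {a..<b}. code_weight g S) =
      F $ (x - a) * (\<Sum>S\<in>gap_codes X {Suc x..<b}. code_weight g S)" .
  qed
  have fin: "finite (gap_codes X {a..<b})" if "X \<subseteq> {a..<b}" "card X = Suc m" for X
  proof -
    have "X \<in> (\<lambda>(x, X). insert x X) ` ?D"
      using that bij_betw_imp_surj_on[OF subsets_by_least[of a b m]] by blast
    then show ?thesis using split(1) by auto
  qed
  have "(\<Sum>X | X \<subseteq> {a..<b} \<and> card X = Suc m. \<Sum>S\<in>gap_codes X {a..<b}. code_weight g S) =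
      (\<Sum>(x, X)\<in>?D. \<Sum>S\<in>gap_codes (insert x X) {a..<b}. code_weight g S)"
    using sum.reindex_bij_betw[OF subsets_by_least[of a b m],
      of "\<lambda>X. \<Sum>S\<in>gap_codes X {a..<b}. code_weight g S"] by (simp add: case_prod_beta)
  also have "\<dots> = (\<Sum>(x, X)\<in>?D. F $ (x - a) * (\<Sum>S\<in>gap_codes X {Suc x..<b}. code_weight g S))"
    by (rule sum.cong) (use split(2) in auto)
  also have "\<dots> = (\<Sum>x\<in>{a..<b}. \<Sum>X | X \<subseteq> {Suc x..<b} \<and> card X = m.
      F $ (x - a) * (\<Sum>S\<in>gap_codes X {Suc x..<b}. code_weight g S))"
    by (rule sum.Sigma[symmetric]) auto
  also have "\<dots> = (\<Sum>x\<in>{a..<b}. F $ (x - a) * ?K $ (b - Suc x))"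
  proof (rule sum.cong[OF refl])
    fix x assume x: "x \<in> {a..<b}"
    have "(\<Sum>X | X \<subseteq> {Suc x..<b} \<and> card X = m. \<Sum>S\<in>gap_codes X {Suc x..<b}. code_weight g S) =
        ?K $ (b - Suc x)"
      using Suc.IH[of "Suc x"] Suc.prems x by auto
    then show "(\<Sum>X | X \<subseteq> {Suc x..<b} \<and> card X = m.
        F $ (x - a) * (\<Sum>S\<in>gap_codes X {Suc x..<b}. code_weight g S)) = F $ (x - a) * ?K $ (b - Suc x)"
      by (simp add: sum_distrib_left[symmetric])
  qed
  also have "\<dots> = (fps_X * (F * ?K)) $ (b - a)"
  proof (cases "b - a")
    case 0
    then show ?thesis by simp
  next
    case (Suc k)
    have "(\<Sum>x\<in>{a..<b}. F $ (x - a) * ?K $ (b - Suc x)) = (\<Sum>i=0..k. F $ i * ?K $ (k - i))"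
      by (rule sum.reindex_bij_witness[of _ "\<lambda>i. a + i" "\<lambda>x. x - a"])
        (use Suc in \<open>auto intro!: arg_cong2[where f = "(*)"] arg_cong[where f = "fps_nth _"]\<close>)
    then show ?thesis by (simp add: Suc fps_mult_nth[of F])
  qed
  also have "fps_X * (F * ?K) = F * (fps_X * F) ^ Suc m" by (simp add: ac_simps)
  finally show ?case using fin by blast
qed

lemma sum_valid_codes:
  "finite (valid_codes {a..<b}) \<and> (\<Sum>S\<in>valid_codes {a..<b}. code_weight g S) = F $ (b - a)"
proof (induction "b - a" arbitrary: a b rule: less_induct)
  case less
  show ?case
  proof (cases "a < b")
    case False
    then show ?thesis by (simp add: valid_codes_empty F_0)
  next
    case True
    let ?A = "{Suc a..<b}" and ?N = "b - Suc a"
    let ?q = "\<lambda>X. \<Sum>S\<in>gap_codes X ?A. code_weight g S"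
    let ?\<tau> = "\<lambda>m. (if m = 0 then g 1 else 0) + Y $ m"
    let ?D = "SIGMA X:Pow ?A. trees_on (sorted_list_of_set X) \<times> gap_codes X ?A"
    have IH: "finite (valid_codes {c..<d}) \<and> (\<Sum>S\<in>valid_codes {c..<d}. code_weight g S) = F $ (d - c)"
      if "d - c \<le> ?N" for c d
      using less that True by simp
    have gap: "finite (gap_codes X ?A)" if "X \<subseteq> ?A" for X
      using sum_gap_codes[where N = ?N and a = "Suc a" and b = b and m = "card X", OF IH order.refl] that by blast
    have gap_sum: "(\<Sum>X | X \<subseteq> ?A \<and> card X = m. ?q X) = (F * (fps_X * F) ^ m) $ ?N" for m
      using sum_gap_codes[where N = ?N and a = "Suc a" and b = b and m = m, OF IH order.refl] by blast
    note bij = valid_codes_decompose[OF True]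
    have finD: "finite ?D" using gap sum_trees_on(1)[of Y g, OF Y] by auto
    have trees: "(\<Sum>t\<in>trees_on (sorted_list_of_set X). weight g t) = ?\<tau> (card X)" if "X \<subseteq> ?A" for X
      using sum_trees_on(2)[of Y g "sorted_list_of_set X", OF Y] finite_subset[OF that] by simp
    have "(\<Sum>S\<in>valid_codes {a..<b}. code_weight g S) = (\<Sum>(X, t, T)\<in>?D. code_weight g (insert (a, t) T))"
      using sum.reindex_bij_betw[OF bij, of "code_weight g"] by (simp add: case_prod_beta)
    also have "\<dots> = (\<Sum>(X, t, T)\<in>?D. weight g t * code_weight g T)"
    proof (rule sum.cong[OF refl])
      fix P assume P: "P \<in> ?D"
      then obtain X t T where P': "P = (X, t, T)" "X \<subseteq> ?A" "t \<in> trees_on (sorted_list_of_set X)" "T \<in> gap_codes X ?A"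
        by auto
      have "finite T" using P'(4) valid_codesD(1) by (auto simp: gap_codes_def)
      then have "code_weight g (insert (a, t) T) = weight g t * code_weight g T"
        using insert_block(2)[OF P'(2,3,4) True] by simp
      then show "(case P of (X, t, T) \<Rightarrow> code_weight g (insert (a, t) T)) =
        (case P of (X, t, T) \<Rightarrow> weight g t * code_weight g T)" using P'(1) by simp
    qed
    also have "\<dots> = (\<Sum>X\<in>Pow ?A. \<Sum>(t, T)\<in>trees_on (sorted_list_of_set X) \<times> gap_codes X ?A. weight g t * code_weight g T)"
      by (rule sum.Sigma[symmetric]) (use gap sum_trees_on(1)[of Y g, OF Y] in auto)
    also have "\<dots> = (\<Sum>X\<in>Pow ?A. ?\<tau> (card X) * ?q X)"
    proof (rule sum.cong[OF refl])
      fix X assume "X \<in> Pow ?A"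
      then have "X \<subseteq> ?A" by simp
      show "(\<Sum>(t, T)\<in>trees_on (sorted_list_of_set X) \<times> gap_codes X ?A. weight g t * code_weight g T) = ?\<tau> (card X) * ?q X"
        unfolding trees[OF \<open>X \<subseteq> ?A\<close>, symmetric] sum_product sum.cartesian_product ..
    qed
    \<comment> \<open>The sum over the first tree depends on \<open>X\<close> only through its size,
      whereas the gap sums are known only in total over all \<open>X\<close> of one size; hence the
      grouping.\<close>
    also have "\<dots> = (\<Sum>m=0..?N. \<Sum>X\<in>{X \<in> Pow ?A. card X = m}. ?\<tau> (card X) * ?q X)"
    proof (rule sum.group[symmetric])
      show "card ` Pow ?A \<subseteq> {0..?N}"
        using card_mono[of ?A] by auto
    qed auto
    also have "\<dots> = (\<Sum>m=0..?N. ?\<tau> m * (F * (fps_X * F) ^ m) $ ?N)"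
    proof (rule sum.cong[OF refl])
      fix m
      have "(\<Sum>X\<in>{X \<in> Pow ?A. card X = m}. ?\<tau> (card X) * ?q X) =
          (\<Sum>X | X \<subseteq> ?A \<and> card X = m. ?\<tau> m * ?q X)"
        by (rule sum.cong) auto
      then show "(\<Sum>X\<in>{X \<in> Pow ?A. card X = m}. ?\<tau> (card X) * ?q X) = ?\<tau> m * (F * (fps_X * F) ^ m) $ ?N"
        unfolding gap_sum[symmetric] sum_distrib_left .
    qed
    also have "\<dots> = F $ Suc ?N" by (rule F_Suc[symmetric])
    also have "Suc ?N = b - a" using True by simp
    finally show ?thesis using bij_betw_finite[OF bij] finD by simp
  qed
qed

lemma forest_sum_coeff: "forest_sum g n = F $ n"
  using sum_valid_codes[of 1 "Suc n"] by (simp add: forest_sum_eq atLeastLessThanSuc_atLeastAtMost)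

end

lemma tree_sum_coeff:
  fixes g :: "nat \<Rightarrow> 'k::field"
  assumes "\<And>n. Y $ n = (if n = 1 then 1 else 0) + (\<Sum>d=2..n. g (Suc d) * (Y ^ d) $ n)"
  shows "tree_sum g (Suc m) = (if m = 0 then g 1 else 0) + Y $ m"
  using sum_trees_on(2)[of Y g "[2..<Suc (Suc m)]", OF assms] tree_sum_eq[of "Suc m" g]
  by (auto simp del: upt_Suc)

theorem corollary3p1:
  fixes g h :: "nat \<Rightarrow> 'k::field" and G H_forest H_tree :: "'k fps"
  assumes "\<And>n. n \<ge> 1 \<Longrightarrow> h n = forest_sum g n"
    and "G = Abs_fps (\<lambda>n. if n \<ge> 3 then g n else 0)"
    and "H_forest = 1 + Abs_fps (\<lambda>n. if n \<ge> 1 then h n else 0)"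
    and "H_tree = Abs_fps (\<lambda>n. if n \<ge> 1 then tree_sum g n else 0)"
  shows "fps_X * H_forest = fps_inv (fps_X / (1 + H_tree)) \<and>
         fps_inv (fps_X / (1 + H_tree)) =
         fps_inv (fps_X / (1 + fps_const (h 1) * fps_X + fps_X * fps_inv (fps_X - G / fps_X)))"
proof -
  let ?R = "G / fps_X" and ?U = "1 + H_tree"
  let ?V = "fps_X / ?U"
  define Y where "Y = fps_inv (fps_X - ?R)"
  have R: "?R $ n = (if n \<ge> 2 then g (Suc n) else 0)" for n
    by (simp add: assms(2))
  have Y_0: "Y $ 0 = 0" by (simp add: Y_def fps_inv_def)
  have "(fps_X - ?R) oo Y = fps_X"
    unfolding Y_def by (rule fps_inv_right) (simp_all add: R del: fps_divide_X)
  \<comment> \<open>Composing \<open>x - G / x\<close> with its inverse gives \<open>x\<close> back;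
    solved for \<open>Y\<close>, this is the tree equation.\<close>
  then have Y_eq: "Y = fps_X + (?R oo Y)"
    using Y_0 by (simp add: fps_compose_sub_distrib algebra_simps del: fps_divide_X)
  have Y: "Y $ n = (if n = 1 then 1 else 0) + (\<Sum>d=2..n. g (Suc d) * (Y ^ d) $ n)" for n
  proof -
    have "Y $ n = (if n = 1 then 1 else 0) + (\<Sum>d=0..n. ?R $ d * (Y ^ d) $ n)"
      by (subst Y_eq) (simp add: fps_compose_nth del: fps_divide_X)
    also have "(\<Sum>d=0..n. ?R $ d * (Y ^ d) $ n) = (\<Sum>d=2..n. g (Suc d) * (Y ^ d) $ n)"
      by (rule sum.mono_neutral_cong_right) (auto simp: R simp del: fps_divide_X)
    finally show ?thesis .
  qed
  have H_0: "H_tree $ 0 = 0" by (simp add: assms(4))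
  have H_Suc: "H_tree $ Suc m = (if m = 0 then g 1 else 0) + Y $ m" for m
    using tree_sum_coeff[of Y g m, OF Y] by (simp add: assms(4))
  \<comment> \<open>With \<open>F\<close> as the value of \<open>1 + H_tree\<close> at
    \<open>y\<close>, the inverse relation reads \<open>y / F = x\<close>, so \<open>y = x F\<close>
    and \<open>F = 1 + H_tree (x F)\<close>. It remains to recognise \<open>F\<close> as the forest
    series.\<close>
  define y where "y = fps_inv ?V"
  define F where "F = ?U oo y"
  have y_0: "y $ 0 = 0" by (simp add: y_def fps_inv_def)
  have V: "?V = fps_X * inverse ?U" by (rule fps_divide_unit) (simp add: H_0)
  have "?V oo y = fps_X"
    unfolding y_def by (rule fps_inv_right) (simp_all add: V H_0)
  then have "y * inverse F = fps_X"
    unfolding V F_def using y_0 H_0 by (simp add: fps_compose_mult_distrib fps_inverse_compose)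
  moreover have F_0: "F $ 0 = 1" by (simp add: F_def fps_compose_nth H_0)
  ultimately have y: "y = fps_X * F"
    by (metis inverse_mult_eq_1 mult.assoc mult.right_neutral one_neq_zero)
  have F_Suc: "F $ Suc N = (\<Sum>m=0..N. ((if m = 0 then g 1 else 0) + Y $ m) * (F * (fps_X * F) ^ m) $ N)" for N
  proof -
    have "F $ Suc N = (\<Sum>i=0..Suc N. H_tree $ i * (y ^ i) $ Suc N)"
      unfolding F_def by (simp add: fps_compose_add_distrib fps_compose_nth[of H_tree])
    also have "\<dots> = (\<Sum>m=0..N. H_tree $ Suc m * (y ^ Suc m) $ Suc N)"
      by (simp only: sum.atLeast0_atMost_Suc_shift H_0) (simp add: comp_def)
    also have "\<dots> = (\<Sum>m=0..N. ((if m = 0 then g 1 else 0) + Y $ m) * (F * (fps_X * F) ^ m) $ N)"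
    proof (rule sum.cong[OF refl])
      fix m
      have "y ^ Suc m = fps_X * (F * (fps_X * F) ^ m)" by (simp add: y ac_simps)
      then show "H_tree $ Suc m * (y ^ Suc m) $ Suc N =
          ((if m = 0 then g 1 else 0) + Y $ m) * (F * (fps_X * F) ^ m) $ N"
        by (simp add: H_Suc)
    qed
    finally show ?thesis .
  qed
  have h: "h n = F $ n" if "n \<ge> 1" for n
    using assms(1)[OF that] forest_sum_coeff[of Y g F n, OF Y F_0 F_Suc] by simp
  have "H_forest = F"
  proof (rule fps_ext)
    fix n show "H_forest $ n = F $ n"
      using h[of n] F_0 by (cases n) (simp_all add: assms(3))
  qed
  then have "fps_X * H_forest = fps_inv ?V" using y y_def by simp
  moreover have U: "?U = 1 + fps_const (h 1) * fps_X + fps_X * Y"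
  proof (rule fps_ext)
    fix n
    \<comment> \<open>Degree one is where the one-leaf tree enters: its weight \<open>g 1\<close> is
      absent from \<open>Y\<close>, and the term with \<open>h 1\<close> supplies it.\<close>
    have h1: "h 1 = g 1" using h[of 1] F_Suc[of 0] F_0 Y_0 by simp
    consider "n = 0" | "n = 1" | m where "n = Suc (Suc m)" by (metis One_nat_def not0_implies_Suc)
    then show "?U $ n = (1 + fps_const (h 1) * fps_X + fps_X * Y) $ n"
      by cases (simp_all add: H_0 H_Suc h1[simplified] Y_0)
  qed
  ultimately show ?thesis unfolding U[unfolded Y_def, symmetric] by blast
qed

end
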